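(* Let $\mathcal{C}$ be a small coherent category. The restriction of the 2-functor $L:\mathbf{Coh}_e/\mathbf{Set}\to\mathbf{DLat}$ to the fiber over $\mathcal{C}$ (objects: coherent functors $M:\mathcal{C}\to\mathbf{Set}$; arrows: the 1-cells $(1_{\mathcal{C}},\eta)$ for natural transformations $\eta:M\Rightarrow N$) is the composite $$L_{\mathcal{C}}:=\ \mathbf{Coh}(\mathcal{C},\mathbf{Set})\hookrightarrow\mathbf{Set}^{\mathcal{C}}\xrightarrow{\ Lan_Y Sub_{\mathcal{C}}\ }\mathbf{DLat},$$ where $Lan_Y Sub_{\mathcal{C}}$ is the left Kan extension of $Sub_{\mathcal{C}}:\mathcal{C}^{op}\to\mathbf{DLat}$ along the Yoneda embedding $Y:\mathcal{C}^{op}\to\mathbf{Set}^{\mathcal{C}}$, $x\mapsto\mathcal{C}(x,-)$.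
   Context: $\mathbf{DLat}$ is the category of (bounded) distributive lattices, regarded as a 2-category with only identity 2-cells. $Sub_{\mathcal{C}}:\mathcal{C}^{op}\to\mathbf{DLat}$ sends $x$ to its lattice of subobjects and $f$ to pullback $f^*$. $\mathbf{Coh}(\mathcal{C},\mathbf{Set})$ is the category of coherent functors and all natural transformations. Elementary natural transformation: one whose naturality squares at monomorphisms are pullbacks. $\mathbf{Coh}_e/\mathbf{Set}$ is the strict 2-category whose objects are coherent functors $M:\mathcal{C}\to\mathbf{Set}$ ($\mathcal{C}$ a coherent category); whose 1-cells from $M:\mathcal{C}\to\mathbf{Set}$ to $N:\mathcal{D}\to\mathbf{Set}$ are pairs $(F:\mathcal{C}\to\mathcal{D},\ \eta_F:M\Rightarrow NF)$ with $F$ coherent and $\eta_F$ an arbitrary natural transformation; and whose 2-cells $(F,\eta_F)\to(G,\eta_G)$ are elementary natural transformations $\alpha:F\Rightarrow G$ with $N\alpha\circ\eta_F=\eta_G$. The 2-functor $L$: on objects, $LM=\mathrm{colim}\big((\int M)^{op}\to\mathcal{C}^{op}\xrightarrow{Sub_{\mathcal{C}}}\mathbf{DLat}\big)$, where $\int M$ is the category of elements (objects $(x,a)$ with $a\in Mx$; arrows $(x,a)\to(y,b)$ are $f:x\to y$ with $Mf(a)=b$). Write $Sub_{\mathcal{C}}(x)^a$ for the copy of $Sub_{\mathcal{C}}(x)$ in the diagram at $(x,a)$. On a 1-cell $(F,\eta_F)$, $L((F,\eta_F)):LM\to LN$ is induced by the composites $Sub_{\mathcal{C}}(x)^a\xrightarrow{F}Sub_{\mathcal{D}}(Fx)^{\eta_{F,x}(a)}\to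 LN$, where the last map is the colimit cocone map; if there is a 2-cell between two 1-cells, their images under $L$ agree. The left Kan extension is computed by the same pointwise colimits. *)

theory Defs
  imports "HOL-Library.FuncSet" "HOL-Algebra.Lattice"
begin

text \<open>
  Size conventions. A type \<open>'u\<close> plays the role of the universe: the arrows of a small category
  and the elements of the sets in the category of sets are taken from \<open>'u\<close>, and the lattices in
  the category of distributive lattices have carriers in \<open>'u set\<close> (a subobject is an equivalence
  class of monomorphisms, hence a set of arrows). The statement assumes \<open>'u\<close> to be infinite, which
  makes the category of sets over \<open>'u\<close> coherent and leaves room for the colimits of lattices.
  Maps that are part of a functor, a natural transformation or an arrow are extensional
  (\<open>undefined\<close> outside their domain), so that equality of HOL terms is the intended equality.
\<close>


section \<open>Categories, functors, natural transformations\<close>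

record ('o, 'm) cat =
  Obj :: "'o set"
  Arr :: "'m set"
  Dom :: "'m \<Rightarrow> 'o"
  Cod :: "'m \<Rightarrow> 'o"
  Ident :: "'o \<Rightarrow> 'm"
  Comp :: "'m \<Rightarrow> 'm \<Rightarrow> 'm"  (infixl "\<cdot>\<index>" 70)

definition hom :: "('o, 'm, 'z) cat_scheme \<Rightarrow> 'o \<Rightarrow> 'o \<Rightarrow> 'm set" where
  "hom C x y = {f \<in> Arr C. Dom C f = x \<and> Cod C f = y}"

locale category =
  fixes C :: "('o, 'm, 'z) cat_scheme" (structure)
  assumes Dom_in: "f \<in> Arr C \<Longrightarrow> Dom C f \<in> Obj C"
    and Cod_in: "f \<in> Arr C \<Longrightarrow> Cod C f \<in> Obj C"
    and Ident_in: "x \<in> Obj C \<Longrightarrow> Ident C x \<in> hom C x x"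
    and Comp_in: "f \<in> hom C x y \<Longrightarrow> g \<in> hom C y z \<Longrightarrow> g \<cdot> f \<in> hom C x z"
    and Ident_left: "f \<in> hom C x y \<Longrightarrow> Ident C y \<cdot> f = f"
    and Ident_right: "f \<in> hom C x y \<Longrightarrow> f \<cdot> Ident C x = f"
    and Comp_assoc: "f \<in> hom C w x \<Longrightarrow> g \<in> hom C x y \<Longrightarrow> h \<in> hom C y z \<Longrightarrow>
      h \<cdot> (g \<cdot> f) = (h \<cdot> g) \<cdot> f"

definition op_cat :: "('o, 'm, 'z) cat_scheme \<Rightarrow> ('o, 'm) cat" where
  "op_cat C = \<lparr>Obj = Obj C, Arr = Arr C, Dom = Cod C, Cod = Dom C, Ident = Ident C,
     Comp = (\<lambda>g f. f \<cdot>\<^bsub>C\<^esub> g)\<rparr>"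

record ('o, 'm, 'p, 'n) func =
  FObj :: "'o \<Rightarrow> 'p"
  FArr :: "'m \<Rightarrow> 'n"

locale is_functor = source: category C + target: category D
  for C :: "('o, 'm, 'y) cat_scheme" and D :: "('p, 'n, 'z) cat_scheme"
    and F :: "('o, 'm, 'p, 'n, 'w) func_scheme" +
  assumes FObj_ext: "FObj F \<in> extensional (Obj C)"
    and FArr_ext: "FArr F \<in> extensional (Arr C)"
    and FObj_in: "x \<in> Obj C \<Longrightarrow> FObj F x \<in> Obj D"
    and FArr_in: "f \<in> hom C x y \<Longrightarrow> FArr F f \<in> hom D (FObj F x) (FObj F y)"
    and FArr_Ident: "x \<in> Obj C \<Longrightarrow> FArr F (Ident C x) = Ident D (FObj F x)"
    and FArr_Comp: "f \<in> hom C x y \<Longrightarrow> g \<in> hom C y z \<Longrightarrow>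
      FArr F (g \<cdot>\<^bsub>C\<^esub> f) = FArr F g \<cdot>\<^bsub>D\<^esub> FArr F f"

definition id_functor :: "('o, 'm, 'z) cat_scheme \<Rightarrow> ('o, 'm, 'o, 'm) func" where
  "id_functor C = \<lparr>FObj = (\<lambda>x\<in>Obj C. x), FArr = (\<lambda>f\<in>Arr C. f)\<rparr>"

text \<open>\<open>comp_functor A G F\<close> is \<open>G \<circ> F\<close>, where \<open>A\<close> is the source category of \<open>F\<close>.\<close>

definition comp_functor :: "('o, 'm, 'z) cat_scheme \<Rightarrow> ('p, 'n, 'q, 'k, 'w) func_scheme \<Rightarrow>
    ('o, 'm, 'p, 'n, 'v) func_scheme \<Rightarrow> ('o, 'm, 'q, 'k) func" where
  "comp_functor A G F =
     \<lparr>FObj = compose (Obj A) (FObj G) (FObj F), FArr = compose (Arr A) (FArr G) (FArr F)\<rparr>"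

locale nat_trans = F: is_functor C D F + G: is_functor C D G
  for C :: "('o, 'm, 'y) cat_scheme" and D :: "('p, 'n, 'z) cat_scheme"
    and F :: "('o, 'm, 'p, 'n) func" and G :: "('o, 'm, 'p, 'n) func" and \<eta> :: "'o \<Rightarrow> 'n" +
  assumes ext: "\<eta> \<in> extensional (Obj C)"
    and component_in: "x \<in> Obj C \<Longrightarrow> \<eta> x \<in> hom D (FObj F x) (FObj G x)"
    and naturality: "f \<in> hom C x y \<Longrightarrow> \<eta> y \<cdot>\<^bsub>D\<^esub> FArr F f = FArr G f \<cdot>\<^bsub>D\<^esub> \<eta> x"

definition is_iso :: "('o, 'm, 'z) cat_scheme \<Rightarrow> 'm \<Rightarrow> bool" where
  "is_iso C f \<longleftrightarrow> f \<in> Arr C \<and> (\<exists>g \<in> hom C (Cod C f) (Dom C f).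
     g \<cdot>\<^bsub>C\<^esub> f = Ident C (Dom C f) \<and> f \<cdot>\<^bsub>C\<^esub> g = Ident C (Cod C f))"

definition naturally_isomorphic :: "('o, 'm, 'y) cat_scheme \<Rightarrow> ('p, 'n, 'z) cat_scheme \<Rightarrow>
    ('o, 'm, 'p, 'n) func \<Rightarrow> ('o, 'm, 'p, 'n) func \<Rightarrow> bool" where
  "naturally_isomorphic C D F G \<longleftrightarrow>
     (\<exists>\<eta>. nat_trans C D F G \<eta> \<and> (\<forall>x \<in> Obj C. is_iso D (\<eta> x)))"

text \<open>Arrows of concrete categories carry their source and target, as these cannot be recovered
  from the underlying map.\<close>

datatype ('a, 'f) arrow = Arrow (src: 'a) (tgt: 'a) (fn: 'f)

definition functor_category :: "('o, 'm, 'y) cat_scheme \<Rightarrow> ('p, 'n, 'z) cat_scheme \<Rightarrow>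
    (('o, 'm, 'p, 'n) func, (('o, 'm, 'p, 'n) func, 'o \<Rightarrow> 'n) arrow) cat" where
  "functor_category C D =
     \<lparr>Obj = {F. is_functor C D F},
      Arr = {t. nat_trans C D (src t) (tgt t) (fn t)},
      Dom = src,
      Cod = tgt,
      Ident = (\<lambda>F. Arrow F F (\<lambda>x\<in>Obj C. Ident D (FObj F x))),
      Comp = (\<lambda>t s. Arrow (src s) (tgt t) (\<lambda>x\<in>Obj C. fn t x \<cdot>\<^bsub>D\<^esub> fn s x))\<rparr>"

definition full_subcategory :: "('o, 'm) cat \<Rightarrow> ('o \<Rightarrow> bool) \<Rightarrow> ('o, 'm) cat" where
  "full_subcategory C P = C\<lparr>Obj := {x \<in> Obj C. P x}, Arr := {f \<in> Arr C. P (Dom C f) \<and> P (Cod C f)}\<rparr>"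


section \<open>Colimits and left Kan extensions\<close>

text \<open>\<open>D\<close> is a diagram of shape \<open>J\<close> in \<open>E\<close>, \<open>X\<close> the tip of the cocone and \<open>\<iota>\<close> its legs.\<close>

definition is_cocone :: "('j, 'i, 'y) cat_scheme \<Rightarrow> ('o, 'm, 'z) cat_scheme \<Rightarrow>
    ('j, 'i, 'o, 'm) func \<Rightarrow> 'o \<Rightarrow> ('j \<Rightarrow> 'm) \<Rightarrow> bool" where
  "is_cocone J E D X \<iota> \<longleftrightarrow> X \<in> Obj E \<and> (\<forall>j \<in> Obj J. \<iota> j \<in> hom E (FObj D j) X) \<and>
     (\<forall>f \<in> Arr J. \<iota> (Cod J f) \<cdot>\<^bsub>E\<^esub> FArr D f = \<iota> (Dom J f))"

definition is_colimit :: "('j, 'i, 'y) cat_scheme \<Rightarrow> ('o, 'm, 'z) cat_scheme \<Rightarrow>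
    ('j, 'i, 'o, 'm) func \<Rightarrow> 'o \<Rightarrow> ('j \<Rightarrow> 'm) \<Rightarrow> bool" where
  "is_colimit J E D X \<iota> \<longleftrightarrow> is_functor J E D \<and> is_cocone J E D X \<iota> \<and>
     (\<forall>Y \<kappa>. is_cocone J E D Y \<kappa> \<longrightarrow> (\<exists>!h. h \<in> hom E X Y \<and> (\<forall>j \<in> Obj J. h \<cdot>\<^bsub>E\<^esub> \<iota> j = \<kappa> j)))"

text \<open>A choice of colimits: the object together with the cocone maps.\<close>

definition colimit :: "('j, 'i, 'y) cat_scheme \<Rightarrow> ('o, 'm, 'z) cat_scheme \<Rightarrow>
    ('j, 'i, 'o, 'm) func \<Rightarrow> 'o \<times> ('j \<Rightarrow> 'm)" where
  "colimit J E D = (SOME (X, \<iota>). is_colimit J E D X \<iota>)"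

text \<open>\<open>(K, u)\<close> with \<open>u : F \<Rightarrow> K Y\<close> is a left Kan extension of \<open>F : A \<rightarrow> E\<close> along \<open>Y : A \<rightarrow> B\<close>.\<close>

definition is_left_kan_extension :: "('a, 'f, 'x) cat_scheme \<Rightarrow> ('b, 'g, 'y) cat_scheme \<Rightarrow>
    ('e, 'h, 'z) cat_scheme \<Rightarrow> ('a, 'f, 'b, 'g) func \<Rightarrow> ('a, 'f, 'e, 'h) func \<Rightarrow>
    ('b, 'g, 'e, 'h) func \<Rightarrow> ('a \<Rightarrow> 'h) \<Rightarrow> bool" where
  "is_left_kan_extension A B E Y F K u \<longleftrightarrow>
     is_functor A B Y \<and> is_functor A E F \<and> is_functor B E K \<and>
     nat_trans A E F (comp_functor A K Y) u \<and>
     (\<forall>G \<gamma>. is_functor B E G \<and> nat_trans A E F (comp_functor A G Y) \<gamma> \<longrightarrow>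
        (\<exists>!\<sigma>. nat_trans B E K G \<sigma> \<and> (\<forall>x \<in> Obj A. \<sigma> (FObj Y x) \<cdot>\<^bsub>E\<^esub> u x = \<gamma> x)))"


section \<open>Subobjects\<close>

definition is_mono :: "('o, 'm, 'z) cat_scheme \<Rightarrow> 'm \<Rightarrow> bool" where
  "is_mono C m \<longleftrightarrow> m \<in> Arr C \<and> (\<forall>w. \<forall>f \<in> hom C w (Dom C m). \<forall>g \<in> hom C w (Dom C m).
     m \<cdot>\<^bsub>C\<^esub> f = m \<cdot>\<^bsub>C\<^esub> g \<longrightarrow> f = g)"

definition factors_through :: "('o, 'm, 'z) cat_scheme \<Rightarrow> 'm \<Rightarrow> 'm \<Rightarrow> bool" where
  "factors_through C f m \<longleftrightarrow> f \<in> Arr C \<and> m \<in> Arr C \<and> Cod C f = Cod C m \<and>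
     (\<exists>k \<in> hom C (Dom C f) (Dom C m). f = m \<cdot>\<^bsub>C\<^esub> k)"

text \<open>The subobject represented by a monomorphism \<open>m\<close>: all monomorphisms isomorphic to \<open>m\<close> over
  its codomain.\<close>

definition subobject :: "('o, 'm, 'z) cat_scheme \<Rightarrow> 'm \<Rightarrow> 'm set" where
  "subobject C m = {n. is_mono C n \<and> factors_through C m n \<and> factors_through C n m}"

definition Sub :: "('o, 'm, 'z) cat_scheme \<Rightarrow> 'o \<Rightarrow> 'm set gorder" where
  "Sub C x = \<lparr>carrier = {subobject C m | m. is_mono C m \<and> Cod C m = x},
     eq = (=),
     le = (\<lambda>S T. \<exists>m \<in> S. \<exists>n \<in> T. factors_through C m n)\<rparr>"

text \<open>The square with sides \<open>p\<close>, \<open>q\<close> over the cospan \<open>f\<close>, \<open>g\<close> is a pullback.\<close>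

definition is_pullback :: "('o, 'm, 'z) cat_scheme \<Rightarrow> 'm \<Rightarrow> 'm \<Rightarrow> 'm \<Rightarrow> 'm \<Rightarrow> bool" where
  "is_pullback C f g p q \<longleftrightarrow>
     f \<in> Arr C \<and> g \<in> Arr C \<and> Cod C f = Cod C g \<and>
     p \<in> hom C (Dom C p) (Dom C f) \<and> q \<in> hom C (Dom C p) (Dom C g) \<and>
     f \<cdot>\<^bsub>C\<^esub> p = g \<cdot>\<^bsub>C\<^esub> q \<and>
     (\<forall>w. \<forall>p' \<in> hom C w (Dom C f). \<forall>q' \<in> hom C w (Dom C g). f \<cdot>\<^bsub>C\<^esub> p' = g \<cdot>\<^bsub>C\<^esub> q' \<longrightarrow>
        (\<exists>!h. h \<in> hom C w (Dom C p) \<and> p \<cdot>\<^bsub>C\<^esub> h = p' \<and> q \<cdot>\<^bsub>C\<^esub> h = q'))"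

text \<open>The pullback \<open>f\<^sup>* S\<close> of a subobject: all pullbacks of representatives of \<open>S\<close> along \<open>f\<close>. These
  form a single equivalence class of monomorphisms.\<close>

definition pull :: "('o, 'm, 'z) cat_scheme \<Rightarrow> 'm \<Rightarrow> 'm set \<Rightarrow> 'm set" where
  "pull C f S = {p. \<exists>m \<in> S. \<exists>q. is_pullback C f m p q}"

text \<open>The image of a subobject under a functor that preserves monomorphisms.\<close>

definition sub_image :: "('p, 'n, 'z) cat_scheme \<Rightarrow> ('o, 'm, 'p, 'n) func \<Rightarrow> 'm set \<Rightarrow> 'n set" where
  "sub_image D F S = (\<Union>m \<in> S. subobject D (FArr F m))"


section \<open>Coherent categories and coherent functors\<close>

definition is_terminal :: "('o, 'm, 'z) cat_scheme \<Rightarrow> 'o \<Rightarrow> bool" where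
  "is_terminal C t \<longleftrightarrow> t \<in> Obj C \<and> (\<forall>x \<in> Obj C. \<exists>!f. f \<in> hom C x t)"

definition is_image :: "('o, 'm, 'z) cat_scheme \<Rightarrow> 'm \<Rightarrow> 'm \<Rightarrow> bool" where
  "is_image C f m \<longleftrightarrow> is_mono C m \<and> factors_through C f m \<and>
     (\<forall>n. is_mono C n \<and> factors_through C f n \<longrightarrow> factors_through C m n)"

text \<open>A cover factors through no proper subobject of its codomain. In a regular category the covers
  are the regular epimorphisms.\<close>

definition is_cover :: "('o, 'm, 'z) cat_scheme \<Rightarrow> 'm \<Rightarrow> bool" where
  "is_cover C e \<longleftrightarrow> e \<in> Arr C \<and> (\<forall>m. is_mono C m \<and> factors_through C e m \<longrightarrow> is_iso C m)"

definition is_union :: "('o, 'm, 'z) cat_scheme \<Rightarrow> 'o \<Rightarrow> 'm set set \<Rightarrow> 'm set \<Rightarrow> bool" where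
  "is_union C x \<A> S \<longleftrightarrow> least (Sub C x) S (Upper (Sub C x) \<A>)"

text \<open>Finite limits are given by a terminal object and pullbacks. A regular category has finite
  limits and images, and covers are stable under pullback; a coherent category moreover has finite
  unions of subobjects (including the empty union), stable under pullback.\<close>

locale coherent_category = category C
  for C :: "('o, 'm, 'z) cat_scheme" (structure) +
  assumes terminal: "\<exists>t. is_terminal C t"
    and pullbacks: "f \<in> Arr C \<Longrightarrow> g \<in> Arr C \<Longrightarrow> Cod C f = Cod C g \<Longrightarrow> \<exists>p q. is_pullback C f g p q"
    and images: "f \<in> Arr C \<Longrightarrow> \<exists>m. is_image C f m"
    and covers_stable: "is_cover C e \<Longrightarrow> is_pullback C f e p q \<Longrightarrow> is_cover C p"
    and unions: "x \<in> Obj C \<Longrightarrow> finite \<A> \<Longrightarrow> \<A> \<subseteq> carrier (Sub C x) \<Longrightarrow> \<exists>S. is_union C x \<A> S"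
    and unions_stable: "f \<in> hom C y x \<Longrightarrow> finite \<A> \<Longrightarrow> \<A> \<subseteq> carrier (Sub C x) \<Longrightarrow>
      is_union C x \<A> S \<Longrightarrow> is_union C y (pull C f ` \<A>) (pull C f S)"

locale coherent_functor = is_functor C D F
  for C :: "('o, 'm, 'y) cat_scheme" and D :: "('p, 'n, 'z) cat_scheme"
    and F :: "('o, 'm, 'p, 'n) func" +
  assumes pres_terminal: "is_terminal C t \<Longrightarrow> is_terminal D (FObj F t)"
    and pres_pullbacks: "is_pullback C f g p q \<Longrightarrow>
      is_pullback D (FArr F f) (FArr F g) (FArr F p) (FArr F q)"
    and pres_covers: "is_cover C e \<Longrightarrow> is_cover D (FArr F e)"
    and pres_unions: "x \<in> Obj C \<Longrightarrow> finite \<A> \<Longrightarrow> \<A> \<subseteq> carrier (Sub C x) \<Longrightarrow> is_union C x \<A> S \<Longrightarrow>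
      is_union D (FObj F x) (sub_image D F ` \<A>) (sub_image D F S)"


section \<open>Sets and distributive lattices\<close>

definition SetCat :: "('u set, ('u set, 'u \<Rightarrow> 'u) arrow) cat" where
  "SetCat =
     \<lparr>Obj = UNIV,
      Arr = {f. fn f \<in> src f \<rightarrow>\<^sub>E tgt f},
      Dom = src,
      Cod = tgt,
      Ident = (\<lambda>A. Arrow A A (\<lambda>a\<in>A. a)),
      Comp = (\<lambda>g f. Arrow (src f) (tgt g) (compose (src f) (fn g) (fn f)))\<rparr>"

type_synonym ('o, 'u) set_functor = "('o, 'u, 'u set, ('u set, 'u \<Rightarrow> 'u) arrow) func"

definition distributive_lattice :: "'v gorder \<Rightarrow> bool" where
  "distributive_lattice L \<longleftrightarrow> bounded_lattice L \<and>
     (\<forall>a \<in> carrier L. \<forall>b \<in> carrier L. \<forall>c \<in> carrier L.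
        a \<sqinter>\<^bsub>L\<^esub> (b \<squnion>\<^bsub>L\<^esub> c) = (a \<sqinter>\<^bsub>L\<^esub> b) \<squnion>\<^bsub>L\<^esub> (a \<sqinter>\<^bsub>L\<^esub> c))"

definition bounded_lattice_hom :: "'v gorder \<Rightarrow> 'v gorder \<Rightarrow> ('v \<Rightarrow> 'v) \<Rightarrow> bool" where
  "bounded_lattice_hom L K h \<longleftrightarrow> h \<in> carrier L \<rightarrow>\<^sub>E carrier K \<and>
     meet_pres L K h \<and> join_pres L K h \<and> h \<top>\<^bsub>L\<^esub> = \<top>\<^bsub>K\<^esub> \<and> h \<bottom>\<^bsub>L\<^esub> = \<bottom>\<^bsub>K\<^esub>"

record ('o, 'm, 't) two_cat = "('o, 'm) cat" +
  Two :: "'t set"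
  Src :: "'t \<Rightarrow> 'm"
  Tgt :: "'t \<Rightarrow> 'm"
  VIdent :: "'m \<Rightarrow> 't"
  VComp :: "'t \<Rightarrow> 't \<Rightarrow> 't"
  HComp :: "'t \<Rightarrow> 't \<Rightarrow> 't"

text \<open>The only 2-cells of \<open>DLat\<close> are identities, so a 2-cell is represented by its 1-cell.\<close>

definition DLat :: "('v gorder, ('v gorder, 'v \<Rightarrow> 'v) arrow, ('v gorder, 'v \<Rightarrow> 'v) arrow) two_cat" where
  "DLat =
     (let arrs = {h. distributive_lattice (src h) \<and> distributive_lattice (tgt h) \<and>
                     bounded_lattice_hom (src h) (tgt h) (fn h)};
          comp = (\<lambda>g f. Arrow (src f) (tgt g) (compose (carrier (src f)) (fn g) (fn f)))
      in \<lparr>Obj = {L. distributive_lattice L},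
          Arr = arrs,
          Dom = src,
          Cod = tgt,
          Ident = (\<lambda>L. Arrow L L (\<lambda>a\<in>carrier L. a)),
          Comp = comp,
          Two = arrs, Src = (\<lambda>h. h), Tgt = (\<lambda>h. h), VIdent = (\<lambda>h. h), VComp = (\<lambda>h g. g),
          HComp = comp\<rparr>)"

definition Sub_functor :: "('o, 'u, 'z) cat_scheme \<Rightarrow>
    ('o, 'u, 'u set gorder, ('u set gorder, 'u set \<Rightarrow> 'u set) arrow) func" where
  "Sub_functor C =
     \<lparr>FObj = (\<lambda>x\<in>Obj C. Sub C x),
      FArr = (\<lambda>f\<in>Arr C. Arrow (Sub C (Cod C f)) (Sub C (Dom C f))
                (\<lambda>S\<in>carrier (Sub C (Cod C f)). pull C f S))\<rparr>"

text \<open>The lattice homomorphism from \<open>Sub C x\<close> to \<open>Sub D (F x)\<close> induced by a coherent functor.\<close>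

definition Sub_map :: "('o, 'u, 'y) cat_scheme \<Rightarrow> ('p, 'u, 'z) cat_scheme \<Rightarrow> ('o, 'u, 'p, 'u) func \<Rightarrow>
    'o \<Rightarrow> ('u set gorder, 'u set \<Rightarrow> 'u set) arrow" where
  "Sub_map C D F x =
     Arrow (Sub C x) (Sub D (FObj F x)) (\<lambda>S\<in>carrier (Sub C x). sub_image D F S)"


section \<open>The 2-category of coherent functors to sets\<close>

type_synonym ('o, 'u) model = "('o, 'u) cat \<times> ('o, 'u) set_functor"

type_synonym ('o, 'u) model_map =
  "(('o, 'u) model, ('o, 'u, 'o, 'u) func \<times> ('o \<Rightarrow> ('u set, 'u \<Rightarrow> 'u) arrow)) arrow"

type_synonym ('o, 'u) model_2cell = "(('o, 'u) model_map, 'o \<Rightarrow> 'u) arrow"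

definition elementary :: "('o, 'm, 'y) cat_scheme \<Rightarrow> ('p, 'n, 'z) cat_scheme \<Rightarrow>
    ('o, 'm, 'p, 'n) func \<Rightarrow> ('o, 'm, 'p, 'n) func \<Rightarrow> ('o \<Rightarrow> 'n) \<Rightarrow> bool" where
  "elementary C D F G \<alpha> \<longleftrightarrow> nat_trans C D F G \<alpha> \<and>
     (\<forall>m. is_mono C m \<longrightarrow>
        is_pullback D (\<alpha> (Cod C m)) (FArr G m) (FArr F m) (\<alpha> (Dom C m)))"

fun is_model_map :: "('o, 'u) model_map \<Rightarrow> bool" where
  "is_model_map (Arrow (C, M) (D, N) (F, \<eta>)) \<longleftrightarrow>
     coherent_category C \<and> coherent_functor C SetCat M \<and>
     coherent_category D \<and> coherent_functor D SetCat N \<and>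
     coherent_functor C D F \<and> nat_trans C SetCat M (comp_functor C N F) \<eta>"

fun model_id :: "('o, 'u) model \<Rightarrow> ('o, 'u) model_map" where
  "model_id (C, M) = Arrow (C, M) (C, M) (id_functor C, \<lambda>x\<in>Obj C. Ident SetCat (FObj M x))"

fun model_comp :: "('o, 'u) model_map \<Rightarrow> ('o, 'u) model_map \<Rightarrow> ('o, 'u) model_map" where
  "model_comp (Arrow Y Z (G, \<theta>)) (Arrow (C, M) Y' (F, \<eta>)) =
     Arrow (C, M) Z (comp_functor C G F, \<lambda>x\<in>Obj C. \<theta> (FObj F x) \<cdot>\<^bsub>SetCat\<^esub> \<eta> x)"

fun is_model_2cell :: "('o, 'u) model_2cell \<Rightarrow> bool" where
  "is_model_2cell (Arrow (Arrow (C, M) (D, N) (F, \<eta>)) (Arrow X Y (G, \<theta>)) \<alpha>) \<longleftrightarrow>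
     X = (C, M) \<and> Y = (D, N) \<and>
     is_model_map (Arrow (C, M) (D, N) (F, \<eta>)) \<and> is_model_map (Arrow (C, M) (D, N) (G, \<theta>)) \<and>
     elementary C D F G \<alpha> \<and> (\<forall>x \<in> Obj C. FArr N (\<alpha> x) \<cdot>\<^bsub>SetCat\<^esub> \<eta> x = \<theta> x)"

fun model_2id :: "('o, 'u) model_map \<Rightarrow> ('o, 'u) model_2cell" where
  "model_2id (Arrow (C, M) (D, N) (F, \<eta>)) =
     (let f = Arrow (C, M) (D, N) (F, \<eta>) in Arrow f f (\<lambda>x\<in>Obj C. Ident D (FObj F x)))"

fun model_vcomp :: "('o, 'u) model_2cell \<Rightarrow> ('o, 'u) model_2cell \<Rightarrow> ('o, 'u) model_2cell" where
  "model_vcomp (Arrow g' h \<beta>) (Arrow (Arrow (C, M) (D, N) t) g \<alpha>) =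
     Arrow (Arrow (C, M) (D, N) t) h (\<lambda>x\<in>Obj C. \<beta> x \<cdot>\<^bsub>D\<^esub> \<alpha> x)"

text \<open>Horizontal composition of \<open>\<alpha> : F \<Rightarrow> G\<close> and \<open>\<beta> : H \<Rightarrow> K\<close> has components
  \<open>\<beta>\<^bsub>G x\<^esub> \<cdot> H \<alpha>\<^bsub>x\<^esub>\<close>.\<close>

fun model_hcomp :: "('o, 'u) model_2cell \<Rightarrow> ('o, 'u) model_2cell \<Rightarrow> ('o, 'u) model_2cell" where
  "model_hcomp (Arrow (Arrow X (E, P) (H, \<theta>)) k \<beta>) (Arrow (Arrow (C, M) Y t) (Arrow V W (G, \<zeta>)) \<alpha>) =
     Arrow (model_comp (Arrow X (E, P) (H, \<theta>)) (Arrow (C, M) Y t)) (model_comp k (Arrow V W (G, \<zeta>)))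
       (\<lambda>x\<in>Obj C. \<beta> (FObj G x) \<cdot>\<^bsub>E\<^esub> FArr H (\<alpha> x))"

definition Coh_e_Set :: "(('o, 'u) model, ('o, 'u) model_map, ('o, 'u) model_2cell) two_cat" where
  "Coh_e_Set =
     \<lparr>Obj = {(C, M). coherent_category C \<and> coherent_functor C SetCat M},
      Arr = {f. is_model_map f},
      Dom = src,
      Cod = tgt,
      Ident = model_id,
      Comp = model_comp,
      Two = {\<alpha>. is_model_2cell \<alpha>}, Src = src, Tgt = tgt,
      VIdent = model_2id, VComp = model_vcomp, HComp = model_hcomp\<rparr>"


section \<open>The 2-functor to distributive lattices\<close>

definition elements :: "('o, 'u) cat \<Rightarrow> ('o, 'u) set_functor \<Rightarrow>
    ('o \<times> 'u, ('o \<times> 'u, 'u) arrow) cat" where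
  "elements C M =
     \<lparr>Obj = {(x, a). x \<in> Obj C \<and> a \<in> FObj M x},
      Arr = {Arrow (x, a) (y, b) f | x a y b f.
               f \<in> hom C x y \<and> a \<in> FObj M x \<and> b \<in> FObj M y \<and> fn (FArr M f) a = b},
      Dom = src,
      Cod = tgt,
      Ident = (\<lambda>(x, a). Arrow (x, a) (x, a) (Ident C x)),
      Comp = (\<lambda>g f. Arrow (src f) (tgt g) (fn g \<cdot>\<^bsub>C\<^esub> fn f))\<rparr>"

definition elements_proj :: "('o, 'u) cat \<Rightarrow> ('o, 'u) set_functor \<Rightarrow>
    ('o \<times> 'u, ('o \<times> 'u, 'u) arrow, 'o, 'u) func" where
  "elements_proj C M =
     \<lparr>FObj = (\<lambda>p\<in>Obj (elements C M). fst p), FArr = (\<lambda>f\<in>Arr (elements C M). fn f)\<rparr>"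

definition Sub_diagram :: "('o, 'u) cat \<Rightarrow> ('o, 'u) set_functor \<Rightarrow>
    ('o \<times> 'u, ('o \<times> 'u, 'u) arrow, 'u set gorder, ('u set gorder, 'u set \<Rightarrow> 'u set) arrow) func" where
  "Sub_diagram C M = comp_functor (op_cat (elements C M)) (Sub_functor C) (elements_proj C M)"

definition L_obj :: "('o, 'u) model \<Rightarrow> 'u set gorder" where
  "L_obj = (\<lambda>(C, M). fst (colimit (op_cat (elements C M)) DLat (Sub_diagram C M)))"

definition L_in :: "('o, 'u) model \<Rightarrow> 'o \<times> 'u \<Rightarrow> ('u set gorder, 'u set \<Rightarrow> 'u set) arrow" where
  "L_in = (\<lambda>(C, M). snd (colimit (op_cat (elements C M)) DLat (Sub_diagram C M)))"

fun L_arr :: "('o, 'u) model_map \<Rightarrow> ('u set gorder, 'u set \<Rightarrow> 'u set) arrow" where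
  "L_arr (Arrow (C, M) (D, N) (F, \<eta>)) =
     (THE h. h \<in> hom DLat (L_obj (C, M)) (L_obj (D, N)) \<and>
        (\<forall>(x, a) \<in> Obj (elements C M).
           h \<cdot>\<^bsub>DLat\<^esub> L_in (C, M) (x, a) =
           L_in (D, N) (FObj F x, fn (\<eta> x) a) \<cdot>\<^bsub>DLat\<^esub> Sub_map C D F x))"

record ('o, 'm, 't, 'p, 'n, 's) two_func = "('o, 'm, 'p, 'n) func" +
  FTwo :: "'t \<Rightarrow> 's"

definition L_functor :: "(('o, 'u) model, ('o, 'u) model_map, ('o, 'u) model_2cell, 'u set gorder,
    ('u set gorder, 'u set \<Rightarrow> 'u set) arrow, ('u set gorder, 'u set \<Rightarrow> 'u set) arrow) two_func" where
  "L_functor =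
     \<lparr>FObj = (\<lambda>X\<in>Obj Coh_e_Set. L_obj X),
      FArr = (\<lambda>f\<in>Arr Coh_e_Set. L_arr f),
      FTwo = (\<lambda>\<alpha>\<in>Two Coh_e_Set. VIdent DLat (L_arr (Src Coh_e_Set \<alpha>)))\<rparr>"


section \<open>The fibre over a coherent category and the Yoneda embedding\<close>

abbreviation Set_functors :: "('o, 'u) cat \<Rightarrow>
    (('o, 'u) set_functor, (('o, 'u) set_functor, 'o \<Rightarrow> ('u set, 'u \<Rightarrow> 'u) arrow) arrow) cat" where
  "Set_functors C \<equiv> functor_category C SetCat"

definition Coh :: "('o, 'u) cat \<Rightarrow>
    (('o, 'u) set_functor, (('o, 'u) set_functor, 'o \<Rightarrow> ('u set, 'u \<Rightarrow> 'u) arrow) arrow) cat" where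
  "Coh C = full_subcategory (Set_functors C) (coherent_functor C SetCat)"

text \<open>The inclusion of \<open>Coh C\<close> into \<open>Set_functors C\<close> is \<open>id_functor (Coh C)\<close>, since the former is a
  subcategory of the latter. The fibre over \<open>C\<close> is included in \<open>Coh_e_Set\<close> by sending \<open>M\<close> to
  \<open>(C, M)\<close> and \<open>\<eta> : M \<Rightarrow> N\<close> to the 1-cell \<open>(1\<^bsub>C\<^esub>, \<eta>)\<close>.\<close>

definition fibre_inclusion :: "('o, 'u) cat \<Rightarrow>
    (('o, 'u) set_functor, (('o, 'u) set_functor, 'o \<Rightarrow> ('u set, 'u \<Rightarrow> 'u) arrow) arrow,
     ('o, 'u) model, ('o, 'u) model_map) func" where
  "fibre_inclusion C =
     \<lparr>FObj = (\<lambda>M\<in>Obj (Coh C). (C, M)),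
      FArr = (\<lambda>t\<in>Arr (Coh C). Arrow (C, src t) (C, tgt t) (id_functor C, fn t))\<rparr>"

definition L_fibre :: "('o, 'u) cat \<Rightarrow>
    (('o, 'u) set_functor, (('o, 'u) set_functor, 'o \<Rightarrow> ('u set, 'u \<Rightarrow> 'u) arrow) arrow,
     'u set gorder, ('u set gorder, 'u set \<Rightarrow> 'u set) arrow) func" where
  "L_fibre C = comp_functor (Coh C) L_functor (fibre_inclusion C)"

definition representable :: "('o, 'u) cat \<Rightarrow> 'o \<Rightarrow> ('o, 'u) set_functor" where
  "representable C x =
     \<lparr>FObj = (\<lambda>y\<in>Obj C. hom C x y),
      FArr = (\<lambda>g\<in>Arr C. Arrow (hom C x (Dom C g)) (hom C x (Cod C g))
                (\<lambda>h\<in>hom C x (Dom C g). g \<cdot>\<^bsub>C\<^esub> h))\<rparr>"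

text \<open>The Yoneda embedding of \<open>op_cat C\<close>; an arrow \<open>f : y \<rightarrow> x\<close> of \<open>C\<close> acts by precomposition.\<close>

definition yoneda :: "('o, 'u) cat \<Rightarrow>
    ('o, 'u, ('o, 'u) set_functor, (('o, 'u) set_functor, 'o \<Rightarrow> ('u set, 'u \<Rightarrow> 'u) arrow) arrow) func"
  where
  "yoneda C =
     \<lparr>FObj = (\<lambda>x\<in>Obj C. representable C x),
      FArr = (\<lambda>f\<in>Arr C. Arrow (representable C (Cod C f)) (representable C (Dom C f))
                (\<lambda>z\<in>Obj C. Arrow (hom C (Cod C f) z) (hom C (Dom C f) z)
                   (\<lambda>h\<in>hom C (Cod C f) z. h \<cdot>\<^bsub>C\<^esub> f)))\<rparr>"

abbreviation is_Lan_Y_Sub :: "('o, 'u) cat \<Rightarrow>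
    (('o, 'u) set_functor, (('o, 'u) set_functor, 'o \<Rightarrow> ('u set, 'u \<Rightarrow> 'u) arrow) arrow,
     'u set gorder, ('u set gorder, 'u set \<Rightarrow> 'u set) arrow) func \<Rightarrow>
    ('o \<Rightarrow> ('u set gorder, 'u set \<Rightarrow> 'u set) arrow) \<Rightarrow> bool" where
  "is_Lan_Y_Sub C K u \<equiv>
     is_left_kan_extension (op_cat C) (Set_functors C) DLat (yoneda C) (Sub_functor C) K u"

end

theory Submission
  imports Defs
begin

text \<open>
  A functor \<open>M : C \<rightarrow> Set\<close> is the colimit of the representables \<open>C(x, -)\<close> over its elements \<open>(x, a)\<close>,
  and \<open>L M\<close> is the colimit of the lattices \<open>Sub C x\<close> over the same elements. This is the pointwise
  formula for a left Kan extension along the Yoneda embedding. Applied to all set-valued functors, it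
  defines a functor \<open>Lan\<close> whose restriction to the coherent ones is the fibre of \<open>L\<close> on the nose
  (\<open>L_fibre_eq_Lan\<close>). Once \<open>Lan\<close> is known to be a left Kan extension
  (\<open>is_Lan_Y_Sub_Lan\<close>), all others are isomorphic to it (\<open>left_kan_extension_unique\<close>), and the
  isomorphism restricts to coherent functors.

  The unit of \<open>Lan\<close> at \<open>x\<close> is the leg of the colimit \<open>L C(x, -)\<close> at the identity of \<open>x\<close>. By the Yoneda
  lemma an element \<open>a\<close> of \<open>M x\<close> is a transformation \<open>C(x, -) \<Rightarrow> M\<close>, and \<open>Lan\<close> of this transformation takes
  the unit to the leg of \<open>L M\<close> at \<open>(x, a)\<close>. So the legs are made from the unit: a transformation
  \<open>Lan \<Rightarrow> G\<close> is determined by its composite \<open>\<gamma>\<close> with the unit, and a given \<open>\<gamma>\<close> yields the cocone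
  of the maps \<open>G a \<cdot> \<gamma>\<^bsub>x\<^esub>\<close>, hence a map \<open>L M \<rightarrow> G M\<close>, for every \<open>M\<close>.

  Two facts must be established for the formula to make sense. First, \<open>Sub\<close> takes values in
  distributive lattices and homomorphisms; here a subobject is replaced by the sieve of arrows that
  factor through it, and distributivity follows from the stability of unions under pullback along a
  monomorphism. Second, the colimits exist although carriers are confined to \<open>'u set\<close>. The colimit
  consists of lattice terms in the elements of the diagram, where terms with the same value in all
  cocones are identified. There are at most as many such terms as elements of \<open>'u\<close>, because \<open>'u\<close> is
  infinite and a subobject is determined by one of its representatives, which is an arrow and hence
  an element of \<open>'u\<close>.
\<close>

section \<open>Categories of functors, sets and lattices\<close>

lemma homD: "f \<in> hom C x y \<Longrightarrow> f \<in> Arr C" "f \<in> hom C x y \<Longrightarrow> Dom C f = x" "f \<in> hom C x y \<Longrightarrow> Cod C f = y"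
  by (simp_all add: hom_def)

lemma Arr_hom: "f \<in> Arr C \<Longrightarrow> f \<in> hom C (Dom C f) (Cod C f)"
  by (simp add: hom_def)

lemma (in category) hom_Obj:
  assumes "f \<in> hom C x y"
  shows "x \<in> Obj C" "y \<in> Obj C"
  using assms Dom_in Cod_in by (auto simp: hom_def)

subsection \<open>Opposite categories and composite functors\<close>

lemma op_cat_simps [simp]:
  "Obj (op_cat C) = Obj C" "Arr (op_cat C) = Arr C" "Dom (op_cat C) = Cod C" "Cod (op_cat C) = Dom C"
  "Ident (op_cat C) = Ident C" "Comp (op_cat C) g f = Comp C f g"
  by (simp_all add: op_cat_def)

lemma hom_op_cat [simp]: "hom (op_cat C) x y = hom C y x"
  by (auto simp: hom_def)

lemma (in category) op_category: "category (op_cat C)"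
proof (unfold_locales, goal_cases)
  case (7 f w x g y h z)
  then show ?case by (simp add: Comp_assoc[of h z y g x f w])
qed (auto simp: Dom_in Cod_in Ident_in Ident_left Ident_right intro: Comp_in)

lemma (in is_functor) op_functor: "is_functor (op_cat C) (op_cat D) F"
  using FObj_ext FArr_ext FObj_in FArr_in FArr_Ident FArr_Comp
  by (intro is_functor.intro is_functor_axioms.intro source.op_category target.op_category) simp_all

lemma comp_functor_simps [simp]:
  "x \<in> Obj A \<Longrightarrow> FObj (comp_functor A G F) x = FObj G (FObj F x)"
  "f \<in> Arr A \<Longrightarrow> FArr (comp_functor A G F) f = FArr G (FArr F f)"
  by (simp_all add: comp_functor_def compose_def)

lemma comp_functor_ext:
  "FObj (comp_functor A G F) \<in> extensional (Obj A)" "FArr (comp_functor A G F) \<in> extensional (Arr A)"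
  by (simp_all add: comp_functor_def)

lemma is_functor_comp:
  assumes "is_functor A B F" and "is_functor B E G"
  shows "is_functor A E (comp_functor A G F)"
proof -
  interpret F: is_functor A B F by fact
  interpret G: is_functor B E G by fact
  show ?thesis
  proof unfold_locales
    fix f x y assume f: "f \<in> hom A x y"
    then show "FArr (comp_functor A G F) f
        \<in> hom E (FObj (comp_functor A G F) x) (FObj (comp_functor A G F) y)"
      using F.source.hom_Obj[OF f] by (simp add: homD(1)[OF f] G.FArr_in F.FArr_in)
  next
    fix f x y g z assume f: "f \<in> hom A x y" and g: "g \<in> hom A y z"
    then show "FArr (comp_functor A G F) (g \<cdot>\<^bsub>A\<^esub> f)
        = FArr (comp_functor A G F) g \<cdot>\<^bsub>E\<^esub> FArr (comp_functor A G F) f"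
      using G.FArr_Comp[OF F.FArr_in[OF f] F.FArr_in[OF g]] F.FArr_Comp[OF f g]
      by (simp add: homD(1)[OF f] homD(1)[OF g] homD(1)[OF F.source.Comp_in[OF f g]])
  qed (auto simp: comp_functor_ext F.FObj_in G.FObj_in F.FArr_Ident G.FArr_Ident
        homD(1)[OF F.source.Ident_in])
qed

lemma func_eqI:
  fixes F G :: "('o, 'm, 'p, 'n) func"
  assumes "FObj F \<in> extensional X" "FObj G \<in> extensional X"
    and "FArr F \<in> extensional Y" "FArr G \<in> extensional Y"
    and "\<And>x. x \<in> X \<Longrightarrow> FObj F x = FObj G x" and "\<And>f. f \<in> Y \<Longrightarrow> FArr F f = FArr G f"
  shows "F = G"
proof -
  have "FObj F = FObj G" using assms by (intro extensionalityI) auto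
  moreover have "FArr F = FArr G" using assms by (intro extensionalityI) auto
  ultimately show ?thesis by simp
qed

lemma id_functor_simps [simp]:
  "x \<in> Obj C \<Longrightarrow> FObj (id_functor C) x = x" "f \<in> Arr C \<Longrightarrow> FArr (id_functor C) f = f"
  by (simp_all add: id_functor_def)

lemma comp_id_functor:
  fixes F :: "('o, 'm, 'p, 'n) func"
  assumes "is_functor C D F"
  shows "comp_functor C F (id_functor C) = F"
proof -
  interpret is_functor C D F by fact
  show ?thesis
    using FObj_ext FArr_ext
    by (intro func_eqI[of _ "Obj C" _ "Arr C"]) (auto simp: comp_functor_ext)
qed

lemma (in category) is_functor_id: "is_functor C C (id_functor C)"
  by unfold_locales
    (auto simp: id_functor_def homD(1)[OF Ident_in] Ident_in Comp_in hom_Obj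
        homD(1)[OF Comp_in] dest: homD)

subsection \<open>Functor categories and full subcategories\<close>

lemma functor_category_simps [simp]:
  "Obj (functor_category C D) = {F. is_functor C D F}"
  "Arr (functor_category C D) = {t. nat_trans C D (src t) (tgt t) (fn t)}"
  "Dom (functor_category C D) = src"
  "Cod (functor_category C D) = tgt"
  "Ident (functor_category C D) F = Arrow F F (\<lambda>x\<in>Obj C. Ident D (FObj F x))"
  "t \<cdot>\<^bsub>functor_category C D\<^esub> s = Arrow (src s) (tgt t) (\<lambda>x\<in>Obj C. fn t x \<cdot>\<^bsub>D\<^esub> fn s x)"
  by (simp_all add: functor_category_def)

lemma hom_functor_category:
  "t \<in> hom (functor_category C D) F G \<longleftrightarrow> src t = F \<and> tgt t = G \<and> nat_trans C D F G (fn t)"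
  by (auto simp: hom_def)

lemma nat_trans_id:
  assumes "is_functor C D F"
  shows "nat_trans C D F F (\<lambda>x\<in>Obj C. Ident D (FObj F x))"
proof -
  interpret is_functor C D F by fact
  show ?thesis
    by unfold_locales
      (auto simp: target.Ident_in FObj_in source.hom_Obj target.Ident_left[OF FArr_in]
        target.Ident_right[OF FArr_in])
qed

lemma nat_trans_comp:
  assumes "nat_trans C D F G \<eta>" and "nat_trans C D G H \<theta>"
  shows "nat_trans C D F H (\<lambda>x\<in>Obj C. \<theta> x \<cdot>\<^bsub>D\<^esub> \<eta> x)"
proof -
  interpret \<eta>: nat_trans C D F G \<eta> by fact
  interpret \<theta>: nat_trans C D G H \<theta> by fact
  note cs = \<eta>.F.target.Comp_assoc
  show ?thesis
  proof unfold_locales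
    fix f x y assume f: "f \<in> hom C x y"
    note o = \<eta>.F.source.hom_Obj[OF f]
    note c = \<eta>.component_in[OF o(1)] \<eta>.component_in[OF o(2)] \<theta>.component_in[OF o(1)]
      \<theta>.component_in[OF o(2)] \<eta>.F.FArr_in[OF f] \<eta>.G.FArr_in[OF f] \<theta>.G.FArr_in[OF f]
    have "(\<theta> y \<cdot>\<^bsub>D\<^esub> \<eta> y) \<cdot>\<^bsub>D\<^esub> FArr F f = \<theta> y \<cdot>\<^bsub>D\<^esub> (\<eta> y \<cdot>\<^bsub>D\<^esub> FArr F f)"
      using cs[OF c(5) c(2) c(4)] by simp
    also have "\<dots> = (\<theta> y \<cdot>\<^bsub>D\<^esub> FArr G f) \<cdot>\<^bsub>D\<^esub> \<eta> x"
      using cs[OF c(1) c(6) c(4)] \<eta>.naturality[OF f] by simp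
    also have "\<dots> = FArr H f \<cdot>\<^bsub>D\<^esub> (\<theta> x \<cdot>\<^bsub>D\<^esub> \<eta> x)"
      using cs[OF c(1) c(3) c(7)] \<theta>.naturality[OF f] by simp
    finally show "(\<lambda>x\<in>Obj C. \<theta> x \<cdot>\<^bsub>D\<^esub> \<eta> x) y \<cdot>\<^bsub>D\<^esub> FArr F f
        = FArr H f \<cdot>\<^bsub>D\<^esub> (\<lambda>x\<in>Obj C. \<theta> x \<cdot>\<^bsub>D\<^esub> \<eta> x) x"
      using o by simp
  qed (auto intro: \<eta>.F.target.Comp_in \<eta>.component_in \<theta>.component_in)
qed

lemma category_functor_category:
  assumes "category C" and "category D"
  shows "category (functor_category C D)"
proof -
  interpret C: category C by fact
  interpret D: category D by fact
  show ?thesis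
  proof (unfold_locales, goal_cases)
    case (1 f) then show ?case by (auto simp: nat_trans_def)
  next
    case (2 f) then show ?case by (auto simp: nat_trans_def)
  next
    case (3 x) then show ?case by (simp add: hom_functor_category nat_trans_id)
  next
    case (4 f x y g z) then show ?case by (auto simp: hom_functor_category intro: nat_trans_comp)
  next
    case (5 f x y)
    then interpret nat_trans C D x y "fn f" by (simp add: hom_functor_category)
    have "(\<lambda>z\<in>Obj C. (\<lambda>x\<in>Obj C. Ident D (FObj y x)) z \<cdot>\<^bsub>D\<^esub> fn f z) = fn f"
      by (rule extensionalityI[OF _ ext]) (auto simp: D.Ident_left[OF component_in])
    with 5 show ?case by (cases f) (simp add: hom_functor_category)
  next
    case (6 f x y)
    then interpret nat_trans C D x y "fn f" by (simp add: hom_functor_category)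
    have "(\<lambda>z\<in>Obj C. fn f z \<cdot>\<^bsub>D\<^esub> (\<lambda>z\<in>Obj C. Ident D (FObj x z)) z) = fn f"
      by (rule extensionalityI[OF _ ext]) (auto simp: D.Ident_right[OF component_in])
    with 6 show ?case by (cases f) (simp add: hom_functor_category)
  next
    case (7 f w x g y h z)
    then interpret f: nat_trans C D w x "fn f" by (simp add: hom_functor_category)
    from 7 interpret g: nat_trans C D x y "fn g" by (simp add: hom_functor_category)
    from 7 interpret h: nat_trans C D y z "fn h" by (simp add: hom_functor_category)
    show ?case
      by (auto simp: D.Comp_assoc[OF f.component_in g.component_in h.component_in])
  qed
qed

lemma full_subcategory_simps [simp]:
  "Obj (full_subcategory C P) = {x \<in> Obj C. P x}"
  "Arr (full_subcategory C P) = {f \<in> Arr C. P (Dom C f) \<and> P (Cod C f)}"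
  "Dom (full_subcategory C P) = Dom C" "Cod (full_subcategory C P) = Cod C"
  "Ident (full_subcategory C P) = Ident C" "Comp (full_subcategory C P) = Comp C"
  by (simp_all add: full_subcategory_def)

lemma hom_full_subcategory:
  "f \<in> hom (full_subcategory C P) x y \<longleftrightarrow> f \<in> hom C x y \<and> P x \<and> P y"
  by (auto simp: hom_def)

lemma category_full_subcategory:
  assumes "category C"
  shows "category (full_subcategory C P)"
proof -
  interpret category C by fact
  show ?thesis
    by unfold_locales (auto simp: hom_full_subcategory Dom_in Cod_in Ident_in Ident_left Ident_right
        Comp_assoc intro: Comp_in)
qed

lemma is_functor_full_subcategory_inclusion:
  assumes "category C"
  shows "is_functor (full_subcategory C P) C (id_functor (full_subcategory C P))"
proof -
  interpret category C by fact
  interpret S: category "full_subcategory C P" by (rule category_full_subcategory[OF assms])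
  interpret I: is_functor "full_subcategory C P" "full_subcategory C P" "id_functor (full_subcategory C P)"
    by (rule S.is_functor_id)
  show ?thesis
    using I.FObj_ext I.FArr_ext I.FObj_in I.FArr_in I.FArr_Ident I.FArr_Comp
    by unfold_locales (simp_all add: hom_full_subcategory)
qed

subsection \<open>Sets\<close>

lemma SetCat_simps [simp]:
  "Obj SetCat = UNIV" "Arr SetCat = {f. fn f \<in> src f \<rightarrow>\<^sub>E tgt f}" "Dom SetCat = src" "Cod SetCat = tgt"
  "Ident SetCat A = Arrow A A (\<lambda>a\<in>A. a)"
  "g \<cdot>\<^bsub>SetCat\<^esub> f = Arrow (src f) (tgt g) (compose (src f) (fn g) (fn f))"
  by (simp_all add: SetCat_def)

lemma hom_SetCat: "f \<in> hom SetCat A B \<longleftrightarrow> src f = A \<and> tgt f = B \<and> fn f \<in> A \<rightarrow>\<^sub>E B"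
  by (auto simp: hom_def)

lemma category_SetCat: "category (SetCat :: ('u set, ('u set, 'u \<Rightarrow> 'u) arrow) cat)"
proof (unfold_locales, goal_cases)
  case (4 f x y g z)
  then show ?case by (auto simp: hom_SetCat compose_def)
next
  case (5 f x y)
  then show ?case by (cases f) (auto simp: hom_SetCat PiE_def intro!: Id_compose)
next
  case (6 f x y)
  then show ?case by (cases f) (auto simp: hom_SetCat PiE_def intro!: compose_Id)
next
  case (7 f w x g y h z)
  then have "fn f \<in> w \<rightarrow> x" by (auto simp: hom_SetCat)
  from compose_assoc[OF this, of "fn h" "fn g"] 7 show ?case by (simp add: hom_SetCat)
qed (auto simp: hom_SetCat)

subsection \<open>Distributive lattices\<close>

lemma bounded_latticeI:
  fixes L :: "'v gorder"
  assumes eq: "eq L = (=)"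
    and refl: "\<And>a. a \<in> carrier L \<Longrightarrow> a \<sqsubseteq>\<^bsub>L\<^esub> a"
    and antisym: "\<And>a b. a \<in> carrier L \<Longrightarrow> b \<in> carrier L \<Longrightarrow> a \<sqsubseteq>\<^bsub>L\<^esub> b \<Longrightarrow> b \<sqsubseteq>\<^bsub>L\<^esub> a \<Longrightarrow> a = b"
    and trans: "\<And>a b c. a \<in> carrier L \<Longrightarrow> b \<in> carrier L \<Longrightarrow> c \<in> carrier L \<Longrightarrow>
      a \<sqsubseteq>\<^bsub>L\<^esub> b \<Longrightarrow> b \<sqsubseteq>\<^bsub>L\<^esub> c \<Longrightarrow> a \<sqsubseteq>\<^bsub>L\<^esub> c"
    and meet: "\<And>a b. a \<in> carrier L \<Longrightarrow> b \<in> carrier L \<Longrightarrow> \<exists>c \<in> carrier L. c \<sqsubseteq>\<^bsub>L\<^esub> a \<and> c \<sqsubseteq>\<^bsub>L\<^esub> b \<and>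
      (\<forall>d \<in> carrier L. d \<sqsubseteq>\<^bsub>L\<^esub> a \<longrightarrow> d \<sqsubseteq>\<^bsub>L\<^esub> b \<longrightarrow> d \<sqsubseteq>\<^bsub>L\<^esub> c)"
    and join: "\<And>a b. a \<in> carrier L \<Longrightarrow> b \<in> carrier L \<Longrightarrow> \<exists>c \<in> carrier L. a \<sqsubseteq>\<^bsub>L\<^esub> c \<and> b \<sqsubseteq>\<^bsub>L\<^esub> c \<and>
      (\<forall>d \<in> carrier L. a \<sqsubseteq>\<^bsub>L\<^esub> d \<longrightarrow> b \<sqsubseteq>\<^bsub>L\<^esub> d \<longrightarrow> c \<sqsubseteq>\<^bsub>L\<^esub> d)"
    and top: "\<exists>t \<in> carrier L. \<forall>a \<in> carrier L. a \<sqsubseteq>\<^bsub>L\<^esub> t"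
    and bottom: "\<exists>b \<in> carrier L. \<forall>a \<in> carrier L. b \<sqsubseteq>\<^bsub>L\<^esub> a"
  shows "bounded_lattice L"
proof -
  interpret partial_order L
    by unfold_locales (auto simp: eq refl intro: antisym trans)
  show ?thesis
  proof unfold_locales
    fix x y assume "x \<in> carrier L" "y \<in> carrier L"
    then obtain c where "c \<in> carrier L" "x \<sqsubseteq>\<^bsub>L\<^esub> c" "y \<sqsubseteq>\<^bsub>L\<^esub> c"
      "\<forall>d \<in> carrier L. x \<sqsubseteq>\<^bsub>L\<^esub> d \<longrightarrow> y \<sqsubseteq>\<^bsub>L\<^esub> d \<longrightarrow> c \<sqsubseteq>\<^bsub>L\<^esub> d"
      using join[of x y] by blast
    with \<open>x \<in> carrier L\<close> \<open>y \<in> carrier L\<close> have "least L c (Upper L {x, y})"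
      unfolding least_def Upper_def by simp
    then show "\<exists>s. least L s (Upper L {x, y})" ..
  next
    fix x y assume "x \<in> carrier L" "y \<in> carrier L"
    then obtain c where "c \<in> carrier L" "c \<sqsubseteq>\<^bsub>L\<^esub> x" "c \<sqsubseteq>\<^bsub>L\<^esub> y"
      "\<forall>d \<in> carrier L. d \<sqsubseteq>\<^bsub>L\<^esub> x \<longrightarrow> d \<sqsubseteq>\<^bsub>L\<^esub> y \<longrightarrow> d \<sqsubseteq>\<^bsub>L\<^esub> c"
      using meet[of x y] by blast
    with \<open>x \<in> carrier L\<close> \<open>y \<in> carrier L\<close> have "greatest L c (Lower L {x, y})"
      unfolding greatest_def Lower_def by simp
    then show "\<exists>s. greatest L s (Lower L {x, y})" ..
  qed (use top bottom in \<open>auto simp: least_def greatest_def\<close>)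
qed

lemma (in lattice) meet_eqI:
  assumes "a \<in> carrier L" "b \<in> carrier L" "c \<in> carrier L" "c \<sqsubseteq> a" "c \<sqsubseteq> b"
    and "\<And>d. d \<in> carrier L \<Longrightarrow> d \<sqsubseteq> a \<Longrightarrow> d \<sqsubseteq> b \<Longrightarrow> d \<sqsubseteq> c"
  shows "a \<sqinter> b = c"
proof (rule le_antisym)
  show "a \<sqinter> b \<sqsubseteq> c" using assms(1,2) by (intro assms(6) meet_closed meet_left meet_right)
  show "c \<sqsubseteq> a \<sqinter> b" using assms(1-5) by (intro meet_le)
qed (use assms(1-3) in auto)

lemma (in lattice) join_eqI:
  assumes "a \<in> carrier L" "b \<in> carrier L" "c \<in> carrier L" "a \<sqsubseteq> c" "b \<sqsubseteq> c"
    and "\<And>d. d \<in> carrier L \<Longrightarrow> a \<sqsubseteq> d \<Longrightarrow> b \<sqsubseteq> d \<Longrightarrow> c \<sqsubseteq> d"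
  shows "a \<squnion> b = c"
proof (rule le_antisym)
  show "a \<squnion> b \<sqsubseteq> c" using assms(1-5) by (intro join_le)
  show "c \<sqsubseteq> a \<squnion> b" using assms(1,2) by (intro assms(6) join_closed join_left join_right)
qed (use assms(1-3) in auto)

lemma distributive_latticeI:
  assumes "bounded_lattice L"
    and distrib: "\<And>a b c. a \<in> carrier L \<Longrightarrow> b \<in> carrier L \<Longrightarrow> c \<in> carrier L \<Longrightarrow>
      a \<sqinter>\<^bsub>L\<^esub> (b \<squnion>\<^bsub>L\<^esub> c) \<sqsubseteq>\<^bsub>L\<^esub> (a \<sqinter>\<^bsub>L\<^esub> b) \<squnion>\<^bsub>L\<^esub> (a \<sqinter>\<^bsub>L\<^esub> c)"
  shows "distributive_lattice L"
proof -
  interpret bounded_lattice L by fact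
  have "a \<sqinter>\<^bsub>L\<^esub> (b \<squnion>\<^bsub>L\<^esub> c) = (a \<sqinter>\<^bsub>L\<^esub> b) \<squnion>\<^bsub>L\<^esub> (a \<sqinter>\<^bsub>L\<^esub> c)"
    if "a \<in> carrier L" "b \<in> carrier L" "c \<in> carrier L" for a b c
  proof (rule le_antisym[OF distrib[OF that]])
    show "(a \<sqinter>\<^bsub>L\<^esub> b) \<squnion>\<^bsub>L\<^esub> (a \<sqinter>\<^bsub>L\<^esub> c) \<sqsubseteq>\<^bsub>L\<^esub> a \<sqinter>\<^bsub>L\<^esub> (b \<squnion>\<^bsub>L\<^esub> c)"
    proof (rule join_le; (rule meet_le)?)
      show "a \<sqinter>\<^bsub>L\<^esub> b \<sqsubseteq>\<^bsub>L\<^esub> b \<squnion>\<^bsub>L\<^esub> c"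
        using that by (intro le_trans[OF meet_right join_left] meet_closed join_closed)
      show "a \<sqinter>\<^bsub>L\<^esub> c \<sqsubseteq>\<^bsub>L\<^esub> b \<squnion>\<^bsub>L\<^esub> c"
        using that by (intro le_trans[OF meet_right join_right] meet_closed join_closed)
    qed (use that in \<open>auto intro: meet_left\<close>)
  qed (use that in auto)
  then show ?thesis by (simp add: distributive_lattice_def assms(1))
qed

lemma DLat_simps [simp]:
  "Obj DLat = {L. distributive_lattice L}"
  "Arr DLat = {h. distributive_lattice (src h) \<and> distributive_lattice (tgt h) \<and>
                     bounded_lattice_hom (src h) (tgt h) (fn h)}"
  "Dom DLat = src" "Cod DLat = tgt"
  "Ident DLat L = Arrow L L (\<lambda>a\<in>carrier L. a)"
  "g \<cdot>\<^bsub>DLat\<^esub> f = Arrow (src f) (tgt g) (compose (carrier (src f)) (fn g) (fn f))"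
  by (simp_all add: DLat_def Let_def)

lemma hom_DLat:
  "f \<in> hom DLat L K \<longleftrightarrow> src f = L \<and> tgt f = K \<and> distributive_lattice L \<and> distributive_lattice K \<and>
     bounded_lattice_hom L K (fn f)"
  by (auto simp: hom_def)

lemma distributive_lattice_imp_bounded: "distributive_lattice L \<Longrightarrow> bounded_lattice L"
  by (simp add: distributive_lattice_def)

lemma category_DLat:
  "category (DLat :: ('v gorder, ('v gorder, 'v \<Rightarrow> 'v) arrow, ('v gorder, 'v \<Rightarrow> 'v) arrow) two_cat)"
proof (unfold_locales, goal_cases)
  case (3 L)
  then have "bounded_lattice L" by (simp add: distributive_lattice_def)
  then interpret bounded_lattice L .
  have "lattice L" ..
  with 3 show ?case
    by (auto simp: hom_DLat bounded_lattice_hom_def meet_pres_def join_pres_def)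
next
  case (4 f x y g z)
  then have "bounded_lattice x" "bounded_lattice y"
    by (auto simp: hom_DLat distributive_lattice_def)
  then interpret x: bounded_lattice x + y: bounded_lattice y .
  from 4 show ?case
    unfolding hom_DLat bounded_lattice_hom_def meet_pres_def join_pres_def
    by (simp add: compose_def PiE_iff)
next
  case (5 f x y)
  then show ?case by (cases f) (auto simp: hom_DLat bounded_lattice_hom_def PiE_def intro!: Id_compose)
next
  case (6 f x y)
  then show ?case by (cases f) (auto simp: hom_DLat bounded_lattice_hom_def PiE_def intro!: compose_Id)
next
  case (7 f w x g y h z)
  then have "fn f \<in> carrier w \<rightarrow> carrier x"
    by (auto simp: hom_DLat bounded_lattice_hom_def)
  from compose_assoc[OF this, of "fn h" "fn g"] 7 show ?case
    by (simp add: hom_DLat)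
qed (auto simp: hom_DLat)

lemma hom_DLatD:
  assumes "f \<in> hom DLat L K"
  shows "src f = L" "tgt f = K" "distributive_lattice L" "distributive_lattice K"
    "bounded_lattice_hom L K (fn f)" "fn f \<in> extensional (carrier L)"
    "\<And>a. a \<in> carrier L \<Longrightarrow> fn f a \<in> carrier K"
  using assms by (auto simp: hom_DLat bounded_lattice_hom_def PiE_def)

lemma hom_DLat_eqI:
  assumes "f \<in> hom DLat L K" "g \<in> hom DLat L K" "\<And>a. a \<in> carrier L \<Longrightarrow> fn f a = fn g a"
  shows "f = g"
proof -
  have "fn f = fn g"
    using assms by (intro extensionalityI[of _ "carrier L"]) (auto dest: hom_DLatD)
  with hom_DLatD(1,2)[OF assms(1)] hom_DLatD(1,2)[OF assms(2)] show ?thesis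
    by (simp add: arrow.expand)
qed

lemma DLat_comp_apply:
  "f \<in> hom DLat L K \<Longrightarrow> a \<in> carrier L \<Longrightarrow> fn (g \<cdot>\<^bsub>DLat\<^esub> f) a = fn g (fn f a)"
  by (auto dest: hom_DLatD(1) simp: compose_def)

section \<open>Colimits of distributive lattices\<close>

datatype 'g lattice_term =
  Gen 'g
| Meet "'g lattice_term" "'g lattice_term"
| Join "'g lattice_term" "'g lattice_term"
| Top
| Bottom

primrec eval :: "('v, 'z) gorder_scheme \<Rightarrow> ('g \<Rightarrow> 'v) \<Rightarrow> 'g lattice_term \<Rightarrow> 'v" where
  "eval L h (Gen x) = h x"
| "eval L h (Meet s t) = eval L h s \<sqinter>\<^bsub>L\<^esub> eval L h t"
| "eval L h (Join s t) = eval L h s \<squnion>\<^bsub>L\<^esub> eval L h t"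
| "eval L h Top = \<top>\<^bsub>L\<^esub>"
| "eval L h Bottom = \<bottom>\<^bsub>L\<^esub>"

lemma (in bounded_lattice) eval_closed:
  "(\<And>x. x \<in> set_lattice_term t \<Longrightarrow> h x \<in> carrier L) \<Longrightarrow> eval L h t \<in> carrier L"
  by (induction t) auto

lemma ex_inj_pair:
  assumes "infinite (UNIV :: 'u set)"
  shows "\<exists>p :: 'u \<times> 'u \<Rightarrow> 'u. inj p"
proof -
  have "\<exists>f. bij_betw f ((UNIV :: 'u set) \<times> (UNIV :: 'u set)) (UNIV :: 'u set)"
    using card_of_Times_same_infinite[OF assms] by (simp add: card_of_ordIso)
  then obtain p :: "'u \<times> 'u \<Rightarrow> 'u" where "bij_betw p UNIV UNIV"
    by (auto simp: UNIV_Times_UNIV)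
  then show ?thesis by (auto simp: bij_betw_def)
qed

text \<open>
  Terms are coded by recursion: every constructor gets its own tag from a countable subset of the
  type, and tags and codes of subterms are paired by an injection of the square of the type into
  the type itself, which exists because the type is infinite.
\<close>

lemma lattice_terms_small:
  fixes e :: "'g \<Rightarrow> 'u"
  assumes inf: "infinite (UNIV :: 'u set)" and e: "inj_on e G"
  shows "\<exists>enc :: 'g lattice_term \<Rightarrow> 'u. inj_on enc {t. set_lattice_term t \<subseteq> G}"
proof -
  obtain p :: "'u \<times> 'u \<Rightarrow> 'u" where p: "inj p" using ex_inj_pair[OF inf] by blast
  obtain c :: "nat \<Rightarrow> 'u" where c: "inj c" using infinite_countable_subset[OF inf] by auto
  define enc where "enc = rec_lattice_term (\<lambda>x. p (c 0, e x)) (\<lambda>_ _ a b. p (c 1, p (a, b)))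
    (\<lambda>_ _ a b. p (c 2, p (a, b))) (p (c 3, c 3)) (p (c 4, c 4))"
  have enc: "enc (Gen x) = p (c 0, e x)" "enc (Meet s t) = p (c 1, p (enc s, enc t))"
    "enc (Join s t) = p (c 2, p (enc s, enc t))" "enc Top = p (c 3, c 3)" "enc Bottom = p (c 4, c 4)"
    for x s t by (simp_all add: enc_def)
  have pc: "p a = p b \<longleftrightarrow> a = b" "c i = c j \<longleftrightarrow> i = j" for a b i j
    using p c by (auto simp: inj_eq)
  have "s = t" if "set_lattice_term s \<subseteq> G" "set_lattice_term t \<subseteq> G" "enc s = enc t" for s t
    using that
  proof (induction s arbitrary: t)
    case (Gen x)
    then show ?case by (cases t) (auto simp: enc pc dest: inj_onD[OF e])
  next
    case (Meet s1 s2)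
    then show ?case by (cases t) (auto simp: enc pc)
  next
    case (Join s1 s2)
    then show ?case by (cases t) (auto simp: enc pc)
  next
    case Top
    then show ?case by (cases t) (auto simp: enc pc)
  next
    case Bottom
    then show ?case by (cases t) (auto simp: enc pc)
  qed
  then show ?thesis by (intro exI[of _ enc]) (auto intro: inj_onI)
qed

text \<open>
  A colimit of lattices is generated by the elements of all lattices of the diagram, so each of its
  elements is the value of a term in these. The injection \<open>enc\<close> bounds the number of terms by the
  size of \<open>'u\<close>, and so makes room for the colimit among the lattices with carrier in \<open>'u set\<close>.
\<close>

locale lattice_diagram = is_functor J DLat D
  for J :: "('j, 'i, 'y) cat_scheme" and D :: "('j, 'i, 'u set gorder, ('u set gorder, 'u set \<Rightarrow> 'u set) arrow) func" +
  fixes enc :: "('j \<times> 'u set) lattice_term \<Rightarrow> 'u"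
  assumes enc: "inj_on enc {t. set_lattice_term t \<subseteq> Sigma (Obj J) (\<lambda>j. carrier (FObj D j))}"
begin

definition generators :: "('j \<times> 'u set) set" where
  "generators = Sigma (Obj J) (\<lambda>j. carrier (FObj D j))"

definition terms :: "('j \<times> 'u set) lattice_term set" where
  "terms = {t. set_lattice_term t \<subseteq> generators}"

definition term_value :: "'u set gorder \<Rightarrow> ('j \<Rightarrow> ('u set gorder, 'u set \<Rightarrow> 'u set) arrow) \<Rightarrow>
    ('j \<times> 'u set) lattice_term \<Rightarrow> 'u set" where
  "term_value Y \<kappa> = eval Y (\<lambda>(j, a). fn (\<kappa> j) a)"

text \<open>
  The preorder whose quotient is the colimit. Quantifying over all cocones, instead of generating a
  congruence from the lattice laws and the arrows of the diagram, makes the maps out of the quotient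
  immediate; conversely, each law that the quotient and its legs have to satisfy holds in every
  cocone.
\<close>

definition below :: "('j \<times> 'u set) lattice_term \<Rightarrow> ('j \<times> 'u set) lattice_term \<Rightarrow> bool" where
  "below s t \<longleftrightarrow> (\<forall>Y \<kappa>. is_cocone J DLat D Y \<kappa> \<longrightarrow> term_value Y \<kappa> s \<sqsubseteq>\<^bsub>Y\<^esub> term_value Y \<kappa> t)"

text \<open>
  The equivalence class of a term, coded as a set of elements of \<open>'u\<close> so that it can be an element
  of a carrier in \<open>'u set\<close>.
\<close>

definition cls :: "('j \<times> 'u set) lattice_term \<Rightarrow> 'u set" where
  "cls t = enc ` {s \<in> terms. below s t \<and> below t s}"

definition tip :: "'u set gorder" where
  "tip = \<lparr>carrier = cls ` terms, eq = (=),
     le = (\<lambda>A B. \<exists>s \<in> terms. \<exists>t \<in> terms. A = cls s \<and> B = cls t \<and> below s t)\<rparr>"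

definition leg :: "'j \<Rightarrow> ('u set gorder, 'u set \<Rightarrow> 'u set) arrow" where
  "leg j = Arrow (FObj D j) tip (\<lambda>a\<in>carrier (FObj D j). cls (Gen (j, a)))"

lemma terms_simps [simp]:
  "Gen x \<in> terms \<longleftrightarrow> x \<in> generators"
  "Meet s t \<in> terms \<longleftrightarrow> s \<in> terms \<and> t \<in> terms" "Join s t \<in> terms \<longleftrightarrow> s \<in> terms \<and> t \<in> terms"
  "Top \<in> terms" "Bottom \<in> terms"
  by (auto simp: terms_def)

lemma generators_iff [simp]: "(j, a) \<in> generators \<longleftrightarrow> j \<in> Obj J \<and> a \<in> carrier (FObj D j)"
  by (auto simp: generators_def)

lemma enc_eq_iff: "s \<in> terms \<Longrightarrow> t \<in> terms \<Longrightarrow> enc s = enc t \<longleftrightarrow> s = t"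
  using enc by (auto simp: terms_def generators_def inj_on_eq_iff)

lemma term_value_simps [simp]:
  "term_value Y \<kappa> (Gen (j, a)) = fn (\<kappa> j) a"
  "term_value Y \<kappa> (Meet s t) = term_value Y \<kappa> s \<sqinter>\<^bsub>Y\<^esub> term_value Y \<kappa> t"
  "term_value Y \<kappa> (Join s t) = term_value Y \<kappa> s \<squnion>\<^bsub>Y\<^esub> term_value Y \<kappa> t"
  "term_value Y \<kappa> Top = \<top>\<^bsub>Y\<^esub>" "term_value Y \<kappa> Bottom = \<bottom>\<^bsub>Y\<^esub>"
  by (simp_all add: term_value_def)

lemma cocone_tip: "is_cocone J DLat D Y \<kappa> \<Longrightarrow> distributive_lattice Y"
  by (simp add: is_cocone_def)

lemma cocone_tip_bounded: "is_cocone J DLat D Y \<kappa> \<Longrightarrow> bounded_lattice Y"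
  by (simp add: cocone_tip distributive_lattice_imp_bounded)

lemma cocone_leg: "is_cocone J DLat D Y \<kappa> \<Longrightarrow> j \<in> Obj J \<Longrightarrow> \<kappa> j \<in> hom DLat (FObj D j) Y"
  by (simp add: is_cocone_def)

lemma term_value_closed:
  assumes c: "is_cocone J DLat D Y \<kappa>" and t: "t \<in> terms"
  shows "term_value Y \<kappa> t \<in> carrier Y"
proof -
  interpret Y: bounded_lattice Y by (rule cocone_tip_bounded[OF c])
  show ?thesis unfolding term_value_def
  proof (rule Y.eval_closed)
    fix x assume "x \<in> set_lattice_term t"
    then have "x \<in> generators" using t by (auto simp: terms_def)
    then show "(case x of (j, a) \<Rightarrow> fn (\<kappa> j) a) \<in> carrier Y"
      using hom_DLatD(7)[OF cocone_leg[OF c]] by (cases x) auto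
  qed
qed

lemma below_refl: "t \<in> terms \<Longrightarrow> below t t"
  unfolding below_def
proof (intro allI impI)
  fix Y \<kappa> assume t: "t \<in> terms" and c: "is_cocone J DLat D Y \<kappa>"
  interpret Y: bounded_lattice Y by (rule cocone_tip_bounded[OF c])
  show "term_value Y \<kappa> t \<sqsubseteq>\<^bsub>Y\<^esub> term_value Y \<kappa> t" using term_value_closed[OF c t] by simp
qed

lemma below_trans:
  assumes "r \<in> terms" "s \<in> terms" "t \<in> terms" "below r s" "below s t"
  shows "below r t"
  unfolding below_def
proof (intro allI impI)
  fix Y \<kappa> assume c: "is_cocone J DLat D Y \<kappa>"
  interpret Y: bounded_lattice Y by (rule cocone_tip_bounded[OF c])
  show "term_value Y \<kappa> r \<sqsubseteq>\<^bsub>Y\<^esub> term_value Y \<kappa> t"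
    by (rule Y.le_trans[of _ "term_value Y \<kappa> s"])
      (use assms(4,5) c in \<open>simp_all add: below_def term_value_closed[OF c] assms(1-3)\<close>)
qed

lemma cls_eq_iff:
  assumes "s \<in> terms" "t \<in> terms"
  shows "cls s = cls t \<longleftrightarrow> below s t \<and> below t s"
proof
  assume "cls s = cls t"
  moreover have "enc s \<in> cls s" using assms by (auto simp: cls_def below_refl)
  ultimately have "enc s \<in> cls t" by simp
  then show "below s t \<and> below t s" using assms by (auto simp: cls_def enc_eq_iff)
next
  assume "below s t \<and> below t s"
  with assms show "cls s = cls t"
    unfolding cls_def by (intro arg_cong[of _ _ "image enc"] Collect_cong) (meson below_trans)
qed

lemma cls_eq_iff_term_value:
  assumes "s \<in> terms" "t \<in> terms"
  shows "cls s = cls t \<longleftrightarrow> (\<forall>Y \<kappa>. is_cocone J DLat D Y \<kappa> \<longrightarrow> term_value Y \<kappa> s = term_value Y \<kappa> t)"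
proof -
  have "term_value Y \<kappa> s = term_value Y \<kappa> t \<longleftrightarrow> term_value Y \<kappa> s \<sqsubseteq>\<^bsub>Y\<^esub> term_value Y \<kappa> t \<and> term_value Y \<kappa> t \<sqsubseteq>\<^bsub>Y\<^esub> term_value Y \<kappa> s"
    if c: "is_cocone J DLat D Y \<kappa>" for Y \<kappa>
  proof -
    interpret Y: bounded_lattice Y by (rule cocone_tip_bounded[OF c])
    note v = term_value_closed[OF c assms(1)] term_value_closed[OF c assms(2)]
    show ?thesis using v Y.le_refl[OF v(1)] Y.le_antisym[OF _ _ v] by metis
  qed
  then show ?thesis by (auto simp: cls_eq_iff[OF assms] below_def)
qed

lemma carrier_tip: "carrier tip = cls ` terms"
  by (simp add: tip_def)

lemma cls_in_tip [simp]: "t \<in> terms \<Longrightarrow> cls t \<in> carrier tip"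
  by (simp add: carrier_tip)

lemma le_tip:
  assumes "s \<in> terms" "t \<in> terms"
  shows "cls s \<sqsubseteq>\<^bsub>tip\<^esub> cls t \<longleftrightarrow> below s t"
proof
  assume "cls s \<sqsubseteq>\<^bsub>tip\<^esub> cls t"
  then obtain s' t' where s't': "s' \<in> terms" "t' \<in> terms" "cls s = cls s'" "cls t = cls t'" "below s' t'"
    by (auto simp: tip_def)
  then have "below s s'" "below t' t" using assms by (auto simp: cls_eq_iff)
  with s't' assms show "below s t" by (meson below_trans)
next
  assume "below s t"
  then show "cls s \<sqsubseteq>\<^bsub>tip\<^esub> cls t" using assms by (auto simp: tip_def)
qed

lemma below_lattice_laws:
  assumes "s \<in> terms" "t \<in> terms"
  shows "below (Meet s t) s" "below (Meet s t) t" "below s (Join s t)" "below t (Join s t)"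
    and "\<And>r. r \<in> terms \<Longrightarrow> below r s \<Longrightarrow> below r t \<Longrightarrow> below r (Meet s t)"
    and "\<And>r. r \<in> terms \<Longrightarrow> below s r \<Longrightarrow> below t r \<Longrightarrow> below (Join s t) r"
    and "below s Top" "below Bottom s"
proof -
  note v = term_value_closed
  {
    fix Y \<kappa> assume c: "is_cocone J DLat D Y \<kappa>"
    interpret Y: bounded_lattice Y by (rule cocone_tip_bounded[OF c])
    note vs = v[OF c assms(1)] v[OF c assms(2)]
    have "term_value Y \<kappa> (Meet s t) \<sqsubseteq>\<^bsub>Y\<^esub> term_value Y \<kappa> s" "term_value Y \<kappa> (Meet s t) \<sqsubseteq>\<^bsub>Y\<^esub> term_value Y \<kappa> t"
      "term_value Y \<kappa> s \<sqsubseteq>\<^bsub>Y\<^esub> term_value Y \<kappa> (Join s t)" "term_value Y \<kappa> t \<sqsubseteq>\<^bsub>Y\<^esub> term_value Y \<kappa> (Join s t)"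
      "term_value Y \<kappa> s \<sqsubseteq>\<^bsub>Y\<^esub> term_value Y \<kappa> Top" "term_value Y \<kappa> Bottom \<sqsubseteq>\<^bsub>Y\<^esub> term_value Y \<kappa> s"
      using vs by (auto intro: Y.meet_left Y.meet_right Y.join_left Y.join_right)
    note this
    moreover have "term_value Y \<kappa> r \<sqsubseteq>\<^bsub>Y\<^esub> term_value Y \<kappa> (Meet s t)"
      if "r \<in> terms" "term_value Y \<kappa> r \<sqsubseteq>\<^bsub>Y\<^esub> term_value Y \<kappa> s" "term_value Y \<kappa> r \<sqsubseteq>\<^bsub>Y\<^esub> term_value Y \<kappa> t" for r
      using that vs v[OF c] by (auto intro: Y.meet_le)
    moreover have "term_value Y \<kappa> (Join s t) \<sqsubseteq>\<^bsub>Y\<^esub> term_value Y \<kappa> r"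
      if "r \<in> terms" "term_value Y \<kappa> s \<sqsubseteq>\<^bsub>Y\<^esub> term_value Y \<kappa> r" "term_value Y \<kappa> t \<sqsubseteq>\<^bsub>Y\<^esub> term_value Y \<kappa> r" for r
      using that vs v[OF c] by (auto intro: Y.join_le)
    note calculation this
  }
  note * = this
  show "below (Meet s t) s" "below (Meet s t) t" "below s (Join s t)" "below t (Join s t)"
    "below s Top" "below Bottom s"
    unfolding below_def using *(1-6) by blast+
  show "\<And>r. r \<in> terms \<Longrightarrow> below r s \<Longrightarrow> below r t \<Longrightarrow> below r (Meet s t)"
    unfolding below_def using *(7) by blast
  show "\<And>r. r \<in> terms \<Longrightarrow> below s r \<Longrightarrow> below t r \<Longrightarrow> below (Join s t) r"
    unfolding below_def using *(8) by blast
qed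

lemma bounded_lattice_tip: "bounded_lattice tip"
proof (rule bounded_latticeI)
  show "eq tip = (=)" by (simp add: tip_def)
  show "a \<sqsubseteq>\<^bsub>tip\<^esub> a" if "a \<in> carrier tip" for a
    using that by (auto simp: carrier_tip le_tip below_refl)
  show "a = b" if "a \<in> carrier tip" "b \<in> carrier tip" "a \<sqsubseteq>\<^bsub>tip\<^esub> b" "b \<sqsubseteq>\<^bsub>tip\<^esub> a" for a b
    using that unfolding carrier_tip by (elim imageE) (simp add: le_tip cls_eq_iff)
  show "a \<sqsubseteq>\<^bsub>tip\<^esub> c"
    if "a \<in> carrier tip" "b \<in> carrier tip" "c \<in> carrier tip" "a \<sqsubseteq>\<^bsub>tip\<^esub> b" "b \<sqsubseteq>\<^bsub>tip\<^esub> c" for a b c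
    using that unfolding carrier_tip by (elim imageE) (simp add: le_tip, meson below_trans)
next
  fix a b assume "a \<in> carrier tip" "b \<in> carrier tip"
  then obtain s t where st: "s \<in> terms" "t \<in> terms" "a = cls s" "b = cls t"
    by (auto simp: carrier_tip)
  note m = below_lattice_laws[OF st(1,2)]
  show "\<exists>c \<in> carrier tip. c \<sqsubseteq>\<^bsub>tip\<^esub> a \<and> c \<sqsubseteq>\<^bsub>tip\<^esub> b \<and>
      (\<forall>d \<in> carrier tip. d \<sqsubseteq>\<^bsub>tip\<^esub> a \<longrightarrow> d \<sqsubseteq>\<^bsub>tip\<^esub> b \<longrightarrow> d \<sqsubseteq>\<^bsub>tip\<^esub> c)"
    using st m(1,2,5) by (intro bexI[of _ "cls (Meet s t)"]) (auto simp: le_tip carrier_tip)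
  show "\<exists>c \<in> carrier tip. a \<sqsubseteq>\<^bsub>tip\<^esub> c \<and> b \<sqsubseteq>\<^bsub>tip\<^esub> c \<and>
      (\<forall>d \<in> carrier tip. a \<sqsubseteq>\<^bsub>tip\<^esub> d \<longrightarrow> b \<sqsubseteq>\<^bsub>tip\<^esub> d \<longrightarrow> c \<sqsubseteq>\<^bsub>tip\<^esub> d)"
    using st m(3,4,6) by (intro bexI[of _ "cls (Join s t)"]) (auto simp: le_tip carrier_tip)
next
  show "\<exists>t \<in> carrier tip. \<forall>a \<in> carrier tip. a \<sqsubseteq>\<^bsub>tip\<^esub> t"
    using below_lattice_laws(7) by (intro bexI[of _ "cls Top"]) (auto simp: le_tip carrier_tip)
  show "\<exists>t \<in> carrier tip. \<forall>a \<in> carrier tip. t \<sqsubseteq>\<^bsub>tip\<^esub> a"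
    using below_lattice_laws(8) by (intro bexI[of _ "cls Bottom"]) (auto simp: le_tip carrier_tip)
qed

lemma tip_operations:
  assumes st: "s \<in> terms" "t \<in> terms"
  shows "cls s \<sqinter>\<^bsub>tip\<^esub> cls t = cls (Meet s t)" and "cls s \<squnion>\<^bsub>tip\<^esub> cls t = cls (Join s t)"
proof -
  interpret tip: bounded_lattice tip by (rule bounded_lattice_tip)
  note m = below_lattice_laws[OF st]
  show "cls s \<sqinter>\<^bsub>tip\<^esub> cls t = cls (Meet s t)"
    using st m(1,2,5) by (intro tip.meet_eqI) (auto simp: le_tip carrier_tip)
  show "cls s \<squnion>\<^bsub>tip\<^esub> cls t = cls (Join s t)"
    using st m(3,4,6) by (intro tip.join_eqI) (auto simp: le_tip carrier_tip)
qed

lemma tip_bounds: "\<top>\<^bsub>tip\<^esub> = cls Top" "\<bottom>\<^bsub>tip\<^esub> = cls Bottom"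
proof -
  interpret tip: bounded_lattice tip by (rule bounded_lattice_tip)
  show "\<top>\<^bsub>tip\<^esub> = cls Top"
    using below_lattice_laws(7) by (intro tip.top_eq[symmetric]) (auto simp: le_tip carrier_tip)
  show "\<bottom>\<^bsub>tip\<^esub> = cls Bottom"
    using below_lattice_laws(8) by (intro tip.bottom_eq[symmetric]) (auto simp: le_tip carrier_tip)
qed

lemma distributive_lattice_tip: "distributive_lattice tip"
proof -
  interpret tip: bounded_lattice tip by (rule bounded_lattice_tip)
  have "cls (Meet r (Join s t)) = cls (Join (Meet r s) (Meet r t))"
    if "r \<in> terms" "s \<in> terms" "t \<in> terms" for r s t
    using that term_value_closed cocone_tip by (subst cls_eq_iff_term_value) (auto simp: distributive_lattice_def)
  then show ?thesis
    unfolding distributive_lattice_def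
    by (auto simp: carrier_tip tip_operations bounded_lattice_tip)
qed

lemma leg_in_hom:
  assumes j: "j \<in> Obj J"
  shows "leg j \<in> hom DLat (FObj D j) tip"
proof -
  let ?L = "FObj D j"
  have dl: "distributive_lattice ?L" using FObj_in[OF j] by simp
  interpret L: bounded_lattice ?L by (rule distributive_lattice_imp_bounded[OF dl])
  interpret tip: bounded_lattice tip by (rule bounded_lattice_tip)
  have lat: "lattice ?L" "lattice tip" by unfold_locales
  note c = hom_DLatD(5)[OF cocone_leg[OF _ j]]
  have "cls (Gen (j, a \<sqinter>\<^bsub>?L\<^esub> b)) = cls (Gen (j, a)) \<sqinter>\<^bsub>tip\<^esub> cls (Gen (j, b))"
    "cls (Gen (j, a \<squnion>\<^bsub>?L\<^esub> b)) = cls (Gen (j, a)) \<squnion>\<^bsub>tip\<^esub> cls (Gen (j, b))"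
    if ab: "a \<in> carrier ?L" "b \<in> carrier ?L" for a b
    using c j ab
    by (auto simp: tip_operations cls_eq_iff_term_value bounded_lattice_hom_def meet_pres_def join_pres_def)
  moreover have "cls (Gen (j, \<top>\<^bsub>?L\<^esub>)) = \<top>\<^bsub>tip\<^esub>" "cls (Gen (j, \<bottom>\<^bsub>?L\<^esub>)) = \<bottom>\<^bsub>tip\<^esub>"
    using c j by (auto simp: tip_bounds cls_eq_iff_term_value bounded_lattice_hom_def)
  ultimately show ?thesis
    using j by (auto simp: hom_DLat leg_def dl distributive_lattice_tip bounded_lattice_hom_def
        meet_pres_def join_pres_def lat)
qed

lemma cocone_compatible:
  assumes c: "is_cocone J DLat D Y \<kappa>" and f: "f \<in> Arr J" and a: "a \<in> carrier (FObj D (Dom J f))"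
  shows "fn (\<kappa> (Cod J f)) (fn (FArr D f) a) = fn (\<kappa> (Dom J f)) a"
proof -
  have "\<kappa> (Cod J f) \<cdot>\<^bsub>DLat\<^esub> FArr D f = \<kappa> (Dom J f)" using c f by (simp add: is_cocone_def)
  then show ?thesis using DLat_comp_apply[OF FArr_in[OF Arr_hom[OF f]] a] by metis
qed

lemma is_cocone_tip: "is_cocone J DLat D tip leg"
  unfolding is_cocone_def
proof (intro conjI ballI)
  show "tip \<in> Obj DLat" by (simp add: distributive_lattice_tip)
  show "leg j \<in> hom DLat (FObj D j) tip" if "j \<in> Obj J" for j by (rule leg_in_hom[OF that])
  fix f assume f: "f \<in> Arr J"
  note Df = FArr_in[OF Arr_hom[OF f]] and o = source.Dom_in[OF f] source.Cod_in[OF f]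
  show "leg (Cod J f) \<cdot>\<^bsub>DLat\<^esub> FArr D f = leg (Dom J f)"
  proof (rule hom_DLat_eqI)
    show "leg (Cod J f) \<cdot>\<^bsub>DLat\<^esub> FArr D f \<in> hom DLat (FObj D (Dom J f)) tip"
      by (rule target.Comp_in[OF Df leg_in_hom[OF o(2)]])
    show "leg (Dom J f) \<in> hom DLat (FObj D (Dom J f)) tip" by (rule leg_in_hom[OF o(1)])
    fix a assume a: "a \<in> carrier (FObj D (Dom J f))"
    have "cls (Gen (Cod J f, fn (FArr D f) a)) = cls (Gen (Dom J f, a))"
      using a o hom_DLatD(7)[OF Df] cocone_compatible[OF _ f a] by (subst cls_eq_iff_term_value) auto
    then show "fn (leg (Cod J f) \<cdot>\<^bsub>DLat\<^esub> FArr D f) a = fn (leg (Dom J f)) a"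
      using a hom_DLatD(7)[OF Df a] by (simp only: DLat_comp_apply[OF Df a]) (simp add: leg_def)
  qed
qed

text \<open>
  The elements of the legs generate the colimit, hence a map out of it has no freedom on terms.
\<close>

lemma mediating_value:
  assumes c: "is_cocone J DLat D Y \<kappa>" and h: "h \<in> hom DLat tip Y"
    and hl: "\<And>j. j \<in> Obj J \<Longrightarrow> h \<cdot>\<^bsub>DLat\<^esub> leg j = \<kappa> j" and t: "t \<in> terms"
  shows "fn h (cls t) = term_value Y \<kappa> t"
  using t
proof (induction t)
  case (Gen x)
  obtain j a where x: "x = (j, a)" by (cases x)
  with Gen have j: "j \<in> Obj J" "a \<in> carrier (FObj D j)" by auto
  have "fn (\<kappa> j) a = fn (h \<cdot>\<^bsub>DLat\<^esub> leg j) a" using hl[OF j(1)] by simp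
  also have "\<dots> = fn h (cls (Gen (j, a)))" using j by (simp add: leg_def compose_def)
  finally show ?case by (simp add: x)
qed (use h in \<open>auto simp: hom_DLat bounded_lattice_hom_def meet_pres_def join_pres_def
    tip_operations[symmetric] tip_bounds[symmetric]\<close>)

lemma is_colimit_tip: "is_colimit J DLat D tip leg"
  unfolding is_colimit_def
proof (intro conjI allI impI)
  show "is_functor J DLat D" by unfold_locales
  show "is_cocone J DLat D tip leg" by (rule is_cocone_tip)
  fix Y \<kappa> assume c: "is_cocone J DLat D Y \<kappa>"
  interpret Y: bounded_lattice Y by (rule cocone_tip_bounded[OF c])
  interpret tip: bounded_lattice tip by (rule bounded_lattice_tip)
  have lat: "lattice Y" "lattice tip" by unfold_locales
  \<comment> \<open>Evaluation of terms in \<open>Y\<close> respects equivalence since \<open>Y\<close> is among the cocones in \<open>below\<close>.\<close>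
  define h where "h = Arrow tip Y (\<lambda>A\<in>carrier tip. term_value Y \<kappa> (SOME t. t \<in> terms \<and> cls t = A))"
  have h: "fn h (cls t) = term_value Y \<kappa> t" if t: "t \<in> terms" for t
  proof -
    let ?s = "SOME s. s \<in> terms \<and> cls s = cls t"
    have "?s \<in> terms \<and> cls ?s = cls t" by (rule someI[of _ t]) (simp add: t)
    then show ?thesis using t c by (auto simp: h_def cls_eq_iff_term_value)
  qed
  have "bounded_lattice_hom tip Y (fn h)"
    unfolding bounded_lattice_hom_def
  proof (intro conjI)
    show "fn h \<in> carrier tip \<rightarrow>\<^sub>E carrier Y"
    proof (rule PiE_I)
      fix A assume "A \<in> carrier tip"
      then show "fn h A \<in> carrier Y" using term_value_closed[OF c] by (auto simp: carrier_tip h)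
    qed (simp add: h_def)
    show "meet_pres tip Y (fn h)" "join_pres tip Y (fn h)"
      by (auto simp: meet_pres_def join_pres_def lat carrier_tip tip_operations h)
    show "fn h \<top>\<^bsub>tip\<^esub> = \<top>\<^bsub>Y\<^esub>" "fn h \<bottom>\<^bsub>tip\<^esub> = \<bottom>\<^bsub>Y\<^esub>" by (simp_all add: tip_bounds h)
  qed
  then have hom: "h \<in> hom DLat tip Y"
    by (simp add: hom_DLat distributive_lattice_tip cocone_tip[OF c] h_def)
  have "h \<cdot>\<^bsub>DLat\<^esub> leg j = \<kappa> j" if j: "j \<in> Obj J" for j
  proof (rule hom_DLat_eqI[OF target.Comp_in[OF leg_in_hom[OF j] hom] cocone_leg[OF c j]])
    fix a assume a: "a \<in> carrier (FObj D j)"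
    with j h[of "Gen (j, a)"] show "fn (h \<cdot>\<^bsub>DLat\<^esub> leg j) a = fn (\<kappa> j) a"
      by (simp only: DLat_comp_apply[OF leg_in_hom[OF j] a]) (simp add: leg_def)
  qed
  moreover have "g = h" if g: "g \<in> hom DLat tip Y" "\<forall>j \<in> Obj J. g \<cdot>\<^bsub>DLat\<^esub> leg j = \<kappa> j" for g
    using mediating_value[OF c g(1)] g(2)
    by (intro hom_DLat_eqI[OF g(1) hom]) (auto simp del: DLat_simps simp: carrier_tip h)
  ultimately show "\<exists>!h. h \<in> hom DLat tip Y \<and> (\<forall>j \<in> Obj J. h \<cdot>\<^bsub>DLat\<^esub> leg j = \<kappa> j)"
    using hom by blast
qed

end

text \<open>
  Since \<open>colimit\<close> is a choice, nothing can be said about its value before a colimit is known to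
  exist. Smallness of the diagram is measured against \<open>'u\<close> rather than \<open>'u set\<close>, because the elements
  of the colimit are sets of codes in \<open>'u\<close>.
\<close>

theorem DLat_small_colimits:
  fixes D :: "('j, 'i, 'u set gorder, ('u set gorder, 'u set \<Rightarrow> 'u set) arrow) func"
  assumes "infinite (UNIV :: 'u set)" and "is_functor J DLat D"
    and e: "inj_on (e :: 'j \<times> 'u set \<Rightarrow> 'u) (Sigma (Obj J) (\<lambda>j. carrier (FObj D j)))"
  shows "is_colimit J DLat D (fst (colimit J DLat D)) (snd (colimit J DLat D))"
proof -
  obtain enc where "inj_on (enc :: _ \<Rightarrow> 'u) {t. set_lattice_term t \<subseteq> Sigma (Obj J) (\<lambda>j. carrier (FObj D j))}"
    using lattice_terms_small[OF assms(1) e] by blast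
  then interpret lattice_diagram J D enc
    using assms(2) by (simp add: lattice_diagram_def lattice_diagram_axioms_def)
  have "case colimit J DLat D of (X, \<iota>) \<Rightarrow> is_colimit J DLat D X \<iota>"
    unfolding colimit_def by (rule someI[of _ "(tip, leg)"]) (simp add: is_colimit_tip)
  then show ?thesis by (simp add: case_prod_beta)
qed

section \<open>Lattices of subobjects\<close>

text \<open>
  A subobject is studied through the sieve of the arrows that lie in it. The sieve determines the
  subobject; its advantage is that it turns the order into inclusion, meets into intersections and
  pullback along \<open>f\<close> into the preimage under composition with \<open>f\<close>, so that laws about them become
  propositional.
\<close>

definition lies_in :: "('o, 'm, 'z) cat_scheme \<Rightarrow> 'm \<Rightarrow> 'm set \<Rightarrow> bool" where
  "lies_in C g S \<longleftrightarrow> (\<exists>m \<in> S. factors_through C g m)"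

context category
begin

lemma Comp_Arr:
  assumes "f \<in> Arr C" "g \<in> Arr C" "Dom C g = Cod C f"
  shows "g \<cdot> f \<in> Arr C" "Dom C (g \<cdot> f) = Dom C f" "Cod C (g \<cdot> f) = Cod C g"
  using Comp_in[of f "Dom C f" "Cod C f" g "Cod C g"] assms by (auto simp: hom_def)

lemma Comp_assoc_Arr:
  assumes "f \<in> Arr C" "g \<in> Arr C" "h \<in> Arr C" "Dom C g = Cod C f" "Dom C h = Cod C g"
  shows "(h \<cdot> g) \<cdot> f = h \<cdot> (g \<cdot> f)"
  using Comp_assoc[of f "Dom C f" "Cod C f" g "Cod C g" h "Cod C h"] assms by (auto simp: hom_def)

lemma factors_throughI:
  assumes "m \<in> Arr C" "k \<in> Arr C" "Cod C k = Dom C m" "f = m \<cdot> k"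
  shows "factors_through C f m"
  using assms Comp_Arr[of k m] by (auto simp: factors_through_def hom_def)

lemma factors_throughE:
  assumes "factors_through C f m"
  obtains k where "k \<in> Arr C" "Cod C k = Dom C m" "f = m \<cdot> k" "m \<in> Arr C" "Dom C k = Dom C f"
  using assms unfolding factors_through_def hom_def by blast

lemma factors_through_refl: "m \<in> Arr C \<Longrightarrow> factors_through C m m"
  by (rule factors_throughI[of _ "Ident C (Dom C m)"])
    (use Ident_right[of m] Ident_in[of "Dom C m"] Dom_in[of m] in \<open>auto simp: hom_def\<close>)

lemma factors_through_trans:
  assumes "factors_through C f m" "factors_through C m n"
  shows "factors_through C f n"
proof -
  obtain k where k: "k \<in> Arr C" "Cod C k = Dom C m" "f = m \<cdot> k" using assms(1) by (rule factors_throughE)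
  obtain l where l: "l \<in> Arr C" "Cod C l = Dom C n" "m = n \<cdot> l" "n \<in> Arr C"
    using assms(2) by (rule factors_throughE)
  show ?thesis
    by (rule factors_throughI[of _ "l \<cdot> k"]) (use k l in \<open>simp_all add: Comp_Arr Comp_assoc_Arr\<close>)
qed

lemma is_monoD: "is_mono C m \<Longrightarrow> m \<in> Arr C"
  by (simp add: is_mono_def)

lemma mono_cancel:
  assumes "is_mono C m" "f \<in> Arr C" "g \<in> Arr C" "Dom C f = Dom C g" "Cod C f = Dom C m"
    "Cod C g = Dom C m" "m \<cdot> f = m \<cdot> g"
  shows "f = g"
  using assms by (auto simp: is_mono_def hom_def)

lemma is_monoI:
  assumes "m \<in> Arr C"
    and "\<And>f g. f \<in> Arr C \<Longrightarrow> g \<in> Arr C \<Longrightarrow> Dom C f = Dom C g \<Longrightarrow> Cod C f = Dom C m \<Longrightarrow>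
      Cod C g = Dom C m \<Longrightarrow> m \<cdot> f = m \<cdot> g \<Longrightarrow> f = g"
  shows "is_mono C m"
  unfolding is_mono_def hom_def using assms by blast

lemma is_mono_Ident: "x \<in> Obj C \<Longrightarrow> is_mono C (Ident C x)"
proof (rule is_monoI)
  assume x: "x \<in> Obj C"
  note id = Ident_in[OF x]
  show "Ident C x \<in> Arr C" using id by (simp add: hom_def)
  fix f g assume "f \<in> Arr C" "g \<in> Arr C" "Cod C f = Dom C (Ident C x)" "Cod C g = Dom C (Ident C x)"
    and eq: "Ident C x \<cdot> f = Ident C x \<cdot> g"
  then have "f \<in> hom C (Dom C f) x" "g \<in> hom C (Dom C g) x" using id by (simp_all add: hom_def)
  then show "f = g" using eq Ident_left by metis
qed

lemma is_mono_comp: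
  assumes m: "is_mono C m" and p: "is_mono C p" and mp: "Dom C m = Cod C p"
  shows "is_mono C (m \<cdot> p)"
proof (rule is_monoI)
  note ar = is_monoD[OF m] is_monoD[OF p]
  show "m \<cdot> p \<in> Arr C" using ar mp by (simp add: Comp_Arr)
  fix f g assume fg: "f \<in> Arr C" "g \<in> Arr C" "Dom C f = Dom C g" "Cod C f = Dom C (m \<cdot> p)"
      "Cod C g = Dom C (m \<cdot> p)" "(m \<cdot> p) \<cdot> f = (m \<cdot> p) \<cdot> g"
  then have "m \<cdot> (p \<cdot> f) = m \<cdot> (p \<cdot> g)" using ar mp by (simp add: Comp_Arr Comp_assoc_Arr)
  then have eq: "p \<cdot> f = p \<cdot> g"
    by (rule mono_cancel[OF m, rotated 5]) (use fg(1-5) ar mp in \<open>simp_all add: Comp_Arr\<close>)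
  show "f = g"
    by (rule mono_cancel[OF p _ _ _ _ _ eq]) (use fg(1-5) ar mp in \<open>simp_all add: Comp_Arr\<close>)
qed

lemma subobject_self: "is_mono C m \<Longrightarrow> m \<in> subobject C m"
  by (simp add: subobject_def factors_through_refl is_monoD)

lemma subobject_in_Sub: "is_mono C m \<Longrightarrow> subobject C m \<in> carrier (Sub C (Cod C m))"
  by (auto simp: Sub_def)

lemma Sub_member:
  assumes "S \<in> carrier (Sub C x)" "m \<in> S"
  shows "is_mono C m" "Cod C m = x" "S = subobject C m"
proof -
  obtain n where n: "S = subobject C n" "is_mono C n" "Cod C n = x"
    using assms(1) by (auto simp: Sub_def)
  with assms(2) have m: "is_mono C m" "factors_through C m n" "factors_through C n m"
    by (auto simp: subobject_def)
  then show "is_mono C m" "Cod C m = x" using n by (auto simp: factors_through_def)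
  show "S = subobject C m" unfolding n subobject_def using m factors_through_trans by blast
qed

lemma Sub_nonempty: "S \<in> carrier (Sub C x) \<Longrightarrow> \<exists>m. m \<in> S"
  using subobject_self by (auto simp: Sub_def)

lemma Sub_rep:
  assumes "S \<in> carrier (Sub C x)"
  obtains m where "is_mono C m" "m \<in> Arr C" "Cod C m = x" "S = subobject C m" "m \<in> S"
  using assms Sub_nonempty Sub_member is_monoD by metis

lemma lies_in_subobject: "is_mono C m \<Longrightarrow> lies_in C g (subobject C m) \<longleftrightarrow> factors_through C g m"
  unfolding lies_in_def using subobject_self factors_through_trans by (auto simp: subobject_def)

lemma le_Sub_iff:
  assumes "S \<in> carrier (Sub C x)" "T \<in> carrier (Sub C x)"
  shows "S \<sqsubseteq>\<^bsub>Sub C x\<^esub> T \<longleftrightarrow> (\<forall>g \<in> Arr C. Cod C g = x \<longrightarrow> lies_in C g S \<longrightarrow> lies_in C g T)"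
proof
  assume "S \<sqsubseteq>\<^bsub>Sub C x\<^esub> T"
  then obtain m n where "m \<in> S" "n \<in> T" "factors_through C m n" by (auto simp: Sub_def)
  with assms show "\<forall>g \<in> Arr C. Cod C g = x \<longrightarrow> lies_in C g S \<longrightarrow> lies_in C g T"
    using Sub_member lies_in_subobject factors_through_trans by metis
next
  assume *: "\<forall>g \<in> Arr C. Cod C g = x \<longrightarrow> lies_in C g S \<longrightarrow> lies_in C g T"
  obtain m where m: "is_mono C m" "m \<in> Arr C" "Cod C m = x" "m \<in> S" using Sub_rep[OF assms(1)] .
  then have "lies_in C m S" using factors_through_refl by (auto simp: lies_in_def)
  with * m have "lies_in C m T" by simp
  with m show "S \<sqsubseteq>\<^bsub>Sub C x\<^esub> T" by (auto simp: Sub_def lies_in_def)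
qed

lemma Sub_eqI:
  assumes "S \<in> carrier (Sub C x)" "T \<in> carrier (Sub C x)"
    and "\<And>g. g \<in> Arr C \<Longrightarrow> Cod C g = x \<Longrightarrow> lies_in C g S \<longleftrightarrow> lies_in C g T"
  shows "S = T"
proof -
  obtain m where m: "is_mono C m" "m \<in> Arr C" "Cod C m = x" "S = subobject C m" using Sub_rep[OF assms(1)] .
  obtain n where n: "is_mono C n" "n \<in> Arr C" "Cod C n = x" "T = subobject C n" using Sub_rep[OF assms(2)] .
  have "factors_through C m n" "factors_through C n m"
    using assms(3)[of m] assms(3)[of n] m n by (auto simp: lies_in_subobject factors_through_refl)
  then show "S = T" unfolding m n subobject_def using factors_through_trans by blast
qed

subsection \<open>Pullback of subobjects\<close>

lemma pullbackD:
  assumes "is_pullback C f m p q"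
  shows "f \<in> Arr C" "m \<in> Arr C" "p \<in> Arr C" "q \<in> Arr C" "Cod C f = Cod C m" "Cod C p = Dom C f"
    "Dom C q = Dom C p" "Cod C q = Dom C m" "f \<cdot> p = m \<cdot> q"
  using assms by (auto simp: is_pullback_def hom_def)

lemma pullback_factor:
  assumes "is_pullback C f m p q" "a \<in> Arr C" "b \<in> Arr C" "Dom C a = Dom C b"
    "Cod C a = Dom C f" "Cod C b = Dom C m" "f \<cdot> a = m \<cdot> b"
  obtains h where "h \<in> Arr C" "Dom C h = Dom C a" "Cod C h = Dom C p" "p \<cdot> h = a" "q \<cdot> h = b"
proof -
  have "\<exists>!h. h \<in> hom C (Dom C a) (Dom C p) \<and> p \<cdot> h = a \<and> q \<cdot> h = b"
  proof -
    have "a \<in> hom C (Dom C a) (Dom C f)" "b \<in> hom C (Dom C a) (Dom C m)"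
      using assms by (simp_all add: hom_def)
    with assms(1,7) show ?thesis unfolding is_pullback_def by blast
  qed
  then obtain h where "h \<in> hom C (Dom C a) (Dom C p)" "p \<cdot> h = a" "q \<cdot> h = b" by blast
  then show ?thesis by (intro that[of h]) (simp_all add: hom_def)
qed

text \<open>
  The part of the universal property of a pullback that sieves can see. For monomorphisms it
  characterizes pullbacks, as shown in \<open>mono_is_pullbackI\<close> below.
\<close>

lemma pullback_factors_iff:
  assumes pb: "is_pullback C f m p q" and g: "g \<in> Arr C" "Cod C g = Dom C f"
  shows "factors_through C g p \<longleftrightarrow> factors_through C (f \<cdot> g) m"
proof
  note D = pullbackD[OF pb]
  assume "factors_through C g p"
  then obtain k where k: "k \<in> Arr C" "Cod C k = Dom C p" "g = p \<cdot> k"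
    by (rule factors_throughE)
  have "f \<cdot> g = (f \<cdot> p) \<cdot> k" using k D(1,3,6) Comp_assoc_Arr[of k p f] by simp
  also have "\<dots> = m \<cdot> (q \<cdot> k)" unfolding D(9) using k D by (simp add: Comp_assoc_Arr)
  finally show "factors_through C (f \<cdot> g) m"
    using k D by (intro factors_throughI[of _ "q \<cdot> k"]) (simp_all add: Comp_Arr)
next
  note D = pullbackD[OF pb]
  assume "factors_through C (f \<cdot> g) m"
  then obtain k where k: "k \<in> Arr C" "Cod C k = Dom C m" "f \<cdot> g = m \<cdot> k" "Dom C k = Dom C (f \<cdot> g)"
    by (rule factors_throughE)
  then have "Dom C g = Dom C k" using g D(1) Comp_Arr(2)[of g f] by simp
  then obtain h where "h \<in> Arr C" "Cod C h = Dom C p" "p \<cdot> h = g"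
    using pullback_factor[OF pb g(1) k(1) _ g(2) k(2,3)] by metis
  then show "factors_through C g p" using D by (intro factors_throughI[of _ h]) auto
qed

lemma is_mono_pullback:
  assumes pb: "is_pullback C f m p q" and m: "is_mono C m"
  shows "is_mono C p"
proof (rule is_monoI)
  note D = pullbackD[OF pb]
  show "p \<in> Arr C" by fact
  fix a b assume ab: "a \<in> Arr C" "b \<in> Arr C" "Dom C a = Dom C b" "Cod C a = Dom C p"
      "Cod C b = Dom C p" "p \<cdot> a = p \<cdot> b"
  have eq: "f \<cdot> (p \<cdot> c) = m \<cdot> (q \<cdot> c)" if "c \<in> Arr C" "Cod C c = Dom C p" for c
    using that D Comp_assoc_Arr[of c p f] Comp_assoc_Arr[of c q m] by simp
  have "m \<cdot> (q \<cdot> a) = m \<cdot> (q \<cdot> b)" using eq[of a] eq[of b] ab by simp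
  then have q: "q \<cdot> a = q \<cdot> b"
    by (rule mono_cancel[OF m, rotated 5]) (use ab(1-5) D in \<open>simp_all add: Comp_Arr\<close>)
  have "\<exists>!h. h \<in> hom C (Dom C a) (Dom C p) \<and> p \<cdot> h = p \<cdot> a \<and> q \<cdot> h = q \<cdot> a"
  proof -
    have "p \<cdot> a \<in> hom C (Dom C a) (Dom C f)" "q \<cdot> a \<in> hom C (Dom C a) (Dom C m)"
      using ab D by (auto simp: hom_def Comp_Arr)
    with pb eq[OF ab(1,4)] show ?thesis unfolding is_pullback_def by blast
  qed
  with ab q show "a = b" by (auto simp: hom_def)
qed

lemma mono_is_pullbackI:
  assumes m: "is_mono C m" and p: "is_mono C p" and f: "f \<in> Arr C" "Cod C f = Cod C m" "Cod C p = Dom C f"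
    and iff: "\<And>g. g \<in> Arr C \<Longrightarrow> Cod C g = Dom C f \<Longrightarrow>
      factors_through C g p \<longleftrightarrow> factors_through C (f \<cdot> g) m"
  shows "\<exists>q. is_pullback C f m p q"
proof -
  note ar = is_monoD[OF m] is_monoD[OF p]
  have "factors_through C (f \<cdot> p) m" using iff[of p] ar f factors_through_refl by simp
  then obtain q where q: "q \<in> Arr C" "Cod C q = Dom C m" "f \<cdot> p = m \<cdot> q" "Dom C q = Dom C (f \<cdot> p)"
    by (rule factors_throughE)
  then have Dq: "Dom C q = Dom C p" using ar f Comp_Arr(2)[of p f] by simp
  have "\<exists>!h. h \<in> hom C w (Dom C p) \<and> p \<cdot> h = a \<and> q \<cdot> h = b"
    if "a \<in> hom C w (Dom C f)" "b \<in> hom C w (Dom C m)" "f \<cdot> a = m \<cdot> b" for w a b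
  proof -
    have ab: "a \<in> Arr C" "Dom C a = w" "Cod C a = Dom C f" "b \<in> Arr C" "Dom C b = w" "Cod C b = Dom C m"
      using that by (auto simp: hom_def)
    have "factors_through C (f \<cdot> a) m" using ab ar that(3) by (intro factors_throughI) auto
    then have "factors_through C a p" using iff ab by simp
    then obtain h where h: "h \<in> Arr C" "Cod C h = Dom C p" "a = p \<cdot> h" "Dom C h = Dom C a"
      by (rule factors_throughE)
    have "m \<cdot> (q \<cdot> h) = (m \<cdot> q) \<cdot> h" using h(1,2) q(1,2) ar Dq by (simp add: Comp_assoc_Arr)
    also have "\<dots> = (f \<cdot> p) \<cdot> h" by (simp only: q(3))
    also have "\<dots> = m \<cdot> b" using h(1-3) f ar that(3) by (simp add: Comp_assoc_Arr)
    finally have eq: "m \<cdot> (q \<cdot> h) = m \<cdot> b" .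
    have "q \<cdot> h = b"
      by (rule mono_cancel[OF m _ _ _ _ _ eq]) (use h(1,2,4) q(1,2) ab Dq in \<open>simp_all add: Comp_Arr\<close>)
    moreover have "h' = h" if "h' \<in> hom C w (Dom C p)" "p \<cdot> h' = a" for h'
      by (rule mono_cancel[OF p]) (use that h(1,2,4) ab in \<open>auto simp: hom_def simp flip: h(3)\<close>)
    moreover have "h \<in> hom C w (Dom C p)" using h(1,2,4) ab by (simp add: hom_def)
    ultimately show ?thesis using h(3) by blast
  qed
  moreover have "p \<in> hom C (Dom C p) (Dom C f)" "q \<in> hom C (Dom C p) (Dom C m)"
    using ar f q Dq by (simp_all add: hom_def)
  ultimately show ?thesis using ar f q(3) unfolding is_pullback_def by blast
qed

text \<open>
  By definition \<open>pull\<close> collects the pullbacks of all representatives. They have the same sieve, so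
  they represent the same subobject; and a monomorphism with that sieve is itself a pullback, so
  the whole equivalence class is reached.
\<close>

lemma pull_subobject:
  assumes m: "is_mono C m" and pb: "is_pullback C f m p q"
  shows "pull C f (subobject C m) = subobject C p"
proof (intro equalityI subsetI)
  note D = pullbackD[OF pb]
  fix p' assume "p' \<in> pull C f (subobject C m)"
  then obtain m' q' where m': "m' \<in> subobject C m" and pb': "is_pullback C f m' p' q'"
    by (auto simp: pull_def)
  from m' have m'': "is_mono C m'" "factors_through C m m'" "factors_through C m' m"
    by (auto simp: subobject_def)
  note D' = pullbackD[OF pb']
  have "factors_through C p p'"
    using pullback_factors_iff[OF pb', of p] pullback_factors_iff[OF pb, of p] D m''
    by (meson factors_through_refl factors_through_trans)
  moreover have "factors_through C p' p"
    using pullback_factors_iff[OF pb', of p'] pullback_factors_iff[OF pb, of p'] D' m''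
    by (meson factors_through_refl factors_through_trans)
  ultimately show "p' \<in> subobject C p"
    using is_mono_pullback[OF pb' m''(1)] by (simp add: subobject_def)
next
  note D = pullbackD[OF pb]
  fix p' assume "p' \<in> subobject C p"
  then have p': "is_mono C p'" "factors_through C p p'" "factors_through C p' p"
    by (auto simp: subobject_def)
  have "\<exists>q'. is_pullback C f m p' q'"
  proof (rule mono_is_pullbackI[OF m p'(1)])
    show "Cod C p' = Dom C f" using p' D by (simp add: factors_through_def)
    fix g assume "g \<in> Arr C" "Cod C g = Dom C f"
    then show "factors_through C g p' \<longleftrightarrow> factors_through C (f \<cdot> g) m"
      using pullback_factors_iff[OF pb, of g] p' by (meson factors_through_trans)
  qed (use D in auto)
  then show "p' \<in> pull C f (subobject C m)" using subobject_self[OF m] by (auto simp: pull_def)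
qed

end

context coherent_category
begin

lemma pull_sieve:
  assumes f: "f \<in> hom C y x" and S: "S \<in> carrier (Sub C x)"
  shows pull_in_Sub: "pull C f S \<in> carrier (Sub C y)"
    and lies_in_pull: "\<And>g. g \<in> Arr C \<Longrightarrow> Cod C g = y \<Longrightarrow> lies_in C g (pull C f S) \<longleftrightarrow> lies_in C (f \<cdot> g) S"
proof -
  obtain m where m: "is_mono C m" "m \<in> Arr C" "Cod C m = x" "S = subobject C m" using Sub_rep[OF S] .
  obtain p q where pb: "is_pullback C f m p q" using pullbacks[of f m] f m by (auto simp: hom_def)
  note D = pullbackD[OF pb] and p = is_mono_pullback[OF pb m(1)]
  have eq: "pull C f S = subobject C p" using pull_subobject[OF m(1) pb] m by simp
  show "pull C f S \<in> carrier (Sub C y)" using subobject_in_Sub[OF p] eq D f by (simp add: hom_def)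
  show "lies_in C g (pull C f S) \<longleftrightarrow> lies_in C (f \<cdot> g) S" if "g \<in> Arr C" "Cod C g = y" for g
    unfolding eq unfolding m(4)
    using that f m(1) p by (simp add: lies_in_subobject pullback_factors_iff[OF pb] hom_def)
qed

lemma pull_Ident:
  assumes "S \<in> carrier (Sub C x)" "x \<in> Obj C"
  shows "pull C (Ident C x) S = S"
  using pull_sieve[OF Ident_in[OF assms(2)] assms(1)] assms Ident_left
  by (intro Sub_eqI[of _ x]) (auto simp: hom_def)

lemma pull_comp:
  assumes f: "f \<in> hom C z y" and g: "g \<in> hom C y x" and S: "S \<in> carrier (Sub C x)"
  shows "pull C (g \<cdot> f) S = pull C f (pull C g S)"
proof (rule Sub_eqI)
  note 1 = pull_sieve[OF Comp_in[OF f g] S] and 2 = pull_sieve[OF g S] note 3 = pull_sieve[OF f 2(1)]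
  show "pull C (g \<cdot> f) S \<in> carrier (Sub C z)" "pull C f (pull C g S) \<in> carrier (Sub C z)" by fact+
  fix h assume h: "h \<in> Arr C" "Cod C h = z"
  then show "lies_in C h (pull C (g \<cdot> f) S) \<longleftrightarrow> lies_in C h (pull C f (pull C g S))"
    using 1(2)[OF h] 2(2)[of "f \<cdot> h"] 3(2)[OF h] f g by (simp add: hom_def Comp_assoc_Arr Comp_Arr)
qed

subsection \<open>The lattice of subobjects\<close>

lemma is_union_iff:
  assumes "\<A> \<subseteq> carrier (Sub C x)"
  shows "is_union C x \<A> U \<longleftrightarrow> U \<in> carrier (Sub C x) \<and> (\<forall>S \<in> \<A>. S \<sqsubseteq>\<^bsub>Sub C x\<^esub> U) \<and>
    (\<forall>V \<in> carrier (Sub C x). (\<forall>S \<in> \<A>. S \<sqsubseteq>\<^bsub>Sub C x\<^esub> V) \<longrightarrow> U \<sqsubseteq>\<^bsub>Sub C x\<^esub> V)"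
  using assms unfolding is_union_def least_def Upper_def by blast

text \<open>
  The intersection of two subobjects is the diagonal of the pullback square of representatives.
  The sieve condition holds for all arrows, not only for monomorphisms, which makes \<open>pull\<close>
  preserve meets.
\<close>

lemma ex_intersection:
  assumes S: "S \<in> carrier (Sub C x)" and T: "T \<in> carrier (Sub C x)"
  shows "\<exists>U \<in> carrier (Sub C x). \<forall>g. lies_in C g U \<longleftrightarrow> lies_in C g S \<and> lies_in C g T"
proof -
  obtain m where m: "is_mono C m" "m \<in> Arr C" "Cod C m = x" "S = subobject C m" using Sub_rep[OF S] .
  obtain n where n: "is_mono C n" "n \<in> Arr C" "Cod C n = x" "T = subobject C n" using Sub_rep[OF T] .
  obtain p q where pb: "is_pullback C m n p q" using pullbacks[of m n] m n by auto
  note D = pullbackD[OF pb]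
  have mono: "is_mono C (m \<cdot> p)"
    using is_mono_comp[OF m(1) is_mono_pullback[OF pb n(1)]] D by simp
  have "factors_through C g (m \<cdot> p) \<longleftrightarrow> factors_through C g m \<and> factors_through C g n" for g
  proof
    have "factors_through C (m \<cdot> p) m" using D by (intro factors_throughI) auto
    moreover have "factors_through C (m \<cdot> p) n" using D by (intro factors_throughI[of _ q]) auto
    moreover assume "factors_through C g (m \<cdot> p)"
    ultimately show "factors_through C g m \<and> factors_through C g n"
      using factors_through_trans by blast
  next
    assume *: "factors_through C g m \<and> factors_through C g n"
    then obtain k where k: "k \<in> Arr C" "Cod C k = Dom C m" "g = m \<cdot> k"
      by (blast elim: factors_throughE)
    with * have "factors_through C k p" using pullback_factors_iff[OF pb, of k] by simp
    then obtain h where h: "h \<in> Arr C" "Cod C h = Dom C p" "k = p \<cdot> h"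
      by (rule factors_throughE)
    show "factors_through C g (m \<cdot> p)"
      by (rule factors_throughI[of _ h]) (use h k D(1,2,3,5,6) in \<open>simp_all add: Comp_Arr Comp_assoc_Arr\<close>)
  qed
  then show ?thesis
    using subobject_in_Sub[OF mono] m n mono D
    by (intro bexI[of _ "subobject C (m \<cdot> p)"]) (auto simp: lies_in_subobject Comp_Arr)
qed

lemma lies_in_total:
  assumes "x \<in> Obj C" "g \<in> Arr C" "Cod C g = x"
  shows "lies_in C g (subobject C (Ident C x))"
  using assms Ident_in[of x] Ident_left[of g "Dom C g" x]
  by (simp add: lies_in_subobject is_mono_Ident)
    (intro factors_throughI[of _ g], auto simp: hom_def)

lemma total_in_Sub: "x \<in> Obj C \<Longrightarrow> subobject C (Ident C x) \<in> carrier (Sub C x)"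
  by (metis subobject_in_Sub is_mono_Ident Ident_in homD(3))

lemma bounded_lattice_Sub:
  assumes x: "x \<in> Obj C"
  shows "bounded_lattice (Sub C x)"
proof (rule bounded_latticeI)
  show "eq (Sub C x) = (=)" by (simp add: Sub_def)
  show "S \<sqsubseteq>\<^bsub>Sub C x\<^esub> S" if "S \<in> carrier (Sub C x)" for S
    using that by (simp add: le_Sub_iff)
  show "S = T" if "S \<in> carrier (Sub C x)" "T \<in> carrier (Sub C x)" "S \<sqsubseteq>\<^bsub>Sub C x\<^esub> T" "T \<sqsubseteq>\<^bsub>Sub C x\<^esub> S" for S T
    using that(3,4) by (intro Sub_eqI[OF that(1,2)]) (auto simp: le_Sub_iff that(1,2))
  show "S \<sqsubseteq>\<^bsub>Sub C x\<^esub> U" if "S \<in> carrier (Sub C x)" "T \<in> carrier (Sub C x)" "U \<in> carrier (Sub C x)"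
    "S \<sqsubseteq>\<^bsub>Sub C x\<^esub> T" "T \<sqsubseteq>\<^bsub>Sub C x\<^esub> U" for S T U
    using that(4,5) by (simp add: le_Sub_iff that(1-3))
next
  fix S T assume ST: "S \<in> carrier (Sub C x)" "T \<in> carrier (Sub C x)"
  obtain U where U: "U \<in> carrier (Sub C x)" "\<forall>g. lies_in C g U \<longleftrightarrow> lies_in C g S \<and> lies_in C g T"
    using ex_intersection[OF ST] by blast
  then show "\<exists>U \<in> carrier (Sub C x). U \<sqsubseteq>\<^bsub>Sub C x\<^esub> S \<and> U \<sqsubseteq>\<^bsub>Sub C x\<^esub> T \<and>
      (\<forall>V \<in> carrier (Sub C x). V \<sqsubseteq>\<^bsub>Sub C x\<^esub> S \<longrightarrow> V \<sqsubseteq>\<^bsub>Sub C x\<^esub> T \<longrightarrow> V \<sqsubseteq>\<^bsub>Sub C x\<^esub> U)"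
    using ST by (intro bexI[of _ U]) (simp_all add: le_Sub_iff)
  obtain V where "is_union C x {S, T} V" using unions[OF x, of "{S, T}"] ST by auto
  then show "\<exists>U \<in> carrier (Sub C x). S \<sqsubseteq>\<^bsub>Sub C x\<^esub> U \<and> T \<sqsubseteq>\<^bsub>Sub C x\<^esub> U \<and>
      (\<forall>V \<in> carrier (Sub C x). S \<sqsubseteq>\<^bsub>Sub C x\<^esub> V \<longrightarrow> T \<sqsubseteq>\<^bsub>Sub C x\<^esub> V \<longrightarrow> U \<sqsubseteq>\<^bsub>Sub C x\<^esub> V)"
    using ST by (intro bexI[of _ V]) (simp_all add: is_union_iff)
next
  show "\<exists>T \<in> carrier (Sub C x). \<forall>S \<in> carrier (Sub C x). S \<sqsubseteq>\<^bsub>Sub C x\<^esub> T"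
    using total_in_Sub[OF x] lies_in_total[OF x]
    by (intro bexI[of _ "subobject C (Ident C x)"]) (simp_all add: le_Sub_iff)
  obtain V where "is_union C x {} V" using unions[OF x, of "{}"] by auto
  then show "\<exists>B \<in> carrier (Sub C x). \<forall>S \<in> carrier (Sub C x). B \<sqsubseteq>\<^bsub>Sub C x\<^esub> S"
    by (intro bexI[of _ V]) (simp_all add: is_union_iff)
qed

lemma lies_in_meet:
  assumes x: "x \<in> Obj C" and ST: "S \<in> carrier (Sub C x)" "T \<in> carrier (Sub C x)"
  shows "lies_in C g (S \<sqinter>\<^bsub>Sub C x\<^esub> T) \<longleftrightarrow> lies_in C g S \<and> lies_in C g T"
proof -
  interpret L: bounded_lattice "Sub C x" by (rule bounded_lattice_Sub[OF x])
  obtain U where U: "U \<in> carrier (Sub C x)" "\<forall>g. lies_in C g U \<longleftrightarrow> lies_in C g S \<and> lies_in C g T"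
    using ex_intersection[OF ST] by blast
  then have "S \<sqinter>\<^bsub>Sub C x\<^esub> T = U" using ST by (intro L.meet_eqI) (simp_all add: le_Sub_iff)
  with U show ?thesis by simp
qed

lemma is_union_join:
  assumes x: "x \<in> Obj C" and ST: "S \<in> carrier (Sub C x)" "T \<in> carrier (Sub C x)"
  shows "is_union C x {S, T} U \<longleftrightarrow> U = S \<squnion>\<^bsub>Sub C x\<^esub> T"
proof -
  interpret L: bounded_lattice "Sub C x" by (rule bounded_lattice_Sub[OF x])
  show ?thesis
    using ST L.join_left[OF ST] L.join_right[OF ST] L.join_le[of S _ T] L.join_eqI[OF ST, of U]
    by (auto simp: is_union_iff)
qed

lemma is_union_bottom:
  assumes x: "x \<in> Obj C"
  shows "is_union C x {} U \<longleftrightarrow> U = \<bottom>\<^bsub>Sub C x\<^esub>"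
proof -
  interpret L: bounded_lattice "Sub C x" by (rule bounded_lattice_Sub[OF x])
  show ?thesis using L.bottom_eq[of U] by (auto simp: is_union_iff)
qed

lemma top_Sub:
  assumes x: "x \<in> Obj C"
  shows "\<top>\<^bsub>Sub C x\<^esub> = subobject C (Ident C x)"
proof -
  interpret L: bounded_lattice "Sub C x" by (rule bounded_lattice_Sub[OF x])
  show ?thesis
    using total_in_Sub[OF x] lies_in_total[OF x]
    by (intro L.top_eq[symmetric]) (simp_all add: le_Sub_iff)
qed

lemma pull_join:
  assumes f: "f \<in> hom C y x" and ST: "S \<in> carrier (Sub C x)" "T \<in> carrier (Sub C x)"
  shows "pull C f (S \<squnion>\<^bsub>Sub C x\<^esub> T) = pull C f S \<squnion>\<^bsub>Sub C y\<^esub> pull C f T"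
proof -
  note o = hom_Obj[OF f]
  have "is_union C x {S, T} (S \<squnion>\<^bsub>Sub C x\<^esub> T)" using is_union_join[OF o(2) ST] by simp
  then have "is_union C y {pull C f S, pull C f T} (pull C f (S \<squnion>\<^bsub>Sub C x\<^esub> T))"
    using unions_stable[OF f, of "{S, T}"] ST by simp
  then show ?thesis using is_union_join[OF o(1)] pull_in_Sub[OF f] ST by simp
qed

text \<open>
  Let \<open>m\<close> represent \<open>A\<close>. Meeting with \<open>A\<close> is pulling back along \<open>m\<close> and then composing with \<open>m\<close>, so
  that \<open>A \<sqinter> V \<le> U\<close> is equivalent to \<open>m\<^sup>* V \<le> m\<^sup>* U\<close>. Pullback along \<open>m\<close> preserves joins; therefore
  the condition holds for \<open>S \<squnion> T\<close> as soon as it holds for \<open>S\<close> and for \<open>T\<close>.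
\<close>

lemma distributive_lattice_Sub:
  assumes x: "x \<in> Obj C"
  shows "distributive_lattice (Sub C x)"
proof (rule distributive_latticeI[OF bounded_lattice_Sub[OF x]])
  interpret L: bounded_lattice "Sub C x" by (rule bounded_lattice_Sub[OF x])
  fix A S T assume A: "A \<in> carrier (Sub C x)" and S: "S \<in> carrier (Sub C x)" and T: "T \<in> carrier (Sub C x)"
  obtain m where m: "is_mono C m" "m \<in> Arr C" "Cod C m = x" "A = subobject C m" using Sub_rep[OF A] .
  define y where "y = Dom C m"
  have mh: "m \<in> hom C y x" using m by (simp add: hom_def y_def)
  note y = hom_Obj(1)[OF mh]
  interpret Y: bounded_lattice "Sub C y" by (rule bounded_lattice_Sub[OF y])
  define U where "U = (A \<sqinter>\<^bsub>Sub C x\<^esub> S) \<squnion>\<^bsub>Sub C x\<^esub> (A \<sqinter>\<^bsub>Sub C x\<^esub> T)"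
  have U: "U \<in> carrier (Sub C x)" using A S T by (simp add: U_def)
  \<comment> \<open>One half of the equivalence: meeting with \<open>A\<close> below \<open>U\<close> gives an inclusion of pullbacks.\<close>
  have le: "pull C m V \<sqsubseteq>\<^bsub>Sub C y\<^esub> pull C m U"
    if V: "V \<in> carrier (Sub C x)" and AV: "A \<sqinter>\<^bsub>Sub C x\<^esub> V \<sqsubseteq>\<^bsub>Sub C x\<^esub> U" for V
  proof -
    have "lies_in C (m \<cdot> g) U" if "g \<in> Arr C" "Cod C g = y" "lies_in C (m \<cdot> g) V" for g
    proof -
      have mg: "m \<cdot> g \<in> Arr C" "Cod C (m \<cdot> g) = x" using that m by (simp_all add: Comp_Arr y_def)
      have "factors_through C (m \<cdot> g) m" using that m by (intro factors_throughI) (auto simp: y_def)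
      then have "lies_in C (m \<cdot> g) (A \<sqinter>\<^bsub>Sub C x\<^esub> V)"
        unfolding lies_in_meet[OF x A V] using that m by (simp add: lies_in_subobject)
      with AV mg show ?thesis using A V U by (simp add: le_Sub_iff)
    qed
    then show ?thesis by (simp add: le_Sub_iff pull_in_Sub[OF mh] lies_in_pull[OF mh] U V)
  qed
  have "pull C m (S \<squnion>\<^bsub>Sub C x\<^esub> T) \<sqsubseteq>\<^bsub>Sub C y\<^esub> pull C m U"
    unfolding pull_join[OF mh S T]
  proof (rule Y.join_le)
    show "pull C m S \<sqsubseteq>\<^bsub>Sub C y\<^esub> pull C m U"
      by (rule le[OF S]) (use A S T in \<open>simp add: U_def L.join_left\<close>)
    show "pull C m T \<sqsubseteq>\<^bsub>Sub C y\<^esub> pull C m U"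
      by (rule le[OF T]) (use A S T in \<open>simp add: U_def L.join_right\<close>)
  qed (use S T U in \<open>simp_all add: pull_in_Sub[OF mh]\<close>)
  \<comment> \<open>The other half, read on the arrows that factor through \<open>m\<close>.\<close>
  then have key: "lies_in C (m \<cdot> k) U"
    if "k \<in> Arr C" "Cod C k = y" "lies_in C (m \<cdot> k) (S \<squnion>\<^bsub>Sub C x\<^esub> T)" for k
    using that S T U by (simp add: le_Sub_iff pull_in_Sub[OF mh] lies_in_pull[OF mh])
  have "lies_in C g U" if g: "lies_in C g A" "lies_in C g (S \<squnion>\<^bsub>Sub C x\<^esub> T)" for g
  proof -
    have "factors_through C g m" using g m by (simp add: lies_in_subobject)
    then obtain k where "k \<in> Arr C" "Cod C k = Dom C m" "g = m \<cdot> k" by (elim factors_throughE)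
    then show ?thesis using key g by (simp add: y_def)
  qed
  then show "A \<sqinter>\<^bsub>Sub C x\<^esub> (S \<squnion>\<^bsub>Sub C x\<^esub> T) \<sqsubseteq>\<^bsub>Sub C x\<^esub> (A \<sqinter>\<^bsub>Sub C x\<^esub> S) \<squnion>\<^bsub>Sub C x\<^esub> (A \<sqinter>\<^bsub>Sub C x\<^esub> T)"
    using A S T U by (simp add: le_Sub_iff lies_in_meet[OF x] flip: U_def)
qed

text \<open>
  Meets and the top element are preserved because they are determined by their sieves; joins and
  the bottom element are unions, which are stable under pullback in a coherent category.
\<close>

lemma pull_in_hom:
  assumes f: "f \<in> hom C y x"
  shows "Arrow (Sub C x) (Sub C y) (\<lambda>S\<in>carrier (Sub C x). pull C f S) \<in> hom DLat (Sub C x) (Sub C y)"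
proof -
  note o = hom_Obj[OF f] and p = pull_sieve[OF f]
  interpret X: bounded_lattice "Sub C x" by (rule bounded_lattice_Sub[OF o(2)])
  interpret Y: bounded_lattice "Sub C y" by (rule bounded_lattice_Sub[OF o(1)])
  have lat: "lattice (Sub C x)" "lattice (Sub C y)" by unfold_locales
  have fg: "f \<cdot> g \<in> Arr C" "Cod C (f \<cdot> g) = x" if "g \<in> Arr C" "Cod C g = y" for g
    using that f by (simp_all add: Comp_Arr hom_def)
  have "pull C f (S \<sqinter>\<^bsub>Sub C x\<^esub> T) = pull C f S \<sqinter>\<^bsub>Sub C y\<^esub> pull C f T"
    if "S \<in> carrier (Sub C x)" "T \<in> carrier (Sub C x)" for S T
    using that by (intro Sub_eqI[of _ y]) (simp_all add: p lies_in_meet o)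
  moreover have "pull C f \<top>\<^bsub>Sub C x\<^esub> = \<top>\<^bsub>Sub C y\<^esub>"
    by (rule Sub_eqI[of _ y])
      (simp_all add: p top_Sub o total_in_Sub lies_in_total fg)
  moreover have "is_union C y {} (pull C f \<bottom>\<^bsub>Sub C x\<^esub>)"
    using unions_stable[OF f, of "{}"] is_union_bottom[OF o(2)] by simp
  ultimately show ?thesis
    using p(1) pull_join[OF f] is_union_bottom[OF o(1)]
    by (auto simp: hom_DLat distributive_lattice_Sub o bounded_lattice_hom_def meet_pres_def
        join_pres_def lat)
qed

lemma Sub_functor_simps [simp]:
  "x \<in> Obj C \<Longrightarrow> FObj (Sub_functor C) x = Sub C x"
  "f \<in> Arr C \<Longrightarrow> FArr (Sub_functor C) f = Arrow (Sub C (Cod C f)) (Sub C (Dom C f))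
                (\<lambda>S\<in>carrier (Sub C (Cod C f)). pull C f S)"
  by (simp_all add: Sub_functor_def)

lemma is_functor_Sub: "is_functor (op_cat C) DLat (Sub_functor C)"
proof (intro is_functor.intro op_category category_DLat is_functor_axioms.intro)
  show "FObj (Sub_functor C) \<in> extensional (Obj (op_cat C))"
    "FArr (Sub_functor C) \<in> extensional (Arr (op_cat C))"
    by (simp_all add: Sub_functor_def)
  show "FObj (Sub_functor C) x \<in> Obj DLat" if "x \<in> Obj (op_cat C)" for x
    using that by (simp add: distributive_lattice_Sub)
next
  fix f x y assume "f \<in> hom (op_cat C) x y"
  then have f: "f \<in> hom C y x" by simp
  from pull_in_hom[OF f] show "FArr (Sub_functor C) f \<in> hom DLat (FObj (Sub_functor C) x) (FObj (Sub_functor C) y)"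
    by (simp add: hom_Obj[OF f] homD[OF f])
next
  fix x assume "x \<in> Obj (op_cat C)"
  then show "FArr (Sub_functor C) (Ident (op_cat C) x) = Ident DLat (FObj (Sub_functor C) x)"
    using Ident_in[of x] by (auto simp: hom_def pull_Ident intro!: ext)
next
  fix f x y g z assume "f \<in> hom (op_cat C) x y" "g \<in> hom (op_cat C) y z"
  then have f: "f \<in> hom C y x" and g: "g \<in> hom C z y" by simp_all
  note fg = Comp_in[OF g f]
  show "FArr (Sub_functor C) (g \<cdot>\<^bsub>op_cat C\<^esub> f) = FArr (Sub_functor C) g \<cdot>\<^bsub>DLat\<^esub> FArr (Sub_functor C) f"
    using pull_comp[OF g f] pull_in_Sub[OF f]
    by (simp add: homD[OF f] homD[OF g] homD[OF fg]) (auto simp: compose_def intro!: ext)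
qed

text \<open>
  The image of a subobject consists of whole equivalence classes, so the identity functor gives back
  the subobject itself and the map on subobjects that it induces is the identity.
\<close>

lemma sub_image_id:
  assumes S: "S \<in> carrier (Sub C x)"
  shows "sub_image C (id_functor C) S = S"
proof -
  have "subobject C (FArr (id_functor C) m) = S" if "m \<in> S" for m
    using Sub_member[OF S that] is_monoD by simp
  then show ?thesis using Sub_nonempty[OF S] by (auto simp: sub_image_def)
qed

lemma coherent_functor_id: "coherent_functor C C (id_functor C)"
proof (intro coherent_functor.intro is_functor_id coherent_functor_axioms.intro)
  show "is_terminal C (FObj (id_functor C) t)" if "is_terminal C t" for t
    using that by (simp add: is_terminal_def)
  show "is_pullback C (FArr (id_functor C) f) (FArr (id_functor C) g) (FArr (id_functor C) p)
      (FArr (id_functor C) q)" if "is_pullback C f g p q" for f g p q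
    using that pullbackD(1-4)[OF that] by simp
  show "is_cover C (FArr (id_functor C) e)" if "is_cover C e" for e
    using that by (simp add: is_cover_def)
  fix x \<A> S assume *: "x \<in> Obj C" "finite \<A>" "\<A> \<subseteq> carrier (Sub C x)" "is_union C x \<A> S"
  then have S: "S \<in> carrier (Sub C x)" by (simp add: is_union_iff)
  have "sub_image C (id_functor C) ` \<A> = id ` \<A>"
    using *(3) sub_image_id by (intro image_cong) auto
  with * show "is_union C (FObj (id_functor C) x) (sub_image C (id_functor C) ` \<A>)
      (sub_image C (id_functor C) S)"
    by (simp add: sub_image_id[OF S])
qed

end

section \<open>Set-valued functors\<close>

lemma SetCat_comp_apply:
  "f \<in> hom SetCat A B \<Longrightarrow> a \<in> A \<Longrightarrow> fn (g \<cdot>\<^bsub>SetCat\<^esub> f) a = fn g (fn f a)"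
  by (auto simp: hom_SetCat compose_def)

lemma hom_SetCat_eqI:
  assumes "f \<in> hom SetCat A B" "g \<in> hom SetCat A B" "\<And>a. a \<in> A \<Longrightarrow> fn f a = fn g a"
  shows "f = g"
proof -
  have "fn f = fn g"
    using assms by (intro extensionalityI[of _ A]) (auto simp: hom_SetCat PiE_def)
  with assms(1,2) show ?thesis by (simp add: hom_SetCat arrow.expand)
qed

context
  fixes C :: "('o, 'u) cat" and M :: "('o, 'u) set_functor"
  assumes M: "is_functor C SetCat M"
begin

interpretation M: is_functor C SetCat M by (rule M)

lemma set_functor_closed:
  "f \<in> hom C x y \<Longrightarrow> a \<in> FObj M x \<Longrightarrow> fn (FArr M f) a \<in> FObj M y"
  using M.FArr_in by (fastforce simp: hom_SetCat)

lemma set_functor_Ident: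
  "x \<in> Obj C \<Longrightarrow> a \<in> FObj M x \<Longrightarrow> fn (FArr M (Ident C x)) a = a"
  by (simp add: M.FArr_Ident)

lemma set_functor_Comp:
  assumes "f \<in> hom C x y" "g \<in> hom C y z" "a \<in> FObj M x"
  shows "fn (FArr M (g \<cdot>\<^bsub>C\<^esub> f)) a = fn (FArr M g) (fn (FArr M f) a)"
  unfolding M.FArr_Comp[OF assms(1,2)] by (rule SetCat_comp_apply[OF M.FArr_in[OF assms(1)] assms(3)])

end

lemma set_nat_trans:
  assumes "t \<in> hom (Set_functors C) M N"
  shows "\<And>x a. x \<in> Obj C \<Longrightarrow> a \<in> FObj M x \<Longrightarrow> fn (fn t x) a \<in> FObj N x"
    and "\<And>f x y a. f \<in> hom C x y \<Longrightarrow> a \<in> FObj M x \<Longrightarrow>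
      fn (fn t y) (fn (FArr M f) a) = fn (FArr N f) (fn (fn t x) a)"
proof -
  interpret nat_trans C SetCat M N "fn t" using assms by (simp add: hom_functor_category)
  show "fn (fn t x) a \<in> FObj N x" if "x \<in> Obj C" "a \<in> FObj M x" for x a
    using component_in[OF that(1)] that(2) by (auto simp: hom_SetCat)
  show "fn (fn t y) (fn (FArr M f) a) = fn (FArr N f) (fn (fn t x) a)"
    if f: "f \<in> hom C x y" and a: "a \<in> FObj M x" for f x y a
    using naturality[OF f] SetCat_comp_apply[OF F.FArr_in[OF f] a]
      SetCat_comp_apply[OF component_in[OF F.source.hom_Obj(1)[OF f]] a] by metis
qed

lemma set_nat_trans_eqI:
  assumes t: "t \<in> hom (Set_functors C) M N" and s: "s \<in> hom (Set_functors C) M N"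
    and eq: "\<And>x a. x \<in> Obj C \<Longrightarrow> a \<in> FObj M x \<Longrightarrow> fn (fn t x) a = fn (fn s x) a"
  shows "t = s"
proof -
  interpret t: nat_trans C SetCat M N "fn t" using t by (simp add: hom_functor_category)
  interpret s: nat_trans C SetCat M N "fn s" using s by (simp add: hom_functor_category)
  have "fn t = fn s"
  proof (rule extensionalityI[OF t.ext s.ext])
    fix x assume x: "x \<in> Obj C"
    show "fn t x = fn s x"
      by (rule hom_SetCat_eqI[OF t.component_in[OF x] s.component_in[OF x] eq[OF x]])
  qed
  with t s show ?thesis by (simp add: hom_functor_category arrow.expand)
qed

lemma set_nat_trans_comp_apply:
  assumes "s \<in> hom (Set_functors C) M N" "x \<in> Obj C" "a \<in> FObj M x"
  shows "fn (fn (t \<cdot>\<^bsub>Set_functors C\<^esub> s) x) a = fn (fn t x) (fn (fn s x) a)"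
proof -
  interpret nat_trans C SetCat M N "fn s" using assms(1) by (simp add: hom_functor_category)
  have "fn (t \<cdot>\<^bsub>Set_functors C\<^esub> s) x = fn t x \<cdot>\<^bsub>SetCat\<^esub> fn s x"
    using assms(2) by (simp only: functor_category_simps arrow.sel restrict_apply if_True)
  then show ?thesis using SetCat_comp_apply[OF component_in[OF assms(2)] assms(3)] by metis
qed

lemma set_nat_transI:
  assumes MN: "is_functor C SetCat M" "is_functor C SetCat N"
    and closed: "\<And>x a. x \<in> Obj C \<Longrightarrow> a \<in> FObj M x \<Longrightarrow> h x a \<in> FObj N x"
    and natural: "\<And>f x y a. f \<in> hom C x y \<Longrightarrow> a \<in> FObj M x \<Longrightarrow>
      h y (fn (FArr M f) a) = fn (FArr N f) (h x a)"
  shows "Arrow M N (\<lambda>x\<in>Obj C. Arrow (FObj M x) (FObj N x) (\<lambda>a\<in>FObj M x. h x a)) \<in> hom (Set_functors C) M N"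
proof -
  interpret M: is_functor C SetCat M by fact
  interpret N: is_functor C SetCat N by fact
  have "nat_trans C SetCat M N (\<lambda>x\<in>Obj C. Arrow (FObj M x) (FObj N x) (\<lambda>a\<in>FObj M x. h x a))"
  proof unfold_locales
    fix f x y assume f: "f \<in> hom C x y"
    note o = M.source.hom_Obj[OF f] and Mf = M.FArr_in[OF f] and Nf = N.FArr_in[OF f]
    let ?h = "\<lambda>x. Arrow (FObj M x) (FObj N x) (\<lambda>a\<in>FObj M x. h x a)"
    have h: "?h x \<in> hom SetCat (FObj M x) (FObj N x)" if "x \<in> Obj C" for x
      using closed that by (auto simp: hom_SetCat)
    have "?h y \<cdot>\<^bsub>SetCat\<^esub> FArr M f = FArr N f \<cdot>\<^bsub>SetCat\<^esub> ?h x"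
    proof (rule hom_SetCat_eqI[OF M.target.Comp_in[OF Mf h[OF o(2)]] M.target.Comp_in[OF h[OF o(1)] Nf]])
      fix a assume a: "a \<in> FObj M x"
      then show "fn (?h y \<cdot>\<^bsub>SetCat\<^esub> FArr M f) a = fn (FArr N f \<cdot>\<^bsub>SetCat\<^esub> ?h x) a"
        unfolding SetCat_comp_apply[OF Mf a] SetCat_comp_apply[OF h[OF o(1)] a]
        using natural[OF f a] set_functor_closed[OF MN(1) f a] by simp
    qed
    then show "(\<lambda>x\<in>Obj C. ?h x) y \<cdot>\<^bsub>SetCat\<^esub> FArr M f = FArr N f \<cdot>\<^bsub>SetCat\<^esub> (\<lambda>x\<in>Obj C. ?h x) x"
      by (simp only: restrict_apply o if_True)
  qed (use closed in \<open>auto simp: hom_SetCat\<close>)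
  then show ?thesis by (simp add: hom_functor_category)
qed

subsection \<open>The category of elements\<close>

lemma elements_simps [simp]:
  "Obj (elements C M) = {(x, a). x \<in> Obj C \<and> a \<in> FObj M x}"
  "Dom (elements C M) = src" "Cod (elements C M) = tgt"
  "Ident (elements C M) (x, a) = Arrow (x, a) (x, a) (Ident C x)"
  "g \<cdot>\<^bsub>elements C M\<^esub> f = Arrow (src f) (tgt g) (fn g \<cdot>\<^bsub>C\<^esub> fn f)"
  by (simp_all add: elements_def)

lemma Arr_elements:
  "Arrow (x, a) (y, b) f \<in> Arr (elements C M) \<longleftrightarrow>
     f \<in> hom C x y \<and> a \<in> FObj M x \<and> b \<in> FObj M y \<and> fn (FArr M f) a = b"
  by (auto simp: elements_def)

lemma hom_elements:
  "t \<in> hom (elements C M) (x, a) (y, b) \<longleftrightarrow> (\<exists>f. t = Arrow (x, a) (y, b) f \<and>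
     f \<in> hom C x y \<and> a \<in> FObj M x \<and> b \<in> FObj M y \<and> fn (FArr M f) a = b)"
  by (cases t) (auto simp: hom_def[of "elements C M"] Arr_elements)

lemma category_elements:
  assumes M: "is_functor C SetCat M"
  shows "category (elements C M)"
proof -
  interpret M: is_functor C SetCat M by fact
  show ?thesis
  proof (unfold_locales, goal_cases)
    case (1 f)
    then show ?case using M.source.hom_Obj by (fastforce simp: elements_def)
  next
    case (2 f)
    then show ?case using M.source.hom_Obj by (fastforce simp: elements_def)
  next
    case (3 x)
    then show ?case
      using M.source.Ident_in set_functor_Ident[OF M] by (cases x) (auto simp: hom_elements)
  next
    case (4 f x y g z)
    then show ?case
      by (cases x; cases y; cases z)
        (auto simp: hom_elements intro: M.source.Comp_in dest: set_functor_Comp[OF M])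
  next
    case (5 f x y)
    then show ?case by (cases x; cases y) (auto simp: hom_elements M.source.Ident_left)
  next
    case (6 f x y)
    then show ?case by (cases x; cases y) (auto simp: hom_elements M.source.Ident_right)
  next
    case (7 f w x g y h z)
    then show ?case
      by (cases w; cases x; cases y; cases z) (auto simp: hom_elements M.source.Comp_assoc)
  qed
qed

lemma is_functor_elements_proj:
  assumes M: "is_functor C SetCat M"
  shows "is_functor (elements C M) C (elements_proj C M)"
proof -
  interpret M: is_functor C SetCat M by fact
  interpret E: category "elements C M" by (rule category_elements[OF M])
  have A: "FArr (elements_proj C M) t = fn t" if "t \<in> hom (elements C M) p q" for t p q
    using homD(1)[OF that] by (simp add: elements_proj_def)
  show ?thesis
  proof (unfold_locales, goal_cases)
    case (4 f x y)
    then show ?case using A[OF 4] E.hom_Obj[OF 4]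
      by (cases x; cases y) (auto simp: hom_elements elements_proj_def)
  next
    case (5 x)
    then show ?case using A[OF E.Ident_in[OF 5]] by (cases x) (auto simp: elements_proj_def)
  next
    case (6 f x y g z)
    then show ?case using A[OF 6(1)] A[OF 6(2)] A[OF E.Comp_in[OF 6]] by simp
  qed (auto simp: elements_proj_def)
qed

section \<open>The Yoneda embedding\<close>

lemma representable_simps [simp]:
  "y \<in> Obj C \<Longrightarrow> FObj (representable C x) y = hom C x y"
  "g \<in> hom C y z \<Longrightarrow> FArr (representable C x) g = Arrow (hom C x y) (hom C x z) (\<lambda>h\<in>hom C x y. g \<cdot>\<^bsub>C\<^esub> h)"
  by (auto simp: representable_def hom_def[of C y z])

locale small_category = category C for C :: "('o, 'u) cat" (structure)
begin

abbreviation SF where "SF \<equiv> Set_functors C"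

lemma category_SF: "category SF"
  by (rule category_functor_category[OF category_axioms category_SetCat])

sublocale SF: category SF by (rule category_SF)

lemma Obj_SF: "M \<in> Obj SF \<longleftrightarrow> is_functor C SetCat M"
  by simp

lemma SF_functors:
  assumes "t \<in> hom SF M N"
  shows "is_functor C SetCat M" "is_functor C SetCat N"
  using SF.hom_Obj[OF assms] by simp_all

lemma is_functor_representable:
  assumes x: "x \<in> Obj C"
  shows "is_functor C SetCat (representable C x)"
proof (intro is_functor.intro category_axioms category_SetCat is_functor_axioms.intro)
  show "FObj (representable C x) \<in> extensional (Obj C)" "FArr (representable C x) \<in> extensional (Arr C)"
    by (simp_all add: representable_def)
  show "FObj (representable C x) y \<in> Obj SetCat" for y by simp
next
  fix f y z assume f: "f \<in> hom C y z"
  show "FArr (representable C x) f \<in> hom SetCat (FObj (representable C x) y) (FObj (representable C x) z)"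
    using Comp_in[OF _ f] by (simp add: representable_simps(2)[OF f] hom_Obj[OF f]) (auto simp: hom_SetCat)
next
  fix y assume y: "y \<in> Obj C"
  show "FArr (representable C x) (Ident C y) = Ident SetCat (FObj (representable C x) y)"
    by (simp add: representable_simps(2)[OF Ident_in[OF y]] y Ident_left cong: restrict_cong)
next
  fix f y z g w assume f: "f \<in> hom C y z" and g: "g \<in> hom C z w"
  show "FArr (representable C x) (g \<cdot> f) = FArr (representable C x) g \<cdot>\<^bsub>SetCat\<^esub> FArr (representable C x) f"
    using Comp_in[OF _ f] Comp_assoc[OF _ f g]
    by (simp add: representable_simps(2)[OF f] representable_simps(2)[OF g]
        representable_simps(2)[OF Comp_in[OF f g]]) (auto simp: compose_def intro!: ext)
qed

text \<open>
  The transformation \<open>C(x, -) \<Rightarrow> M\<close> that corresponds to an element of \<open>M x\<close> by the Yoneda lemma.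
  Naturality of this correspondence in \<open>M\<close> and in \<open>x\<close> is \<open>classify_comp\<close> and \<open>classify_yoneda\<close>.
\<close>

definition classify :: "('o, 'u) set_functor \<Rightarrow> 'o \<Rightarrow> 'u \<Rightarrow>
    (('o, 'u) set_functor, 'o \<Rightarrow> ('u set, 'u \<Rightarrow> 'u) arrow) arrow" where
  "classify M x a = Arrow (representable C x) M (\<lambda>z\<in>Obj C.
     Arrow (FObj (representable C x) z) (FObj M z) (\<lambda>h\<in>FObj (representable C x) z. fn (FArr M h) a))"

lemma classify_in_hom:
  assumes M: "is_functor C SetCat M" and x: "x \<in> Obj C" and a: "a \<in> FObj M x"
  shows "classify M x a \<in> hom SF (representable C x) M"
  unfolding classify_def
proof (rule set_nat_transI[OF is_functor_representable[OF x] M])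
  show "fn (FArr M h) a \<in> FObj M z" if "z \<in> Obj C" "h \<in> FObj (representable C x) z" for z h
    using that set_functor_closed[OF M _ a] by simp
  show "fn (FArr M (fn (FArr (representable C x) f) h)) a = fn (FArr M f) (fn (FArr M h) a)"
    if f: "f \<in> hom C y z" and h: "h \<in> FObj (representable C x) y" for f y z h
    using h set_functor_Comp[OF M _ f a] by (simp add: representable_simps(2)[OF f] hom_Obj[OF f])
qed

lemma classify_apply:
  "z \<in> Obj C \<Longrightarrow> h \<in> hom C x z \<Longrightarrow> fn (fn (classify M x a) z) h = fn (FArr M h) a"
  by (simp add: classify_def)

lemma classify_comp:
  assumes t: "t \<in> hom SF M N" and x: "x \<in> Obj C" and a: "a \<in> FObj M x"
  shows "t \<cdot>\<^bsub>SF\<^esub> classify M x a = classify N x (fn (fn t x) a)"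
proof -
  note MN = SF_functors[OF t] and c = classify_in_hom[OF SF_functors(1)[OF t] x a]
  have ta: "fn (fn t x) a \<in> FObj N x" by (rule set_nat_trans(1)[OF t x a])
  show ?thesis
  proof (rule set_nat_trans_eqI[OF SF.Comp_in[OF c t] classify_in_hom[OF MN(2) x ta]])
    fix z h assume z: "z \<in> Obj C" and h: "h \<in> FObj (representable C x) z"
    then have h': "h \<in> hom C x z" by simp
    show "fn (fn (t \<cdot>\<^bsub>SF\<^esub> classify M x a) z) h = fn (fn (classify N x (fn (fn t x) a)) z) h"
      unfolding set_nat_trans_comp_apply[OF c z h] classify_apply[OF z h']
      by (rule set_nat_trans(2)[OF t h' a])
  qed
qed

lemma classify_Ident:
  assumes x: "x \<in> Obj C"
  shows "classify (representable C x) x (Ident C x) = Ident SF (representable C x)"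
proof (rule set_nat_trans_eqI)
  note R = is_functor_representable[OF x]
  show "classify (representable C x) x (Ident C x) \<in> hom SF (representable C x) (representable C x)"
    using x Ident_in by (intro classify_in_hom[OF R x]) simp
  show "Ident SF (representable C x) \<in> hom SF (representable C x) (representable C x)"
    by (rule SF.Ident_in) (simp add: R)
  fix z h assume z: "z \<in> Obj C" and h: "h \<in> FObj (representable C x) z"
  then have h': "h \<in> hom C x z" by simp
  show "fn (fn (classify (representable C x) x (Ident C x)) z) h = fn (fn (Ident SF (representable C x)) z) h"
    unfolding classify_apply[OF z h']
    using z h' x by (simp add: representable_simps(2)[OF h'] Ident_in Ident_right[OF h'])
qed

lemma yoneda_arrow:
  assumes f: "f \<in> hom C x y"
  shows "FArr (yoneda C) f = classify (representable C x) y f"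
proof -
  have "(\<lambda>h\<in>hom C y z. h \<cdot> f) = (\<lambda>h\<in>hom C y z. fn (FArr (representable C x) h) f)" for z
    by (rule restrict_ext) (use f in \<open>simp add: representable_simps(2)\<close>)
  then show ?thesis
    using hom_Obj[OF f] homD[OF f] by (simp add: yoneda_def classify_def cong: restrict_cong)
qed

lemma yoneda_obj: "x \<in> Obj C \<Longrightarrow> FObj (yoneda C) x = representable C x"
  by (simp add: yoneda_def)

lemma yoneda_arrow_in_hom:
  assumes f: "f \<in> hom C x y"
  shows "FArr (yoneda C) f \<in> hom SF (representable C y) (representable C x)"
  unfolding yoneda_arrow[OF f] using f hom_Obj[OF f]
  by (intro classify_in_hom is_functor_representable) simp_all

lemma classify_yoneda:
  assumes M: "is_functor C SetCat M" and f: "f \<in> hom C x y" and a: "a \<in> FObj M x"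
  shows "classify M x a \<cdot>\<^bsub>SF\<^esub> FArr (yoneda C) f = classify M y (fn (FArr M f) a)"
proof -
  note o = hom_Obj[OF f]
  have "classify M x a \<cdot>\<^bsub>SF\<^esub> classify (representable C x) y f
      = classify M y (fn (fn (classify M x a) y) f)"
    using f o by (intro classify_comp[OF classify_in_hom[OF M o(1) a]]) simp_all
  then show ?thesis by (simp only: yoneda_arrow[OF f] classify_apply[OF o(2) f])
qed

lemma is_functor_yoneda: "is_functor (op_cat C) SF (yoneda C)"
proof (intro is_functor.intro op_category category_SF is_functor_axioms.intro)
  show "FObj (yoneda C) \<in> extensional (Obj (op_cat C))" "FArr (yoneda C) \<in> extensional (Arr (op_cat C))"
    by (simp_all add: yoneda_def)
  show "FObj (yoneda C) x \<in> Obj SF" if "x \<in> Obj (op_cat C)" for x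
    using that is_functor_representable[of x] by (simp add: yoneda_obj)
  show "FArr (yoneda C) f \<in> hom SF (FObj (yoneda C) x) (FObj (yoneda C) y)"
    if "f \<in> hom (op_cat C) x y" for f x y
    using that yoneda_arrow_in_hom[of f y x] hom_Obj[of f y x] by (simp only: hom_op_cat yoneda_obj)
  show "FArr (yoneda C) (Ident (op_cat C) x) = Ident SF (FObj (yoneda C) x)" if "x \<in> Obj (op_cat C)" for x
    using that yoneda_arrow[OF Ident_in[of x]] classify_Ident[of x] by (simp only: op_cat_simps yoneda_obj)
next
  fix f x y g z assume "f \<in> hom (op_cat C) x y" "g \<in> hom (op_cat C) y z"
  then have f: "f \<in> hom C y x" and g: "g \<in> hom C z y" by simp_all
  note o = hom_Obj[OF f] hom_Obj[OF g]
  have "FArr (yoneda C) g \<cdot>\<^bsub>SF\<^esub> FArr (yoneda C) f = classify (representable C z) y g \<cdot>\<^bsub>SF\<^esub> FArr (yoneda C) f"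
    by (simp only: yoneda_arrow[OF g])
  also have "\<dots> = classify (representable C z) x (fn (FArr (representable C z) f) g)"
    using g o by (intro classify_yoneda[OF is_functor_representable f]) simp_all
  also have "\<dots> = FArr (yoneda C) (f \<cdot> g)"
    using yoneda_arrow[OF Comp_in[OF g f]] g by (simp add: representable_simps(2)[OF f])
  finally show "FArr (yoneda C) (g \<cdot>\<^bsub>op_cat C\<^esub> f) = FArr (yoneda C) g \<cdot>\<^bsub>SF\<^esub> FArr (yoneda C) f"
    by (simp only: op_cat_simps)
qed

end

section \<open>The lattice of a set-valued functor\<close>

type_synonym ('o, 'u) lattice_functor =
  "(('o, 'u) set_functor, (('o, 'u) set_functor, 'o \<Rightarrow> ('u set, 'u \<Rightarrow> 'u) arrow) arrow,
    'u set gorder, ('u set gorder, 'u set \<Rightarrow> 'u set) arrow) func"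

locale small_coherent_category = coherent_category C
  for C :: "('o, 'u) cat" (structure) +
  assumes infinite_universe: "infinite (UNIV :: 'u set)"
begin

sublocale small_category C ..

lemma Sub_diagram_simps:
  assumes "x \<in> Obj C" "a \<in> FObj M x"
  shows "FObj (Sub_diagram C M) (x, a) = Sub C x"
  using assms by (simp add: Sub_diagram_def elements_proj_def)

lemma Sub_diagram_arrow:
  assumes "Arrow (x, a) (y, b) f \<in> Arr (elements C M)"
  shows "FArr (Sub_diagram C M) (Arrow (x, a) (y, b) f) = FArr (Sub_functor C) f"
  using assms by (simp add: Sub_diagram_def elements_proj_def)

lemma is_functor_Sub_diagram:
  assumes M: "is_functor C SetCat M"
  shows "is_functor (op_cat (elements C M)) DLat (Sub_diagram C M)"
proof -
  interpret P: is_functor "elements C M" C "elements_proj C M" by (rule is_functor_elements_proj[OF M])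
  show ?thesis unfolding Sub_diagram_def by (rule is_functor_comp[OF P.op_functor is_functor_Sub])
qed

text \<open>
  A subobject is determined by any of its representatives, and a representative determines the
  object \<open>x\<close> as its codomain. Hence an element \<open>S\<close> of the copy of \<open>Sub C x\<close> at \<open>(x, a)\<close> is
  determined by the pair of \<open>a\<close> and a chosen member of \<open>S\<close>, and pairs of elements of \<open>'u\<close> can be
  coded by elements of \<open>'u\<close>.
\<close>

lemma Sub_diagram_small:
  fixes M :: "('o, 'u) set_functor"
  shows "\<exists>e :: ('o \<times> 'u) \<times> 'u set \<Rightarrow> 'u.
    inj_on e (Sigma (Obj (op_cat (elements C M))) (\<lambda>j. carrier (FObj (Sub_diagram C M) j)))"
proof -
  obtain p :: "'u \<times> 'u \<Rightarrow> 'u" where p: "inj p" using ex_inj_pair[OF infinite_universe] by blast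
  define e where "e = (\<lambda>((x :: 'o, a), S). p (a, SOME m. m \<in> S))"
  have inj: "x = y \<and> a = b \<and> S = T"
    if *: "x \<in> Obj C" "a \<in> FObj M x" "S \<in> carrier (Sub C x)" "y \<in> Obj C" "b \<in> FObj M y"
      "T \<in> carrier (Sub C y)" "e ((x, a), S) = e ((y, b), T)" for x a S y b T
  proof -
    from *(7) p have ab: "a = b" and m: "(SOME m. m \<in> S) = (SOME m. m \<in> T)"
      by (auto simp: e_def inj_eq)
    have "(SOME m. m \<in> S) \<in> S" "(SOME m. m \<in> T) \<in> T"
      using Sub_nonempty[OF *(3)] Sub_nonempty[OF *(6)] by (auto intro: someI_ex)
    with m Sub_member[OF *(3)] Sub_member[OF *(6)] ab show ?thesis by metis
  qed
  have "inj_on e (Sigma (Obj (op_cat (elements C M))) (\<lambda>j. carrier (FObj (Sub_diagram C M) j)))"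
  proof (rule inj_onI)
    fix p q
    assume *: "p \<in> Sigma (Obj (op_cat (elements C M))) (\<lambda>j. carrier (FObj (Sub_diagram C M) j))"
      "q \<in> Sigma (Obj (op_cat (elements C M))) (\<lambda>j. carrier (FObj (Sub_diagram C M) j))" "e p = e q"
    obtain x a S y b T where "p = ((x, a), S)" "q = ((y, b), T)" by (metis prod.exhaust)
    with * show "p = q" using inj[of x a S y b T] by (auto simp: Sub_diagram_simps)
  qed
  then show ?thesis by (rule exI[of _ e])
qed

lemma L_colimit:
  assumes M: "is_functor C SetCat M"
  shows "is_colimit (op_cat (elements C M)) DLat (Sub_diagram C M) (L_obj (C, M)) (L_in (C, M))"
proof -
  obtain e :: "('o \<times> 'u) \<times> 'u set \<Rightarrow> 'u" where
    "inj_on e (Sigma (Obj (op_cat (elements C M))) (\<lambda>j. carrier (FObj (Sub_diagram C M) j)))"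
    using Sub_diagram_small by blast
  from DLat_small_colimits[OF infinite_universe is_functor_Sub_diagram[OF M] this]
  show ?thesis by (simp add: L_obj_def L_in_def)
qed

text \<open>
  An arrow \<open>f : x \<rightarrow> y\<close> of \<open>C\<close> with an element \<open>a\<close> of \<open>M x\<close> gives an arrow from \<open>(x, a)\<close> to
  \<open>(y, (M f) a)\<close>, which the opposite category reverses; so the leg at \<open>x\<close> composed with \<open>f\<^sup>*\<close> is the
  leg at \<open>y\<close>.
\<close>

lemma is_cocone_Sub_diagram_iff:
  "is_cocone (op_cat (elements C M)) DLat (Sub_diagram C M) Y \<kappa> \<longleftrightarrow>
    distributive_lattice Y \<and> (\<forall>x \<in> Obj C. \<forall>a \<in> FObj M x. \<kappa> (x, a) \<in> hom DLat (Sub C x) Y) \<and>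
    (\<forall>x y. \<forall>f \<in> hom C x y. \<forall>a \<in> FObj M x. fn (FArr M f) a \<in> FObj M y \<longrightarrow>
       \<kappa> (x, a) \<cdot>\<^bsub>DLat\<^esub> FArr (Sub_functor C) f = \<kappa> (y, fn (FArr M f) a))"
proof -
  have "(\<forall>t \<in> Arr (elements C M). \<kappa> (src t) \<cdot>\<^bsub>DLat\<^esub> FArr (Sub_diagram C M) t = \<kappa> (tgt t)) \<longleftrightarrow>
    (\<forall>x y. \<forall>f \<in> hom C x y. \<forall>a \<in> FObj M x. fn (FArr M f) a \<in> FObj M y \<longrightarrow>
       \<kappa> (x, a) \<cdot>\<^bsub>DLat\<^esub> FArr (Sub_functor C) f = \<kappa> (y, fn (FArr M f) a))" (is "?l \<longleftrightarrow> ?r")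
  proof
    assume l: ?l
    show ?r
    proof (intro allI ballI impI)
      fix x y f a assume "f \<in> hom C x y" "a \<in> FObj M x" "fn (FArr M f) a \<in> FObj M y"
      then have t: "Arrow (x, a) (y, fn (FArr M f) a) f \<in> Arr (elements C M)" by (simp add: Arr_elements)
      from l[rule_format, OF t] show "\<kappa> (x, a) \<cdot>\<^bsub>DLat\<^esub> FArr (Sub_functor C) f = \<kappa> (y, fn (FArr M f) a)"
        unfolding Sub_diagram_arrow[OF t] by (simp only: arrow.sel)
    qed
  next
    assume r: ?r
    show ?l
    proof
      fix t assume t: "t \<in> Arr (elements C M)"
      obtain x a y b f where t': "t = Arrow (x, a) (y, b) f" by (metis arrow.exhaust prod.exhaust)
      with t have "f \<in> hom C x y" "a \<in> FObj M x" "b \<in> FObj M y" "fn (FArr M f) a = b"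
        by (simp_all add: Arr_elements)
      with r show "\<kappa> (src t) \<cdot>\<^bsub>DLat\<^esub> FArr (Sub_diagram C M) t = \<kappa> (tgt t)"
        using Sub_diagram_arrow[OF t[unfolded t']] unfolding t' by (metis arrow.sel(1,2))
    qed
  qed
  then show ?thesis
    unfolding is_cocone_def by (auto simp del: DLat_simps simp: DLat_simps(1) Sub_diagram_simps)
qed

context
  fixes M :: "('o, 'u) set_functor"
  assumes M: "is_functor C SetCat M"
begin

lemma L_cocone:
  shows L_obj: "distributive_lattice (L_obj (C, M))"
    and L_in_hom: "x \<in> Obj C \<Longrightarrow> a \<in> FObj M x \<Longrightarrow> L_in (C, M) (x, a) \<in> hom DLat (Sub C x) (L_obj (C, M))"
    and L_in_natural: "f \<in> hom C x y \<Longrightarrow> a \<in> FObj M x \<Longrightarrow>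
      L_in (C, M) (x, a) \<cdot>\<^bsub>DLat\<^esub> FArr (Sub_functor C) f = L_in (C, M) (y, fn (FArr M f) a)"
proof -
  have "is_cocone (op_cat (elements C M)) DLat (Sub_diagram C M) (L_obj (C, M)) (L_in (C, M))"
    using L_colimit[OF M] by (simp add: is_colimit_def)
  note c = this[unfolded is_cocone_Sub_diagram_iff]
  show "distributive_lattice (L_obj (C, M))" using c by blast
  show "L_in (C, M) (x, a) \<in> hom DLat (Sub C x) (L_obj (C, M))" if "x \<in> Obj C" "a \<in> FObj M x"
    using c that by blast
  show "L_in (C, M) (x, a) \<cdot>\<^bsub>DLat\<^esub> FArr (Sub_functor C) f = L_in (C, M) (y, fn (FArr M f) a)"
    if "f \<in> hom C x y" "a \<in> FObj M x"
    using c that set_functor_closed[OF M that] by blast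
qed

lemma L_universal:
  assumes "distributive_lattice Y"
    and "\<And>x a. x \<in> Obj C \<Longrightarrow> a \<in> FObj M x \<Longrightarrow> \<kappa> (x, a) \<in> hom DLat (Sub C x) Y"
    and "\<And>f x y a. f \<in> hom C x y \<Longrightarrow> a \<in> FObj M x \<Longrightarrow>
      \<kappa> (x, a) \<cdot>\<^bsub>DLat\<^esub> FArr (Sub_functor C) f = \<kappa> (y, fn (FArr M f) a)"
  shows "\<exists>!h. h \<in> hom DLat (L_obj (C, M)) Y \<and>
    (\<forall>(x, a) \<in> Obj (elements C M). h \<cdot>\<^bsub>DLat\<^esub> L_in (C, M) (x, a) = \<kappa> (x, a))"
proof -
  have "is_cocone (op_cat (elements C M)) DLat (Sub_diagram C M) Y \<kappa>"
    unfolding is_cocone_Sub_diagram_iff using assms by blast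
  with L_colimit[OF M] have "\<exists>!h. h \<in> hom DLat (L_obj (C, M)) Y \<and>
    (\<forall>j \<in> Obj (op_cat (elements C M)). h \<cdot>\<^bsub>DLat\<^esub> L_in (C, M) j = \<kappa> j)"
    unfolding is_colimit_def by blast
  then show ?thesis by (simp only: op_cat_simps case_prod_unfold prod.collapse)
qed

lemma L_eqI:
  assumes g: "g \<in> hom DLat (L_obj (C, M)) Y" and h: "h \<in> hom DLat (L_obj (C, M)) Y"
    and eq: "\<And>x a. x \<in> Obj C \<Longrightarrow> a \<in> FObj M x \<Longrightarrow>
      g \<cdot>\<^bsub>DLat\<^esub> L_in (C, M) (x, a) = h \<cdot>\<^bsub>DLat\<^esub> L_in (C, M) (x, a)"
  shows "g = h"
proof -
  interpret D: category DLat by (rule category_DLat)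
  let ?\<kappa> = "\<lambda>j. h \<cdot>\<^bsub>DLat\<^esub> L_in (C, M) j"
  have "\<exists>!k. k \<in> hom DLat (L_obj (C, M)) Y \<and>
    (\<forall>(x, a) \<in> Obj (elements C M). k \<cdot>\<^bsub>DLat\<^esub> L_in (C, M) (x, a) = ?\<kappa> (x, a))"
  proof (rule L_universal)
    show "distributive_lattice Y" using h by (rule hom_DLatD)
    show "?\<kappa> (x, a) \<in> hom DLat (Sub C x) Y" if "x \<in> Obj C" "a \<in> FObj M x" for x a
      by (rule D.Comp_in[OF L_in_hom[OF that] h])
    fix f x y a assume f: "f \<in> hom C x y" and a: "a \<in> FObj M x"
    interpret S: is_functor "op_cat C" DLat "Sub_functor C" by (rule is_functor_Sub)
    have "FArr (Sub_functor C) f \<in> hom DLat (Sub C y) (Sub C x)"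
      using S.FArr_in[of f y x] f hom_Obj[OF f] by simp
    from D.Comp_assoc[OF this L_in_hom[OF hom_Obj(1)[OF f] a] h]
    show "?\<kappa> (x, a) \<cdot>\<^bsub>DLat\<^esub> FArr (Sub_functor C) f = ?\<kappa> (y, fn (FArr M f) a)"
      by (simp only: L_in_natural[OF f a])
  qed
  moreover have "\<forall>(x, a) \<in> Obj (elements C M). g \<cdot>\<^bsub>DLat\<^esub> L_in (C, M) (x, a) = ?\<kappa> (x, a)"
    using eq unfolding elements_simps by blast
  ultimately show "g = h" using g h by blast
qed

end

lemma Sub_map_id:
  assumes x: "x \<in> Obj C"
  shows "Sub_map C C (id_functor C) x = Ident DLat (Sub C x)"
  using x sub_image_id[of _ x] by (simp add: Sub_map_def cong: restrict_cong)

definition fibre_arrow :: "(('o, 'u) set_functor, 'o \<Rightarrow> ('u set, 'u \<Rightarrow> 'u) arrow) arrow \<Rightarrow> ('o, 'u) model_map"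
  where "fibre_arrow t = Arrow (C, src t) (C, tgt t) (id_functor C, fn t)"

text \<open>
  Over a fixed category the 1-cells have the identity as functor part, so the maps of subobject
  lattices in the description of \<open>L_arr\<close> disappear. The description is satisfied by exactly one map
  since the right-hand sides form a cocone by naturality of \<open>t\<close>.
\<close>

lemma L_arr_fibre:
  assumes t: "t \<in> hom SF M N"
  shows L_arr_in_hom: "L_arr (fibre_arrow t) \<in> hom DLat (L_obj (C, M)) (L_obj (C, N))"
    and L_arr_L_in: "\<And>x a. x \<in> Obj C \<Longrightarrow> a \<in> FObj M x \<Longrightarrow>
      L_arr (fibre_arrow t) \<cdot>\<^bsub>DLat\<^esub> L_in (C, M) (x, a) = L_in (C, N) (x, fn (fn t x) a)"
proof -
  interpret D: category DLat by (rule category_DLat)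
  note MN = SF_functors[OF t]
  have st: "src t = M" "tgt t = N" using t by (simp_all add: hom_functor_category)
  let ?P = "\<lambda>h. h \<in> hom DLat (L_obj (C, M)) (L_obj (C, N)) \<and>
    (\<forall>(x, a) \<in> Obj (elements C M). h \<cdot>\<^bsub>DLat\<^esub> L_in (C, M) (x, a) = L_in (C, N) (x, fn (fn t x) a))"
  have "\<exists>!h. h \<in> hom DLat (L_obj (C, M)) (L_obj (C, N)) \<and> (\<forall>(x, a) \<in> Obj (elements C M).
      h \<cdot>\<^bsub>DLat\<^esub> L_in (C, M) (x, a) = (\<lambda>(x, a). L_in (C, N) (x, fn (fn t x) a)) (x, a))"
  proof (rule L_universal[OF MN(1) L_obj[OF MN(2)]]; unfold prod.case)
    show "L_in (C, N) (x, fn (fn t x) a) \<in> hom DLat (Sub C x) (L_obj (C, N))"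
      if "x \<in> Obj C" "a \<in> FObj M x" for x a
      using that by (intro L_in_hom[OF MN(2)] set_nat_trans(1)[OF t])
    show "L_in (C, N) (x, fn (fn t x) a) \<cdot>\<^bsub>DLat\<^esub> FArr (Sub_functor C) f
        = L_in (C, N) (y, fn (fn t y) (fn (FArr M f) a))" if f: "f \<in> hom C x y" and a: "a \<in> FObj M x" for f x y a
      using L_in_natural[OF MN(2) f set_nat_trans(1)[OF t hom_Obj(1)[OF f] a]] set_nat_trans(2)[OF t f a]
      by (simp only:)
  qed
  then have unique: "\<exists>!h. ?P h" by (simp only: prod.case)
  have "L_arr (fibre_arrow t) = (THE h. h \<in> hom DLat (L_obj (C, M)) (L_obj (C, N)) \<and>
    (\<forall>(x, a) \<in> Obj (elements C M). h \<cdot>\<^bsub>DLat\<^esub> L_in (C, M) (x, a) =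
      L_in (C, N) (FObj (id_functor C) x, fn (fn t x) a) \<cdot>\<^bsub>DLat\<^esub> Sub_map C C (id_functor C) x))"
    by (simp only: fibre_arrow_def st L_arr.simps)
  also have "\<dots> = (THE h. ?P h)"
  proof (rule arg_cong[of _ _ The], rule ext, rule conj_cong[OF refl], rule ball_cong[OF refl])
    fix h p assume "p \<in> Obj (elements C M)"
    then obtain x a where p: "p = (x, a)" and x: "x \<in> Obj C" and a: "a \<in> FObj M x" by auto
    have "L_in (C, N) (x, fn (fn t x) a) \<cdot>\<^bsub>DLat\<^esub> Ident DLat (Sub C x) = L_in (C, N) (x, fn (fn t x) a)"
      by (rule D.Ident_right[OF L_in_hom[OF MN(2) x set_nat_trans(1)[OF t x a]]])
    then show "(case p of (x, a) \<Rightarrow> h \<cdot>\<^bsub>DLat\<^esub> L_in (C, M) (x, a) =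
        L_in (C, N) (FObj (id_functor C) x, fn (fn t x) a) \<cdot>\<^bsub>DLat\<^esub> Sub_map C C (id_functor C) x) =
      (case p of (x, a) \<Rightarrow> h \<cdot>\<^bsub>DLat\<^esub> L_in (C, M) (x, a) = L_in (C, N) (x, fn (fn t x) a))"
      by (simp only: p prod.case id_functor_simps(1)[OF x] Sub_map_id[OF x])
  qed
  finally have eq: "L_arr (fibre_arrow t) = (THE h. ?P h)" .
  have "?P (L_arr (fibre_arrow t))" unfolding eq by (rule theI'[OF unique])
  then show "L_arr (fibre_arrow t) \<in> hom DLat (L_obj (C, M)) (L_obj (C, N))"
    "\<And>x a. x \<in> Obj C \<Longrightarrow> a \<in> FObj M x \<Longrightarrow>
      L_arr (fibre_arrow t) \<cdot>\<^bsub>DLat\<^esub> L_in (C, M) (x, a) = L_in (C, N) (x, fn (fn t x) a)"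
    by (auto simp del: DLat_simps)
qed

section \<open>The left Kan extension\<close>

text \<open>
  The formulas for \<open>L\<close> on the fibre over \<open>C\<close>, read for all set-valued functors. The Kan extension
  lives on this larger category because the representables, on which its unit is defined, are in
  general not coherent.
\<close>

definition Lan :: "('o, 'u) lattice_functor" where
  "Lan = \<lparr>FObj = (\<lambda>M\<in>Obj SF. L_obj (C, M)), FArr = (\<lambda>t\<in>Arr SF. L_arr (fibre_arrow t))\<rparr>"

text \<open>
  The identity of \<open>x\<close> is the universal element of \<open>C(x, -)\<close>; the leg at it is the component of the
  unit.
\<close>

definition Lan_unit :: "'o \<Rightarrow> ('u set gorder, 'u set \<Rightarrow> 'u set) arrow" where
  "Lan_unit = (\<lambda>x\<in>Obj C. L_in (C, representable C x) (x, Ident C x))"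

lemma Lan_obj: "is_functor C SetCat M \<Longrightarrow> FObj Lan M = L_obj (C, M)"
  by (simp add: Lan_def)

lemma Lan_arr: "t \<in> hom SF M N \<Longrightarrow> FArr Lan t = L_arr (fibre_arrow t)"
  using homD(1)[of t SF M N] by (simp add: Lan_def)

lemma Lan_arr_in_hom: "t \<in> hom SF M N \<Longrightarrow> FArr Lan t \<in> hom DLat (L_obj (C, M)) (L_obj (C, N))"
  by (simp only: Lan_arr L_arr_in_hom)

lemma Lan_arr_L_in:
  "t \<in> hom SF M N \<Longrightarrow> x \<in> Obj C \<Longrightarrow> a \<in> FObj M x \<Longrightarrow>
     FArr Lan t \<cdot>\<^bsub>DLat\<^esub> L_in (C, M) (x, a) = L_in (C, N) (x, fn (fn t x) a)"
  by (simp only: Lan_arr L_arr_L_in)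

lemma is_functor_Lan: "is_functor SF DLat Lan"
proof (intro is_functor.intro category_SF category_DLat is_functor_axioms.intro)
  interpret D: category DLat by (rule category_DLat)
  show "FObj Lan \<in> extensional (Obj SF)" "FArr Lan \<in> extensional (Arr SF)" by (simp_all add: Lan_def)
  show "FObj Lan M \<in> Obj DLat" if "M \<in> Obj SF" for M
    using that L_obj[of M] by (simp add: Lan_obj)
  show "FArr Lan t \<in> hom DLat (FObj Lan M) (FObj Lan N)" if t: "t \<in> hom SF M N" for t M N
    using Lan_arr_in_hom[OF t] by (simp only: Lan_obj[OF SF_functors(1)[OF t]] Lan_obj[OF SF_functors(2)[OF t]])
  show "FArr Lan (Ident SF M) = Ident DLat (FObj Lan M)" if "M \<in> Obj SF" for M
  proof -
    from that have M: "is_functor C SetCat M" by simp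
    note I = SF.Ident_in[OF that] and D = D.Ident_in[of "L_obj (C, M)", simplified DLat_simps(1) mem_Collect_eq, OF L_obj[OF M]]
    have "FArr Lan (Ident SF M) = Ident DLat (L_obj (C, M))"
    proof (rule L_eqI[OF M Lan_arr_in_hom[OF I] D])
      fix x a assume x: "x \<in> Obj C" and a: "a \<in> FObj M x"
      have "fn (fn (Ident SF M) x) a = a" using x a by simp
      then show "FArr Lan (Ident SF M) \<cdot>\<^bsub>DLat\<^esub> L_in (C, M) (x, a) = Ident DLat (L_obj (C, M)) \<cdot>\<^bsub>DLat\<^esub> L_in (C, M) (x, a)"
        by (simp only: Lan_arr_L_in[OF I x a] D.Ident_left[OF L_in_hom[OF M x a]])
    qed
    then show ?thesis by (simp only: Lan_obj[OF M])
  qed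
  fix s M N t P assume s: "s \<in> hom SF M N" and t: "t \<in> hom SF N P"
  note M = SF_functors(1)[OF s] and ts = SF.Comp_in[OF s t]
  show "FArr Lan (t \<cdot>\<^bsub>SF\<^esub> s) = FArr Lan t \<cdot>\<^bsub>DLat\<^esub> FArr Lan s"
  proof (rule L_eqI[OF M Lan_arr_in_hom[OF ts] D.Comp_in[OF Lan_arr_in_hom[OF s] Lan_arr_in_hom[OF t]]])
    fix x a assume x: "x \<in> Obj C" and a: "a \<in> FObj M x"
    show "FArr Lan (t \<cdot>\<^bsub>SF\<^esub> s) \<cdot>\<^bsub>DLat\<^esub> L_in (C, M) (x, a)
        = FArr Lan t \<cdot>\<^bsub>DLat\<^esub> FArr Lan s \<cdot>\<^bsub>DLat\<^esub> L_in (C, M) (x, a)"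
      by (simp only: D.Comp_assoc[OF L_in_hom[OF M x a] Lan_arr_in_hom[OF s] Lan_arr_in_hom[OF t], symmetric]
        Lan_arr_L_in[OF s x a] Lan_arr_L_in[OF t x set_nat_trans(1)[OF s x a]]
        Lan_arr_L_in[OF ts x a] set_nat_trans_comp_apply[OF s x a])
  qed
qed

lemma Sub_arrow_in_hom: "f \<in> hom C x y \<Longrightarrow> FArr (Sub_functor C) f \<in> hom DLat (Sub C y) (Sub C x)"
  using is_functor.FArr_in[OF is_functor_Sub, of f y x] hom_Obj[of f x y] by simp

lemma Lan_unit_in_hom:
  assumes x: "x \<in> Obj C"
  shows "Lan_unit x \<in> hom DLat (Sub C x) (L_obj (C, representable C x))"
  using x Ident_in[OF x] L_in_hom[OF is_functor_representable[OF x] x, of "Ident C x"]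
  by (simp add: Lan_unit_def)

text \<open>
  Every leg comes from a leg at a universal element: \<open>a\<close> is the image of the identity of \<open>x\<close> under
  the transformation that classifies it. This is what reduces statements about \<open>Lan\<close> to statements
  about its unit.
\<close>

lemma Lan_classify_unit:
  assumes M: "is_functor C SetCat M" and x: "x \<in> Obj C" and a: "a \<in> FObj M x"
  shows "FArr Lan (classify M x a) \<cdot>\<^bsub>DLat\<^esub> Lan_unit x = L_in (C, M) (x, a)"
proof -
  note I = Ident_in[OF x]
  have I': "Ident C x \<in> FObj (representable C x) x" using I x by simp
  have "FArr Lan (classify M x a) \<cdot>\<^bsub>DLat\<^esub> Lan_unit x
      = L_in (C, M) (x, fn (fn (classify M x a) x) (Ident C x))"
    using Lan_arr_L_in[OF classify_in_hom[OF M x a] x I'] by (simp only: Lan_unit_def restrict_apply x if_True)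
  then show ?thesis by (simp only: classify_apply[OF x I] set_functor_Ident[OF M x a])
qed

lemma nat_trans_Lan_unit:
  "nat_trans (op_cat C) DLat (Sub_functor C) (comp_functor (op_cat C) Lan (yoneda C)) Lan_unit"
proof (intro nat_trans.intro is_functor_Sub nat_trans_axioms.intro
    is_functor_comp[OF is_functor_yoneda is_functor_Lan])
  show "Lan_unit \<in> extensional (Obj (op_cat C))" by (simp add: Lan_unit_def)
  show "Lan_unit x \<in> hom DLat (FObj (Sub_functor C) x) (FObj (comp_functor (op_cat C) Lan (yoneda C)) x)"
    if "x \<in> Obj (op_cat C)" for x
    using that Lan_unit_in_hom[of x] by (simp add: yoneda_obj Lan_obj is_functor_representable)
  fix f y x assume "f \<in> hom (op_cat C) y x"
  then have f: "f \<in> hom C x y" by simp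
  note o = hom_Obj[OF f] and R = is_functor_representable[OF hom_Obj(1)[OF f]]
  have I: "Ident C x \<in> FObj (representable C x) x" using Ident_in[OF o(1)] o by simp
  have "Lan_unit x \<cdot>\<^bsub>DLat\<^esub> FArr (Sub_functor C) f = L_in (C, representable C x) (y, fn (FArr (representable C x) f) (Ident C x))"
    using L_in_natural[OF R f I] by (simp only: Lan_unit_def restrict_apply o if_True)
  also have "fn (FArr (representable C x) f) (Ident C x) = f"
    using Ident_in[OF o(1)] Ident_right[OF f] by (simp add: representable_simps(2)[OF f])
  also have "L_in (C, representable C x) (y, f) = FArr Lan (FArr (yoneda C) f) \<cdot>\<^bsub>DLat\<^esub> Lan_unit y"
    using Lan_classify_unit[OF R o(2), of f] f o by (simp only: yoneda_arrow[OF f] representable_simps(1))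
  finally show "Lan_unit x \<cdot>\<^bsub>DLat\<^esub> FArr (Sub_functor C) f
      = FArr (comp_functor (op_cat C) Lan (yoneda C)) f \<cdot>\<^bsub>DLat\<^esub> Lan_unit y"
    using homD(1)[OF f] by (simp only: comp_functor_simps(2) op_cat_simps)
qed

context
  fixes G :: "('o, 'u) lattice_functor"
    and \<gamma> :: "'o \<Rightarrow> ('u set gorder, 'u set \<Rightarrow> 'u set) arrow"
  assumes G: "is_functor SF DLat G"
    and \<gamma>: "nat_trans (op_cat C) DLat (Sub_functor C) (comp_functor (op_cat C) G (yoneda C)) \<gamma>"
begin

interpretation G: is_functor SF DLat G by (rule G)
interpretation \<gamma>: nat_trans "op_cat C" DLat "Sub_functor C" "comp_functor (op_cat C) G (yoneda C)" \<gamma> by (rule \<gamma>)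

text \<open>
  A transformation from \<open>Lan\<close> to \<open>G\<close> with composite \<open>\<gamma>\<close> must have this composite with the leg at
  \<open>(x, a)\<close>, because of \<open>Lan_classify_unit\<close> and naturality at the classifying transformation.
\<close>

definition Lan_cocone :: "('o, 'u) set_functor \<Rightarrow> 'o \<times> 'u \<Rightarrow> ('u set gorder, 'u set \<Rightarrow> 'u set) arrow" where
  "Lan_cocone M = (\<lambda>(x, a). FArr G (classify M x a) \<cdot>\<^bsub>DLat\<^esub> \<gamma> x)"

lemma component_in_hom: "x \<in> Obj C \<Longrightarrow> \<gamma> x \<in> hom DLat (Sub C x) (FObj G (representable C x))"
  using \<gamma>.component_in[of x] by (simp add: yoneda_obj)

lemma Lan_cocone_in_hom:
  assumes "is_functor C SetCat M" "x \<in> Obj C" "a \<in> FObj M x"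
  shows "Lan_cocone M (x, a) \<in> hom DLat (Sub C x) (FObj G M)"
  unfolding Lan_cocone_def prod.case
  by (rule G.target.Comp_in[OF component_in_hom[OF assms(2)] G.FArr_in[OF classify_in_hom[OF assms]]])

lemma Lan_cocone_natural:
  assumes M: "is_functor C SetCat M" and f: "f \<in> hom C x y" and a: "a \<in> FObj M x"
  shows "Lan_cocone M (x, a) \<cdot>\<^bsub>DLat\<^esub> FArr (Sub_functor C) f = Lan_cocone M (y, fn (FArr M f) a)"
proof -
  note o = hom_Obj[OF f] and cl = classify_in_hom[OF M hom_Obj(1)[OF f] a]
  note Y = yoneda_arrow_in_hom[OF f]
  have "Lan_cocone M (x, a) \<cdot>\<^bsub>DLat\<^esub> FArr (Sub_functor C) f
      = FArr G (classify M x a) \<cdot>\<^bsub>DLat\<^esub> (\<gamma> x \<cdot>\<^bsub>DLat\<^esub> FArr (Sub_functor C) f)"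
    unfolding Lan_cocone_def prod.case
    by (rule G.target.Comp_assoc[OF Sub_arrow_in_hom[OF f] component_in_hom[OF o(1)] G.FArr_in[OF cl], symmetric])
  also have "\<gamma> x \<cdot>\<^bsub>DLat\<^esub> FArr (Sub_functor C) f = FArr G (FArr (yoneda C) f) \<cdot>\<^bsub>DLat\<^esub> \<gamma> y"
    using \<gamma>.naturality[of f y x] f homD(1)[OF f] by (simp only: hom_op_cat comp_functor_simps(2) op_cat_simps)
  also have "FArr G (classify M x a) \<cdot>\<^bsub>DLat\<^esub> (FArr G (FArr (yoneda C) f) \<cdot>\<^bsub>DLat\<^esub> \<gamma> y)
      = FArr G (classify M x a \<cdot>\<^bsub>SF\<^esub> FArr (yoneda C) f) \<cdot>\<^bsub>DLat\<^esub> \<gamma> y"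
    unfolding G.FArr_Comp[OF Y cl]
    by (rule G.target.Comp_assoc[OF component_in_hom[OF o(2)] G.FArr_in[OF Y] G.FArr_in[OF cl]])
  finally show ?thesis by (simp only: classify_yoneda[OF M f a] Lan_cocone_def prod.case)
qed

definition Lan_induced :: "('o, 'u) set_functor \<Rightarrow> ('u set gorder, 'u set \<Rightarrow> 'u set) arrow" where
  "Lan_induced = (\<lambda>M\<in>Obj SF. THE h. h \<in> hom DLat (L_obj (C, M)) (FObj G M) \<and>
     (\<forall>(x, a) \<in> Obj (elements C M). h \<cdot>\<^bsub>DLat\<^esub> L_in (C, M) (x, a) = Lan_cocone M (x, a)))"

lemma Lan_induced:
  assumes M: "is_functor C SetCat M"
  shows Lan_induced_in_hom: "Lan_induced M \<in> hom DLat (L_obj (C, M)) (FObj G M)"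
    and Lan_induced_L_in: "\<And>x a. x \<in> Obj C \<Longrightarrow> a \<in> FObj M x \<Longrightarrow>
      Lan_induced M \<cdot>\<^bsub>DLat\<^esub> L_in (C, M) (x, a) = Lan_cocone M (x, a)"
proof -
  have "distributive_lattice (FObj G M)" using G.FObj_in[of M] M by simp
  note u = L_universal[OF M this Lan_cocone_in_hom[OF M] Lan_cocone_natural[OF M]]
  have "Lan_induced M = (THE h. h \<in> hom DLat (L_obj (C, M)) (FObj G M) \<and>
     (\<forall>(x, a) \<in> Obj (elements C M). h \<cdot>\<^bsub>DLat\<^esub> L_in (C, M) (x, a) = Lan_cocone M (x, a)))"
    by (simp only: Lan_induced_def restrict_apply Obj_SF M if_True)
  with theI'[OF u] show "Lan_induced M \<in> hom DLat (L_obj (C, M)) (FObj G M)"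
    "\<And>x a. x \<in> Obj C \<Longrightarrow> a \<in> FObj M x \<Longrightarrow>
      Lan_induced M \<cdot>\<^bsub>DLat\<^esub> L_in (C, M) (x, a) = Lan_cocone M (x, a)"
    by (auto simp del: DLat_simps)
qed

lemma nat_trans_Lan_induced: "nat_trans SF DLat Lan G Lan_induced"
proof (intro nat_trans.intro is_functor_Lan G nat_trans_axioms.intro)
  show "Lan_induced \<in> extensional (Obj SF)" by (simp add: Lan_induced_def)
  show "Lan_induced M \<in> hom DLat (FObj Lan M) (FObj G M)" if "M \<in> Obj SF" for M
    using that Lan_induced_in_hom[of M] by (simp only: Obj_SF Lan_obj)
  fix t M N assume t: "t \<in> hom SF M N"
  note MN = SF_functors[OF t]
  note K = Lan_arr_in_hom[OF t] and I = Lan_induced_in_hom[OF MN(1)] Lan_induced_in_hom[OF MN(2)]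
    and Gt = G.FArr_in[OF t]
  show "Lan_induced N \<cdot>\<^bsub>DLat\<^esub> FArr Lan t = FArr G t \<cdot>\<^bsub>DLat\<^esub> Lan_induced M"
  proof (rule L_eqI[OF MN(1) G.target.Comp_in[OF K I(2)] G.target.Comp_in[OF I(1) Gt]])
    fix x a assume x: "x \<in> Obj C" and a: "a \<in> FObj M x"
    note ta = set_nat_trans(1)[OF t x a] and cl = classify_in_hom[OF MN(1) x a]
    have "(Lan_induced N \<cdot>\<^bsub>DLat\<^esub> FArr Lan t) \<cdot>\<^bsub>DLat\<^esub> L_in (C, M) (x, a)
        = Lan_induced N \<cdot>\<^bsub>DLat\<^esub> L_in (C, N) (x, fn (fn t x) a)"
      by (simp only: G.target.Comp_assoc[OF L_in_hom[OF MN(1) x a] K I(2), symmetric] Lan_arr_L_in[OF t x a])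
    also have "\<dots> = FArr G (t \<cdot>\<^bsub>SF\<^esub> classify M x a) \<cdot>\<^bsub>DLat\<^esub> \<gamma> x"
      by (simp only: Lan_induced_L_in[OF MN(2) x ta] Lan_cocone_def prod.case classify_comp[OF t x a])
    also have "\<dots> = FArr G t \<cdot>\<^bsub>DLat\<^esub> Lan_cocone M (x, a)"
      by (simp only: G.FArr_Comp[OF cl t] Lan_cocone_def prod.case
        G.target.Comp_assoc[OF component_in_hom[OF x] G.FArr_in[OF cl] Gt])
    also have "\<dots> = (FArr G t \<cdot>\<^bsub>DLat\<^esub> Lan_induced M) \<cdot>\<^bsub>DLat\<^esub> L_in (C, M) (x, a)"
      by (simp only: G.target.Comp_assoc[OF L_in_hom[OF MN(1) x a] I(1) Gt, symmetric] Lan_induced_L_in[OF MN(1) x a])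
    finally show "(Lan_induced N \<cdot>\<^bsub>DLat\<^esub> FArr Lan t) \<cdot>\<^bsub>DLat\<^esub> L_in (C, M) (x, a)
        = (FArr G t \<cdot>\<^bsub>DLat\<^esub> Lan_induced M) \<cdot>\<^bsub>DLat\<^esub> L_in (C, M) (x, a)" .
  qed
qed

lemma Lan_induced_unit:
  assumes x: "x \<in> Obj C"
  shows "Lan_induced (FObj (yoneda C) x) \<cdot>\<^bsub>DLat\<^esub> Lan_unit x = \<gamma> x"
proof -
  note R = is_functor_representable[OF x]
  have I: "Ident C x \<in> FObj (representable C x) x" using Ident_in[OF x] x by simp
  have "Lan_induced (representable C x) \<cdot>\<^bsub>DLat\<^esub> Lan_unit x = Lan_cocone (representable C x) (x, Ident C x)"
    using Lan_induced_L_in[OF R x I] by (simp only: Lan_unit_def restrict_apply x if_True)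
  also have "\<dots> = FArr G (Ident SF (representable C x)) \<cdot>\<^bsub>DLat\<^esub> \<gamma> x"
    by (simp only: Lan_cocone_def prod.case classify_Ident[OF x])
  also have "\<dots> = \<gamma> x"
    using G.FArr_Ident[of "representable C x"] R G.target.Ident_left[OF component_in_hom[OF x]] by (simp only: Obj_SF)
  finally show ?thesis by (simp only: yoneda_obj[OF x])
qed

lemma Lan_induced_unique:
  assumes \<sigma>: "nat_trans SF DLat Lan G \<sigma>"
    and unit: "\<And>x. x \<in> Obj C \<Longrightarrow> \<sigma> (FObj (yoneda C) x) \<cdot>\<^bsub>DLat\<^esub> Lan_unit x = \<gamma> x"
  shows "\<sigma> = Lan_induced"
proof -
  interpret \<sigma>: nat_trans SF DLat Lan G \<sigma> by (rule \<sigma>)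
  show ?thesis
  proof (rule extensionalityI[OF \<sigma>.ext])
    show "Lan_induced \<in> extensional (Obj SF)" by (simp add: Lan_induced_def)
    fix M assume MO: "M \<in> Obj SF"
    then have M: "is_functor C SetCat M" by simp
    have \<sigma>M: "\<sigma> N \<in> hom DLat (L_obj (C, N)) (FObj G N)" if "is_functor C SetCat N" for N
      using \<sigma>.component_in[of N] that by (simp only: Obj_SF Lan_obj)
    show "\<sigma> M = Lan_induced M"
    proof (rule L_eqI[OF M \<sigma>M[OF M] Lan_induced_in_hom[OF M]])
      fix x a assume x: "x \<in> Obj C" and a: "a \<in> FObj M x"
      note cl = classify_in_hom[OF M x a] and R = is_functor_representable[OF x]
      note u = Lan_unit_in_hom[OF x]
      have "\<sigma> M \<cdot>\<^bsub>DLat\<^esub> L_in (C, M) (x, a) = \<sigma> M \<cdot>\<^bsub>DLat\<^esub> (FArr Lan (classify M x a) \<cdot>\<^bsub>DLat\<^esub> Lan_unit x)"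
        by (simp only: Lan_classify_unit[OF M x a])
      also have "\<dots> = (\<sigma> M \<cdot>\<^bsub>DLat\<^esub> FArr Lan (classify M x a)) \<cdot>\<^bsub>DLat\<^esub> Lan_unit x"
        by (rule G.target.Comp_assoc[OF u Lan_arr_in_hom[OF cl] \<sigma>M[OF M]])
      also have "\<dots> = (FArr G (classify M x a) \<cdot>\<^bsub>DLat\<^esub> \<sigma> (representable C x)) \<cdot>\<^bsub>DLat\<^esub> Lan_unit x"
        by (simp only: \<sigma>.naturality[OF cl])
      also have "\<dots> = FArr G (classify M x a) \<cdot>\<^bsub>DLat\<^esub> (\<sigma> (representable C x) \<cdot>\<^bsub>DLat\<^esub> Lan_unit x)"
        by (rule G.target.Comp_assoc[OF u \<sigma>M[OF R] G.FArr_in[OF cl], symmetric])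
      also have "\<dots> = Lan_cocone M (x, a)"
        using unit[OF x] by (simp only: yoneda_obj[OF x] Lan_cocone_def prod.case)
      finally show "\<sigma> M \<cdot>\<^bsub>DLat\<^esub> L_in (C, M) (x, a) = Lan_induced M \<cdot>\<^bsub>DLat\<^esub> L_in (C, M) (x, a)"
        by (simp only: Lan_induced_L_in[OF M x a])
    qed
  qed
qed

end

theorem is_Lan_Y_Sub_Lan: "is_Lan_Y_Sub C Lan Lan_unit"
  unfolding is_left_kan_extension_def
proof (intro conjI allI impI is_functor_yoneda is_functor_Sub is_functor_Lan nat_trans_Lan_unit)
  fix G :: "('o, 'u) lattice_functor" and \<gamma>
  assume *: "is_functor SF DLat G \<and>
    nat_trans (op_cat C) DLat (Sub_functor C) (comp_functor (op_cat C) G (yoneda C)) \<gamma>"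
  note G = conjunct1[OF *] conjunct2[OF *]
  show "\<exists>!\<sigma>. nat_trans SF DLat Lan G \<sigma> \<and>
      (\<forall>x \<in> Obj (op_cat C). \<sigma> (FObj (yoneda C) x) \<cdot>\<^bsub>DLat\<^esub> Lan_unit x = \<gamma> x)"
  proof (rule ex1I[of _ "Lan_induced G \<gamma>"])
    show "nat_trans SF DLat Lan G (Lan_induced G \<gamma>) \<and>
        (\<forall>x \<in> Obj (op_cat C). Lan_induced G \<gamma> (FObj (yoneda C) x) \<cdot>\<^bsub>DLat\<^esub> Lan_unit x = \<gamma> x)"
      using nat_trans_Lan_induced[OF G] Lan_induced_unit[OF G] unfolding op_cat_simps by blast
    show "\<sigma> = Lan_induced G \<gamma>" if "nat_trans SF DLat Lan G \<sigma> \<and>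
        (\<forall>x \<in> Obj (op_cat C). \<sigma> (FObj (yoneda C) x) \<cdot>\<^bsub>DLat\<^esub> Lan_unit x = \<gamma> x)" for \<sigma>
      using that Lan_induced_unique[OF G] unfolding op_cat_simps by blast
  qed
qed

end

section \<open>Uniqueness of left Kan extensions\<close>

text \<open>
  The universal properties yield comparison maps in both directions. Their composites are compatible
  with the units, as are the identities, so the uniqueness part makes them identities.
\<close>

lemma left_kan_extension_unique:
  fixes K K' :: "('b, 'g, 'e, 'h) func"
  assumes K: "is_left_kan_extension A B E Y F K u" and K': "is_left_kan_extension A B E Y F K' u'"
  shows "naturally_isomorphic B E K K'"
proof -
  have Y: "is_functor A B Y" and F: "is_functor A E F" and KF: "is_functor B E K" "is_functor B E K'"
    using K K' by (simp_all add: is_left_kan_extension_def)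
  interpret Y: is_functor A B Y by (rule Y)
  interpret F: is_functor A E F by (rule F)
  have u: "nat_trans A E F (comp_functor A K Y) u" "nat_trans A E F (comp_functor A K' Y) u'"
    using K K' by (simp_all add: is_left_kan_extension_def)
  have inverse: "\<theta> X \<cdot>\<^bsub>E\<^esub> \<eta> X = Ident E (FObj P X)"
    if P: "is_left_kan_extension A B E Y F P p" and \<eta>: "nat_trans B E P Q \<eta>" and \<theta>: "nat_trans B E Q P \<theta>"
      and pq: "\<And>x. x \<in> Obj A \<Longrightarrow> \<eta> (FObj Y x) \<cdot>\<^bsub>E\<^esub> p x = q x" "\<And>x. x \<in> Obj A \<Longrightarrow> \<theta> (FObj Y x) \<cdot>\<^bsub>E\<^esub> q x = p x"
      and X: "X \<in> Obj B" for P Q :: "('b, 'g, 'e, 'h) func" and p q \<eta> \<theta> X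
  proof -
    have PF: "is_functor B E P" and p: "nat_trans A E F (comp_functor A P Y) p"
      using P by (simp_all add: is_left_kan_extension_def)
    have ph: "p x \<in> hom E (FObj F x) (FObj P (FObj Y x))" if "x \<in> Obj A" for x
      using nat_trans.component_in[OF p that] that by simp
    let ?c = "\<lambda>X\<in>Obj B. \<theta> X \<cdot>\<^bsub>E\<^esub> \<eta> X" and ?i = "\<lambda>X\<in>Obj B. Ident E (FObj P X)"
    have "\<exists>!\<sigma>. nat_trans B E P P \<sigma> \<and> (\<forall>x \<in> Obj A. \<sigma> (FObj Y x) \<cdot>\<^bsub>E\<^esub> p x = p x)"
      using P PF p unfolding is_left_kan_extension_def by blast
    moreover have "nat_trans B E P P ?c" by (rule nat_trans_comp[OF \<eta> \<theta>])
    moreover have "?c (FObj Y x) \<cdot>\<^bsub>E\<^esub> p x = p x" if x: "x \<in> Obj A" for x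
    proof -
      note Yx = Y.FObj_in[OF x]
      have "(\<theta> (FObj Y x) \<cdot>\<^bsub>E\<^esub> \<eta> (FObj Y x)) \<cdot>\<^bsub>E\<^esub> p x = \<theta> (FObj Y x) \<cdot>\<^bsub>E\<^esub> (\<eta> (FObj Y x) \<cdot>\<^bsub>E\<^esub> p x)"
        by (rule F.target.Comp_assoc[OF ph[OF x] nat_trans.component_in[OF \<eta> Yx]
              nat_trans.component_in[OF \<theta> Yx], symmetric])
      then show ?thesis using Yx x by (simp add: pq)
    qed
    moreover have "nat_trans B E P P ?i" by (rule nat_trans_id[OF PF])
    moreover have "?i (FObj Y x) \<cdot>\<^bsub>E\<^esub> p x = p x" if x: "x \<in> Obj A" for x
      using Y.FObj_in[OF x] F.target.Ident_left[OF ph[OF x]] by simp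
    ultimately have "?c = ?i" by blast
    then have "?c X = ?i X" by (rule fun_cong)
    with X show ?thesis by simp
  qed
  obtain \<sigma> where \<sigma>: "nat_trans B E K K' \<sigma>" "\<And>x. x \<in> Obj A \<Longrightarrow> \<sigma> (FObj Y x) \<cdot>\<^bsub>E\<^esub> u x = u' x"
    using K KF(2) u(2) unfolding is_left_kan_extension_def by blast
  obtain \<tau> where \<tau>: "nat_trans B E K' K \<tau>" "\<And>x. x \<in> Obj A \<Longrightarrow> \<tau> (FObj Y x) \<cdot>\<^bsub>E\<^esub> u' x = u x"
    using K' KF(1) u(1) unfolding is_left_kan_extension_def by blast
  have "is_iso E (\<sigma> X)" if X: "X \<in> Obj B" for X
  proof -
    have "\<sigma> X \<in> hom E (FObj K X) (FObj K' X)" by (rule nat_trans.component_in[OF \<sigma>(1) X])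
    moreover have "\<tau> X \<in> hom E (FObj K' X) (FObj K X)" by (rule nat_trans.component_in[OF \<tau>(1) X])
    moreover have "\<tau> X \<cdot>\<^bsub>E\<^esub> \<sigma> X = Ident E (FObj K X)" by (rule inverse[OF K \<sigma>(1) \<tau>(1) \<sigma>(2) \<tau>(2) X])
    moreover have "\<sigma> X \<cdot>\<^bsub>E\<^esub> \<tau> X = Ident E (FObj K' X)" by (rule inverse[OF K' \<tau>(1) \<sigma>(1) \<tau>(2) \<sigma>(2) X])
    ultimately show ?thesis unfolding is_iso_def by (auto simp: homD intro!: bexI[of _ "\<tau> X"])
  qed
  with \<sigma>(1) show ?thesis unfolding naturally_isomorphic_def by blast
qed

lemma naturally_isomorphic_full_subcategory:
  fixes B :: "('b, 'g) cat" and K K' :: "('b, 'g, 'e, 'h) func" and P :: "'b \<Rightarrow> bool"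
  assumes "naturally_isomorphic B E K K'"
  defines "S \<equiv> full_subcategory B P"
  shows "naturally_isomorphic S E (comp_functor S K (id_functor S)) (comp_functor S K' (id_functor S))"
proof -
  obtain \<eta> where \<eta>: "nat_trans B E K K' \<eta>" "\<And>X. X \<in> Obj B \<Longrightarrow> is_iso E (\<eta> X)"
    using assms(1) by (auto simp: naturally_isomorphic_def)
  interpret \<eta>: nat_trans B E K K' \<eta> by fact
  have I: "is_functor S B (id_functor S)"
    unfolding S_def by (rule is_functor_full_subcategory_inclusion[OF \<eta>.F.source.category_axioms])
  have SB: "X \<in> Obj B" if "X \<in> Obj S" for X using that by (simp add: S_def)
  have "nat_trans S E (comp_functor S K (id_functor S)) (comp_functor S K' (id_functor S)) (\<lambda>X\<in>Obj S. \<eta> X)"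
  proof (intro nat_trans.intro is_functor_comp[OF I] \<eta>.F.is_functor_axioms \<eta>.G.is_functor_axioms nat_trans_axioms.intro)
    show "(\<lambda>X\<in>Obj S. \<eta> X) X \<in> hom E (FObj (comp_functor S K (id_functor S)) X)
        (FObj (comp_functor S K' (id_functor S)) X)" if "X \<in> Obj S" for X
      using that \<eta>.component_in[OF SB[OF that]] by simp
    fix f X Z assume f: "f \<in> hom S X Z"
    then have fB: "f \<in> hom B X Z" by (simp add: S_def hom_full_subcategory)
    have o: "X \<in> Obj S" "Z \<in> Obj S"
      using f \<eta>.F.source.hom_Obj[OF fB] by (simp_all add: S_def hom_full_subcategory)
    show "(\<lambda>X\<in>Obj S. \<eta> X) Z \<cdot>\<^bsub>E\<^esub> FArr (comp_functor S K (id_functor S)) f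
        = FArr (comp_functor S K' (id_functor S)) f \<cdot>\<^bsub>E\<^esub> (\<lambda>X\<in>Obj S. \<eta> X) X"
      using \<eta>.naturality[OF fB] o homD(1)[OF f] by simp
  qed simp
  then show ?thesis
    unfolding naturally_isomorphic_def using \<eta>(2) SB by (intro exI[of _ "\<lambda>X\<in>Obj S. \<eta> X"]) simp
qed

section \<open>The fibre of the 2-functor\<close>

context small_coherent_category
begin

lemma fibre_arrow_is_model_map:
  assumes "t \<in> Arr (Coh C)"
  shows "is_model_map (fibre_arrow t)"
proof -
  have t: "nat_trans C SetCat (src t) (tgt t) (fn t)" "coherent_functor C SetCat (src t)"
    "coherent_functor C SetCat (tgt t)"
    using assms by (simp_all add: Coh_def)
  from t(1) have "is_functor C SetCat (tgt t)" by (simp add: nat_trans_def)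
  then have "comp_functor C (tgt t) (id_functor C) = tgt t" by (rule comp_id_functor)
  with t show ?thesis
    by (simp add: fibre_arrow_def coherent_functor_id coherent_category_axioms)
qed

text \<open>
  On coherent functors and transformations between them, \<open>Lan\<close> is defined by the formulas of
  \<open>L_functor\<close>; the point to check is that the fibre inclusion lands in the domain of
  \<open>L_functor\<close>, outside of which the latter is \<open>undefined\<close>.
\<close>

lemma L_fibre_eq_Lan: "L_fibre C = comp_functor (Coh C) Lan (id_functor (Coh C))"
  unfolding L_fibre_def
proof (rule func_eqI[OF comp_functor_ext(1) comp_functor_ext(1) comp_functor_ext(2) comp_functor_ext(2)])
  fix M assume M: "M \<in> Obj (Coh C)"
  then have "is_functor C SetCat M" "coherent_functor C SetCat M" by (simp_all add: Coh_def)
  then have "FObj L_functor (FObj (fibre_inclusion C) M) = L_obj (C, M)" "FObj Lan M = L_obj (C, M)"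
    using M coherent_category_axioms
    by (simp_all add: L_functor_def fibre_inclusion_def Coh_e_Set_def Lan_obj)
  then show "FObj (comp_functor (Coh C) L_functor (fibre_inclusion C)) M
      = FObj (comp_functor (Coh C) Lan (id_functor (Coh C))) M"
    using M by simp
next
  fix t assume t: "t \<in> Arr (Coh C)"
  then have "t \<in> Arr SF" by (simp add: Coh_def)
  then have Lt: "FArr Lan t = L_arr (fibre_arrow t)" by (simp add: Lan_def)
  have "FArr (fibre_inclusion C) t = fibre_arrow t" using t by (simp add: fibre_inclusion_def fibre_arrow_def)
  moreover have "fibre_arrow t \<in> Arr Coh_e_Set"
    using fibre_arrow_is_model_map[OF t] by (simp add: Coh_e_Set_def)
  ultimately have "FArr L_functor (FArr (fibre_inclusion C) t) = L_arr (fibre_arrow t)"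
    by (simp add: L_functor_def)
  with Lt t show "FArr (comp_functor (Coh C) L_functor (fibre_inclusion C)) t
      = FArr (comp_functor (Coh C) Lan (id_functor (Coh C))) t"
    by simp
qed

end

theorem proposition6p5:
  fixes C :: "('o, 'u) cat"
  assumes "infinite (UNIV :: 'u set)"
    and "coherent_category C"
  shows "(\<exists>K u. is_Lan_Y_Sub C K u \<and>
            L_fibre C = comp_functor (Coh C) K (id_functor (Coh C))) \<and>
         (\<forall>K u. is_Lan_Y_Sub C K u \<longrightarrow>
            naturally_isomorphic (Coh C) DLat
              (L_fibre C) (comp_functor (Coh C) K (id_functor (Coh C))))"
proof -
  interpret small_coherent_category C
    using assms by (simp add: small_coherent_category_def small_coherent_category_axioms_def)
  show ?thesis
  proof (intro conjI exI allI impI)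
    show "is_Lan_Y_Sub C Lan Lan_unit" by (rule is_Lan_Y_Sub_Lan)
    show "L_fibre C = comp_functor (Coh C) Lan (id_functor (Coh C))" by (rule L_fibre_eq_Lan)
    fix K u assume "is_Lan_Y_Sub C K u"
    then have "naturally_isomorphic SF DLat Lan K"
      by (rule left_kan_extension_unique[OF is_Lan_Y_Sub_Lan])
    then show "naturally_isomorphic (Coh C) DLat (L_fibre C) (comp_functor (Coh C) K (id_functor (Coh C)))"
      unfolding L_fibre_eq_Lan Coh_def by (rule naturally_isomorphic_full_subcategory)
  qed
qed

end
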